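(* Let $d\in\mathbb N$, let $\varphi$ be the random dynamical system on $[0,1]^d$ generated by $\mathrm dX^i(t)=X^i(t)(1-X^i(t))\,\mathrm dW^i(t)$, $i=1,\dots,d$, and let $\bar\varphi(t,\omega)=(\varphi(t,\vartheta_{-t}\omega))^{-1}$ be its inverse flow, a random dynamical system over $(\bar\vartheta_t)_{t\in\mathbb R}$ with $\bar\vartheta_t=\vartheta_{-t}$ (see context). Let $b=(b^1,\dots,b^d)$ be the random point with $b^i(\omega)=\sup\{x^i : x\in[0,1]^d,\ \lim_{t\to\infty}\varphi^i(t,\omega)x^i=0\}$. Then the minimal forward point attractor, the minimal pullback point attractor and the minimal weak point attractor of $\bar\varphi$ on $[0,1]^d$ are all given by $$A:=\{P_\alpha(b)\ :\ \alpha\in\{-1,0,1\}^d\}.$$ Furthermore, $b$ is uniformly distributed on $(0,1)^d$.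
   Context: RDS setting. A metric dynamical system (MDS) is a probability space $(\Omega,\mathcal F,\mathbb P)$ with a jointly measurable family of maps $(\vartheta_t)_{t\in\mathbb R}$ preserving $\mathbb P$, with $\vartheta_0=\mathrm{Id}$ and $\vartheta_{t+s}=\vartheta_t\circ\vartheta_s$. A (two-sided) random dynamical system (RDS) on a metric space $(E,\mathrm d)$ is an MDS together with a measurable map $\varphi:\mathbb R\times\Omega\times E\to E$, $(t,\omega,x)\mapsto\varphi(t,\omega)x$, with $\varphi(0,\omega)=\mathrm{Id}_E$ and $\varphi(t+s,\omega)=\varphi(t,\vartheta_s\omega)\circ\varphi(s,\omega)$. The system. $E=[0,1]^d$ with the metric $\mathrm d$ induced by the uniform norm; $(\Omega,\mathcal F,\mathbb P)$ is the $d$-dimensional two-sided Wiener space, $W=(W^1,\dots,W^d)$ the two-sided $d$-dimensional Wiener process, and $(\vartheta_t\omega)_s=\omega_{s+t}-\omega_t$ the Wiener shift. $\varphi$ is the two-sided RDS on $[0,1]^d$, jointly continuous in time and space, such that for $t\ge 0$, $t\mapsto\varphi(t,\cdot)x$ solves the Itô SDE $\mathrm dX^i(t)=X^i(t)(1-X^i(t))\,\mathrm dW^i(t)$, $i=1,\dots,d$, with $X(0)=x$. It acts coordinatewise, $\varphi(t,\omega)x=(\varphi^1(t,\omega)x^1,\dots,\varphi^d(t,\omega)x^d)$, each $\varphi^i(t,\omega)$ being an increasing bijection of $[0,1]$. The inverse flow $\bar\varphi(t,\omega)=(\varphi(t,\vartheta_{-t}\omega))^{-1}$ is an RDS on $[0,1]^d$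 over the MDS $(\Omega,\mathcal F,\mathbb P,(\bar\vartheta_t)_{t\in\mathbb R})$, $\bar\vartheta_t=\vartheta_{-t}$, jointly continuous in time and space. Attractors (for an RDS $\psi$ over $(\theta_t)$). For nonempty $A,B\subseteq E$, $B$ bounded, $\mathrm d(A,B)=\sup_{x\in A}\inf_{y\in B}\mathrm d(x,y)$. A compact random set is a map $A$ from $\Omega$ to subsets of $E$ with $A(\omega)$ compact for each $\omega$ and $\omega\mapsto\mathrm d(x,A(\omega))$ measurable for each $x$; it is strictly $\psi$-invariant if for every $t$, $\psi(t,\omega)A(\omega)=A(\theta_t\omega)$ for $\mathbb P$-almost all $\omega$. For a nonempty family $\mathcal C$ of subsets of $E$, a strictly $\psi$-invariant compact random set $A$ is a forward $\mathcal C$-attractor if for every $C\in\mathcal C$, $\lim_{t\to\infty}\mathrm d(\psi(t,\omega)C,A(\theta_t\omega))=0$ $\mathbb P$-a.s.; a pullback $\mathcal C$-attractor if for every $C\in\mathcal C$, $\lim_{t\to\infty}\mathrm d(\psi(t,\theta_{-t}\omega)C,A(\omega))=0$ $\mathbb P$-a.s.; a weak $\mathcal C$-attractor if for every $C\in\mathcal C$, $\lim_{t\to\infty}\mathrm d(\psi(t,\omega)C,A(\theta_t\omega))=0$ in probability. A point attractor is a $\mathcal C$-attractor with $\mathcal C=\{\{x\}: x\in E\}$. A $\mathcal C$-attractor is minimal if it is contained ($\mathbb P$-almost surely) in any other $\mathcal C$-attractor of the same type (forward, pullback, weak). Faces. For $\alpha\in\{-1,0,1\}^d$ let $\Gamma_\alpha=\{x\in[0,1]^d:\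 \forall i,\ \alpha_i\ne0\Rightarrow x^i=(1+\alpha_i)/2\}$; $P_\alpha$ denotes the orthogonal projection onto $\Gamma_\alpha$, i.e. $(P_\alpha x)^i=x^i$ if $\alpha_i=0$ and $(P_\alpha x)^i=(1+\alpha_i)/2$ otherwise. *)

theory Defs
  imports "HOL-Probability.Probability"
begin

section \<open>Metric and random dynamical systems\<close>

definition metric_dynamical_system ::
  "'a measure \<Rightarrow> (real \<Rightarrow> 'a \<Rightarrow> 'a) \<Rightarrow> bool" where
  "metric_dynamical_system M \<theta> \<longleftrightarrow>
     prob_space M \<and>
     (\<lambda>(t, \<omega>). \<theta> t \<omega>) \<in> measurable (borel \<Otimes>\<^sub>M M) M \<and>
     (\<forall>t. distr M M (\<theta> t) = M) \<and>
     (\<forall>\<omega>\<in>space M. \<theta> 0 \<omega> = \<omega>) \<and>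
     (\<forall>t s. \<forall>\<omega>\<in>space M. \<theta> (t + s) \<omega> = \<theta> t (\<theta> s \<omega>))"

definition metric_borel :: "'e set \<Rightarrow> ('e \<Rightarrow> 'e \<Rightarrow> real) \<Rightarrow> 'e measure" where
  "metric_borel E d = sigma E {U. openin (Metric_space.mtopology E d) U}"

definition random_dynamical_system ::
  "'a measure \<Rightarrow> (real \<Rightarrow> 'a \<Rightarrow> 'a) \<Rightarrow> 'e set \<Rightarrow> ('e \<Rightarrow> 'e \<Rightarrow> real) \<Rightarrow>
   (real \<Rightarrow> 'a \<Rightarrow> 'e \<Rightarrow> 'e) \<Rightarrow> bool" where
  "random_dynamical_system M \<theta> E d \<psi> \<longleftrightarrow>
     metric_dynamical_system M \<theta> \<and>
     Metric_space E d \<and>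
     (\<lambda>(t, \<omega>, x). \<psi> t \<omega> x)
       \<in> measurable (borel \<Otimes>\<^sub>M M \<Otimes>\<^sub>M metric_borel E d) (metric_borel E d) \<and>
     (\<forall>\<omega>\<in>space M. \<forall>x\<in>E. \<psi> 0 \<omega> x = x) \<and>
     (\<forall>t s. \<forall>\<omega>\<in>space M. \<forall>x\<in>E. \<psi> (t + s) \<omega> x = \<psi> t (\<theta> s \<omega>) (\<psi> s \<omega> x))"

definition jointly_continuous ::
  "'a measure \<Rightarrow> 'e set \<Rightarrow> ('e \<Rightarrow> 'e \<Rightarrow> real) \<Rightarrow> (real \<Rightarrow> 'a \<Rightarrow> 'e \<Rightarrow> 'e) \<Rightarrow> bool" where
  "jointly_continuous M E d \<psi> \<longleftrightarrow>
     (\<forall>\<omega>\<in>space M.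
        continuous_map (prod_topology euclideanreal (Metric_space.mtopology E d))
          (Metric_space.mtopology E d) (\<lambda>(t, x). \<psi> t \<omega> x))"

definition inverse_flow ::
  "(real \<Rightarrow> 'a \<Rightarrow> 'a) \<Rightarrow> 'e set \<Rightarrow> (real \<Rightarrow> 'a \<Rightarrow> 'e \<Rightarrow> 'e) \<Rightarrow> real \<Rightarrow> 'a \<Rightarrow> 'e \<Rightarrow> 'e" where
  "inverse_flow \<theta> E \<psi> t \<omega> = inv_into E (\<psi> t (\<theta> (- t) \<omega>))"


section \<open>Attractors\<close>

text \<open>One-sided Hausdorff distance of nonempty sets. The suprema and infima are those of
  type \<^typ>\<open>real\<close>, so the value is meaningful only if the set of distances is bounded; below it
  is applied to subsets of a bounded space.\<close>

definition set_dist :: "('e \<Rightarrow> 'e \<Rightarrow> real) \<Rightarrow> 'e set \<Rightarrow> 'e set \<Rightarrow> real" where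
  "set_dist d A B = (SUP x\<in>A. INF y\<in>B. d x y)"

text \<open>The values of a compact random set are required to be nonempty, since the distance
  \<open>d(x, A(\<omega>))\<close> is only defined for nonempty \<open>A(\<omega>)\<close>.\<close>

definition compact_random_set ::
  "'a measure \<Rightarrow> 'e set \<Rightarrow> ('e \<Rightarrow> 'e \<Rightarrow> real) \<Rightarrow> ('a \<Rightarrow> 'e set) \<Rightarrow> bool" where
  "compact_random_set M E d A \<longleftrightarrow>
     (\<forall>\<omega>\<in>space M. A \<omega> \<noteq> {} \<and> compactin (Metric_space.mtopology E d) (A \<omega>)) \<and>
     (\<forall>x\<in>E. (\<lambda>\<omega>. set_dist d {x} (A \<omega>)) \<in> borel_measurable M)"

definition strictly_invariant ::
  "'a measure \<Rightarrow> (real \<Rightarrow> 'a \<Rightarrow> 'a) \<Rightarrow> (real \<Rightarrow> 'a \<Rightarrow> 'e \<Rightarrow> 'e) \<Rightarrow> ('a \<Rightarrow> 'e set) \<Rightarrow> bool" where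
  "strictly_invariant M \<theta> \<psi> A \<longleftrightarrow> (\<forall>t. AE \<omega> in M. \<psi> t \<omega> ` A \<omega> = A (\<theta> t \<omega>))"

definition forward_attractor ::
  "'a measure \<Rightarrow> (real \<Rightarrow> 'a \<Rightarrow> 'a) \<Rightarrow> 'e set \<Rightarrow> ('e \<Rightarrow> 'e \<Rightarrow> real) \<Rightarrow>
   (real \<Rightarrow> 'a \<Rightarrow> 'e \<Rightarrow> 'e) \<Rightarrow> 'e set set \<Rightarrow> ('a \<Rightarrow> 'e set) \<Rightarrow> bool" where
  "forward_attractor M \<theta> E d \<psi> \<C> A \<longleftrightarrow>
     compact_random_set M E d A \<and> strictly_invariant M \<theta> \<psi> A \<and>
     (\<forall>C\<in>\<C>. AE \<omega> in M. ((\<lambda>t. set_dist d (\<psi> t \<omega> ` C) (A (\<theta> t \<omega>))) \<longlongrightarrow> 0) at_top)"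

definition pullback_attractor ::
  "'a measure \<Rightarrow> (real \<Rightarrow> 'a \<Rightarrow> 'a) \<Rightarrow> 'e set \<Rightarrow> ('e \<Rightarrow> 'e \<Rightarrow> real) \<Rightarrow>
   (real \<Rightarrow> 'a \<Rightarrow> 'e \<Rightarrow> 'e) \<Rightarrow> 'e set set \<Rightarrow> ('a \<Rightarrow> 'e set) \<Rightarrow> bool" where
  "pullback_attractor M \<theta> E d \<psi> \<C> A \<longleftrightarrow>
     compact_random_set M E d A \<and> strictly_invariant M \<theta> \<psi> A \<and>
     (\<forall>C\<in>\<C>. AE \<omega> in M. ((\<lambda>t. set_dist d (\<psi> t (\<theta> (- t) \<omega>) ` C) (A \<omega>)) \<longlongrightarrow> 0) at_top)"

definition tendsto_in_probability ::
  "'a measure \<Rightarrow> (real \<Rightarrow> 'a \<Rightarrow> real) \<Rightarrow> real \<Rightarrow> bool" where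
  "tendsto_in_probability M X c \<longleftrightarrow>
     (\<forall>t\<ge>0. X t \<in> borel_measurable M) \<and>
     (\<forall>\<epsilon>>0. ((\<lambda>t. measure M {\<omega>\<in>space M. \<bar>X t \<omega> - c\<bar> > \<epsilon>}) \<longlongrightarrow> 0) at_top)"

definition weak_attractor ::
  "'a measure \<Rightarrow> (real \<Rightarrow> 'a \<Rightarrow> 'a) \<Rightarrow> 'e set \<Rightarrow> ('e \<Rightarrow> 'e \<Rightarrow> real) \<Rightarrow>
   (real \<Rightarrow> 'a \<Rightarrow> 'e \<Rightarrow> 'e) \<Rightarrow> 'e set set \<Rightarrow> ('a \<Rightarrow> 'e set) \<Rightarrow> bool" where
  "weak_attractor M \<theta> E d \<psi> \<C> A \<longleftrightarrow>
     compact_random_set M E d A \<and> strictly_invariant M \<theta> \<psi> A \<and>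
     (\<forall>C\<in>\<C>. tendsto_in_probability M (\<lambda>t \<omega>. set_dist d (\<psi> t \<omega> ` C) (A (\<theta> t \<omega>))) 0)"

text \<open>Here \<open>Q\<close> is the property of being an attractor of a given type for a given family.\<close>

definition minimal_among ::
  "'a measure \<Rightarrow> (('a \<Rightarrow> 'e set) \<Rightarrow> bool) \<Rightarrow> ('a \<Rightarrow> 'e set) \<Rightarrow> bool" where
  "minimal_among M Q A \<longleftrightarrow> Q A \<and> (\<forall>B. Q B \<longrightarrow> (AE \<omega> in M. A \<omega> \<subseteq> B \<omega>))"

definition singletons :: "'e set \<Rightarrow> 'e set set" where
  "singletons E = (\<lambda>x. {x}) ` E"


section \<open>Two-sided Wiener space\<close>

definition wiener_paths :: "(real \<Rightarrow> real ^ 'd) set" where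
  "wiener_paths = {\<omega>. continuous_on UNIV \<omega> \<and> \<omega> 0 = 0}"

text \<open>The canonical space of the two-sided Wiener process; the \<open>\<sigma>\<close>-algebra generated by the
  evaluations coincides with the Borel \<open>\<sigma>\<close>-algebra of locally uniform convergence. The
  conditions on the increments (over all of \<open>\<real>\<close>) determine the measure uniquely.\<close>

definition wiener_space :: "(real \<Rightarrow> real ^ 'd) measure \<Rightarrow> bool" where
  "wiener_space M \<longleftrightarrow>
     prob_space M \<and>
     space M = wiener_paths \<and>
     sets M = sets (restrict_space (\<Pi>\<^sub>M t\<in>UNIV. borel) wiener_paths) \<and>
     (\<forall>s t i. s < t \<longrightarrow>
        distributed M lborel (\<lambda>\<omega>. \<omega> t $ i - \<omega> s $ i) (normal_density 0 (sqrt (t - s)))) \<and>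
     (\<forall>\<tau> :: nat \<Rightarrow> real. strict_mono \<tau> \<longrightarrow>
        prob_space.indep_vars M (\<lambda>_. borel)
          (\<lambda>(j, i) \<omega>. \<omega> (\<tau> (Suc j)) $ i - \<omega> (\<tau> j) $ i) (UNIV :: (nat \<times> 'd) set))"

definition wiener_shift :: "real \<Rightarrow> (real \<Rightarrow> real ^ 'd) \<Rightarrow> (real \<Rightarrow> real ^ 'd)" where
  "wiener_shift t \<omega> = (\<lambda>s. \<omega> (s + t) - \<omega> t)"

text \<open>The filtration generated by \<open>W\<^sub>s\<close>, \<open>0 \<le> s \<le> t\<close>, augmented by the null sets.\<close>

definition wiener_filtration ::
  "(real \<Rightarrow> real ^ 'd) measure \<Rightarrow> real \<Rightarrow> (real \<Rightarrow> real ^ 'd) measure" where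
  "wiener_filtration M t =
     sigma (space M)
       ({{\<omega>\<in>space M. \<omega> s \<in> U} | s U. 0 \<le> s \<and> s \<le> t \<and> U \<in> sets borel} \<union> null_sets M)"


section \<open>Ito integral and stochastic differential equations\<close>

text \<open>A simple integrand on \<open>[0, T]\<close> takes the bounded value \<open>\<xi> j\<close>, measurable at time \<open>\<tau> j\<close>,
  on \<open>(\<tau> j, \<tau> (j + 1)]\<close>, where \<open>0 = \<tau> 0 \<le> \<dots> \<le> \<tau> n = T\<close>.\<close>

definition simple_integrand ::
  "'a measure \<Rightarrow> (real \<Rightarrow> 'a measure) \<Rightarrow> real \<Rightarrow>
   nat \<Rightarrow> (nat \<Rightarrow> real) \<Rightarrow> (nat \<Rightarrow> 'a \<Rightarrow> real) \<Rightarrow> bool" where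
  "simple_integrand M F T n \<tau> \<xi> \<longleftrightarrow>
     \<tau> 0 = 0 \<and> \<tau> n = T \<and>
     (\<forall>j<n. \<tau> j \<le> \<tau> (Suc j) \<and> \<xi> j \<in> borel_measurable (F (\<tau> j)) \<and>
            (\<exists>K. \<forall>\<omega>\<in>space M. \<bar>\<xi> j \<omega>\<bar> \<le> K))"

definition simple_value ::
  "nat \<Rightarrow> (nat \<Rightarrow> real) \<Rightarrow> (nat \<Rightarrow> 'a \<Rightarrow> real) \<Rightarrow> real \<Rightarrow> 'a \<Rightarrow> real" where
  "simple_value n \<tau> \<xi> s \<omega> = (\<Sum>j<n. \<xi> j \<omega> * indicator {\<tau> j<..\<tau> (Suc j)} s)"

definition simple_integral ::
  "(real \<Rightarrow> 'a \<Rightarrow> real) \<Rightarrow> nat \<Rightarrow> (nat \<Rightarrow> real) \<Rightarrow> (nat \<Rightarrow> 'a \<Rightarrow> real) \<Rightarrow> 'a \<Rightarrow> real" where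
  "simple_integral B n \<tau> \<xi> \<omega> = (\<Sum>j<n. \<xi> j \<omega> * (B (\<tau> (Suc j)) \<omega> - B (\<tau> j) \<omega>))"

text \<open>\<open>I\<close> is a version of the Ito integral \<open>\<integral>\<^sub>0\<^sup>T H dB\<close> of a measurable adapted
  square-integrable process \<open>H\<close>: the \<open>L\<^sup>2(P)\<close>-limit of the integrals of simple integrands
  converging to \<open>H\<close> in \<open>L\<^sup>2([0, T] \<times> P)\<close>. As usual \<open>I\<close> is determined up to null sets.\<close>

definition has_ito_integral ::
  "'a measure \<Rightarrow> (real \<Rightarrow> 'a measure) \<Rightarrow> (real \<Rightarrow> 'a \<Rightarrow> real) \<Rightarrow>
   (real \<Rightarrow> 'a \<Rightarrow> real) \<Rightarrow> real \<Rightarrow> ('a \<Rightarrow> real) \<Rightarrow> bool" where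
  "has_ito_integral M F B H T I \<longleftrightarrow>
     (\<lambda>(s, \<omega>). H s \<omega>) \<in> borel_measurable (restrict_space borel {0..T} \<Otimes>\<^sub>M M) \<and>
     (\<forall>s\<in>{0..T}. H s \<in> borel_measurable (F s)) \<and>
     I \<in> borel_measurable M \<and>
     (\<exists>n \<tau> \<xi>.
        (\<forall>k::nat. simple_integrand M F T (n k) (\<tau> k) (\<xi> k)) \<and>
        (\<lambda>k. \<integral>\<^sup>+ \<omega>. (\<integral>\<^sup>+ s. ennreal ((H s \<omega> - simple_value (n k) (\<tau> k) (\<xi> k) s \<omega>)\<^sup>2)
                * indicator {0..T} s \<partial>lborel) \<partial>M) \<longlonglongrightarrow> 0 \<and>
        (\<lambda>k. \<integral>\<^sup>+ \<omega>. ennreal ((I \<omega> - simple_integral B (n k) (\<tau> k) (\<xi> k) \<omega>)\<^sup>2) \<partial>M)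
           \<longlonglongrightarrow> 0)"

text \<open>\<open>X\<close> is a strong solution of \<open>dX(t) = \<sigma>(X(t)) dB(t)\<close>, \<open>X(0) = x\<close>, on \<open>[0, \<infinity>)\<close>
  (for bounded \<open>\<sigma>(X)\<close>, so that the square-integrable Ito integral suffices).\<close>

definition solves_ito_sde ::
  "'a measure \<Rightarrow> (real \<Rightarrow> 'a measure) \<Rightarrow> (real \<Rightarrow> 'a \<Rightarrow> real) \<Rightarrow>
   (real \<Rightarrow> real) \<Rightarrow> real \<Rightarrow> (real \<Rightarrow> 'a \<Rightarrow> real) \<Rightarrow> bool" where
  "solves_ito_sde M F B \<sigma> x X \<longleftrightarrow>
     (\<forall>\<omega>\<in>space M. continuous_on {0..} (\<lambda>t. X t \<omega>)) \<and>
     (\<forall>t\<ge>0. X t \<in> borel_measurable (F t)) \<and>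
     (\<forall>t\<ge>0. has_ito_integral M F B (\<lambda>s \<omega>. \<sigma> (X s \<omega>)) t (\<lambda>\<omega>. X t \<omega> - x))"


section \<open>The system on the unit cube\<close>

definition unit_cube :: "(real ^ 'd) set" where
  "unit_cube = {x. \<forall>i. 0 \<le> x $ i \<and> x $ i \<le> 1}"

definition uniform_dist :: "real ^ 'd \<Rightarrow> real ^ 'd \<Rightarrow> real" where
  "uniform_dist x y = infnorm (x - y)"

text \<open>The flow acts on the cube through increasing bijections \<open>\<phi>c i t \<omega>\<close> of \<open>[0, 1]\<close>.\<close>

definition acts_coordinatewise ::
  "'a measure \<Rightarrow> (real \<Rightarrow> 'a \<Rightarrow> real ^ 'd \<Rightarrow> real ^ 'd) \<Rightarrow>
   ('d \<Rightarrow> real \<Rightarrow> 'a \<Rightarrow> real \<Rightarrow> real) \<Rightarrow> bool" where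
  "acts_coordinatewise M \<phi> \<phi>c \<longleftrightarrow>
     (\<forall>t. \<forall>\<omega>\<in>space M. \<forall>x\<in>unit_cube. \<phi> t \<omega> x = (\<chi> i. \<phi>c i t \<omega> (x $ i))) \<and>
     (\<forall>i t. \<forall>\<omega>\<in>space M.
        strict_mono_on {0..1} (\<phi>c i t \<omega>) \<and> bij_betw (\<phi>c i t \<omega>) {0..1} {0..1})"

text \<open>\<open>\<phi>\<close> is the two-sided random dynamical system on the cube generated by
  \<open>dX\<^sup>i = X\<^sup>i (1 - X\<^sup>i) dW\<^sup>i\<close>, with coordinate flows \<open>\<phi>c\<close>.\<close>

definition generated_rds ::
  "(real \<Rightarrow> real ^ 'd) measure \<Rightarrow>
   (real \<Rightarrow> (real \<Rightarrow> real ^ 'd) \<Rightarrow> real ^ 'd \<Rightarrow> real ^ 'd) \<Rightarrow>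
   ('d \<Rightarrow> real \<Rightarrow> (real \<Rightarrow> real ^ 'd) \<Rightarrow> real \<Rightarrow> real) \<Rightarrow> bool" where
  "generated_rds M \<phi> \<phi>c \<longleftrightarrow>
     random_dynamical_system M wiener_shift unit_cube uniform_dist \<phi> \<and>
     jointly_continuous M unit_cube uniform_dist \<phi> \<and>
     acts_coordinatewise M \<phi> \<phi>c \<and>
     (\<forall>x\<in>unit_cube. \<forall>i.
        solves_ito_sde M (wiener_filtration M) (\<lambda>t \<omega>. \<omega> t $ i) (\<lambda>y. y * (1 - y))
          (x $ i) (\<lambda>t \<omega>. \<phi> t \<omega> x $ i))"

text \<open>Orthogonal projection onto the face
  \<open>{x \<in> [0, 1]\<^sup>d. \<forall>i. \<alpha>\<^sub>i \<noteq> 0 \<longrightarrow> x\<^sup>i = (1 + \<alpha>\<^sub>i) / 2}\<close>.\<close>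

definition face_proj :: "int ^ 'd \<Rightarrow> real ^ 'd \<Rightarrow> real ^ 'd" where
  "face_proj \<alpha> x = (\<chi> i. if \<alpha> $ i = 0 then x $ i else (1 + real_of_int (\<alpha> $ i)) / 2)"

definition basin_point ::
  "('d \<Rightarrow> real \<Rightarrow> 'a \<Rightarrow> real \<Rightarrow> real) \<Rightarrow> 'a \<Rightarrow> real ^ 'd" where
  "basin_point \<phi>c \<omega> =
     (\<chi> i. Sup {x $ i | x :: real ^ 'd.
                 x \<in> unit_cube \<and> ((\<lambda>t. \<phi>c i t \<omega> (x $ i)) \<longlongrightarrow> 0) at_top})"

end

theory Submission
  imports Defs
begin

text \<open>The inverse flow is \<open>\<phi>\<close> run backwards: on the cube its time-\<open>t\<close> map at \<open>\<omega>\<close> is \<open>\<phi> (- t) \<omega>\<close>, and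
  its pullback map, from time \<open>- t\<close> to time \<open>0\<close>, is the inverse of \<open>\<phi> t \<omega>\<close>. Everything is
  determined by the forward behaviour of the coordinate flows. A coordinate \<open>X\<close> of a solution is a
  martingale in \<open>[0, 1]\<close> and its accumulated variance, the mean of the integral of \<open>(X (1 - X))\<^sup>2\<close>, is
  bounded; so it converges almost surely, to \<open>0\<close> or \<open>1\<close>, and the limit is \<open>1\<close> with probability \<open>X 0\<close>
  (\<open>solutions_limits\<close>). By monotonicity in the initial value, starting points below \<open>b\<^sup>i\<close> tend to \<open>0\<close> and
  those above tend to \<open>1\<close>. Hence \<open>b\<^sup>i \<le> c\<close> has probability \<open>c\<close>, and since the coordinates are driven
  by independent Wiener processes, \<open>b\<close> is uniform on the cube (\<open>b_distribution\<close>).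

  The set \<open>A\<close> consists of the points with coordinates in \<open>{0, b\<^sup>i, 1}\<close>. It is invariant because the
  basin of \<open>0\<close> is carried along by the flow, \<open>b (\<theta> t \<omega>) = \<phi> t \<omega> (b \<omega>)\<close>. It is a pullback attractor
  because \<open>\<phi> t\<close> squeezes everything below \<open>b\<^sup>i\<close> to \<open>0\<close> and everything above to \<open>1\<close>, so that its inverse
  sends every interior point close to \<open>b\<^sup>i\<close> (\<open>pullback_to_b\<close>). Shift invariance of the Wiener measure
  turns this into forward attraction in probability. For almost sure forward attraction a monotone
  quantity is needed: by Ito's formula \<open>Y = ln (X / (1 - X))\<close> solves \<open>dY = dW + (X - 1/2) dt\<close>, so in this
  coordinate two solutions drift apart, and under the inverse flow they approach each other. A
  monotone quantity that tends to \<open>0\<close> in probability tends to \<open>0\<close> almost surely (\<open>forward_to_b\<close>).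
  For minimality, attractors of all three types attract points in probability, and for every \<open>\<alpha>\<close>
  there is a point that the inverse flow pulls to \<open>P\<^sub>\<alpha> b\<close>; as the values of an attractor are closed,
  they contain \<open>P\<^sub>\<alpha> b\<close> (\<open>att_minimal\<close>).

  The stochastic analysis rests on two facts about the Ito integral only: the isometry and the
  orthogonality to the past. Ito's formula is replaced by the Euler scheme
  \<open>x \<mapsto> x + x (1 - x) w\<close>, where \<open>w\<close> is an increment of the Wiener process truncated to
  \<open>[- 1/2, 1/2]\<close>. It converges to the solution in mean square (\<open>euler_converges\<close>), and the distance of
  two solutions in the logarithmic coordinate does not decrease in any single Euler step
  (\<open>separation_euler_step\<close>). The scheme also exhibits the solutions as limits of functions of
  increments of their own driving process, which gives the independence of the coordinates.\<close>

section \<open>Increments of the Wiener process\<close>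

lemma borel_measurable_vecI:
  fixes f :: "'a \<Rightarrow> real ^ 'n"
  assumes "\<And>i. (\<lambda>x. f x $ i) \<in> borel_measurable N"
  shows "f \<in> borel_measurable N"
proof (subst borel_measurable_euclidean_space, intro ballI)
  fix e :: "real ^ 'n" assume "e \<in> Basis"
  then obtain i where "e = axis i 1" by (auto simp: Basis_vec_def)
  then show "(\<lambda>x. f x \<bullet> e) \<in> borel_measurable N" using assms[of i] by (simp add: inner_axis)
qed

locale wiener =
  fixes M :: "(real \<Rightarrow> real ^ 'd) measure"
  assumes wiener: "wiener_space M"
begin

sublocale prob_space M
  using wiener by (simp add: wiener_space_def)

abbreviation increment :: "'d \<Rightarrow> real \<Rightarrow> real \<Rightarrow> (real \<Rightarrow> real ^ 'd) \<Rightarrow> real" where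
  "increment i s t \<omega> \<equiv> \<omega> t $ i - \<omega> s $ i"

abbreviation "\<F> \<equiv> wiener_filtration M"

lemma space_M: "space M = wiener_paths"
  using wiener by (simp add: wiener_space_def)

lemma evaluation_measurable [measurable]: "(\<lambda>\<omega>. \<omega> t) \<in> borel_measurable M"
proof -
  have "(\<lambda>\<omega>. \<omega> t) \<in> measurable (\<Pi>\<^sub>M t\<in>UNIV. (borel :: (real ^ 'd) measure)) borel"
    by measurable
  then have "(\<lambda>\<omega>. \<omega> t) \<in> measurable (restrict_space (\<Pi>\<^sub>M t\<in>UNIV. (borel :: (real ^ 'd) measure)) wiener_paths) borel"
    by (rule measurable_restrict_space1)
  moreover have "sets M = sets (restrict_space (\<Pi>\<^sub>M t\<in>UNIV. (borel :: (real ^ 'd) measure)) wiener_paths)"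
    using wiener by (simp add: wiener_space_def)
  ultimately show ?thesis
    using measurable_cong_sets by blast
qed

lemma evaluation_nth_measurable [measurable]: "(\<lambda>\<omega>. \<omega> t $ i) \<in> borel_measurable M"
  by (rule measurable_compose[OF evaluation_measurable borel_measurable_nth])

lemma space_filtration [simp]: "space (\<F> t) = space M"
  by (simp add: wiener_filtration_def space_measure_of_conv)

lemma filtration_generators:
  "{{\<omega>\<in>space M. \<omega> s \<in> U} | s U. 0 \<le> s \<and> s \<le> t \<and> U \<in> sets borel} \<union> null_sets M \<subseteq> sets M"
  by auto

lemma sets_filtration:
  "sets (\<F> t) = sigma_sets (space M)
     ({{\<omega>\<in>space M. \<omega> s \<in> U} | s U. 0 \<le> s \<and> s \<le> t \<and> U \<in> sets borel} \<union> null_sets M)"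
  unfolding wiener_filtration_def
  by (rule sets_measure_of) (use filtration_generators[of t] sets.sets_into_space in blast)

lemma subalgebra_filtration: "subalgebra M (\<F> t)"
  unfolding subalgebra_def sets_filtration
  using sets.sigma_sets_subset[OF filtration_generators] by simp

lemma filtration_mono: "s \<le> t \<Longrightarrow> subalgebra (\<F> t) (\<F> s)"
  unfolding subalgebra_def sets_filtration
  by (simp, rule sigma_sets_mono') fastforce

lemma filtration_measurable_mono:
  "f \<in> borel_measurable (\<F> s) \<Longrightarrow> s \<le> t \<Longrightarrow> f \<in> borel_measurable (\<F> t)"
  using measurable_from_subalg[OF filtration_mono] by blast

lemma filtration_measurable: "f \<in> borel_measurable (\<F> s) \<Longrightarrow> f \<in> borel_measurable M"
  using measurable_from_subalg[OF subalgebra_filtration] by blast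

lemma evaluation_adapted: "0 \<le> s \<Longrightarrow> s \<le> t \<Longrightarrow> (\<lambda>\<omega>. \<omega> s) \<in> borel_measurable (\<F> t)"
proof (rule measurableI)
  fix A :: "(real ^ 'd) set" assume "A \<in> sets borel" "0 \<le> s" "s \<le> t"
  then show "(\<lambda>\<omega>. \<omega> s) -` A \<inter> space (\<F> t) \<in> sets (\<F> t)"
    unfolding sets_filtration by (intro sigma_sets.Basic UnI1) auto
qed simp

lemma evaluation_nth_adapted:
  "0 \<le> s \<Longrightarrow> s \<le> t \<Longrightarrow> (\<lambda>\<omega>. \<omega> s $ i) \<in> borel_measurable (\<F> t)"
  by (rule measurable_compose[OF evaluation_adapted borel_measurable_nth])

lemma increment_adapted:
  "0 \<le> s \<Longrightarrow> s \<le> t \<Longrightarrow> t \<le> u \<Longrightarrow> increment i s t \<in> borel_measurable (\<F> u)"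
  by (intro borel_measurable_diff evaluation_nth_adapted) auto

subsection \<open>Independence of the past\<close>

lemma indep_set_mono:
  assumes "indep_set A B" "A' \<subseteq> A" "B' \<subseteq> B"
  shows "indep_set A' B'"
  unfolding indep_sets2_eq
proof (intro conjI ballI)
  show "A' \<subseteq> events" "B' \<subseteq> events"
    using indep_setD_ev1[OF assms(1)] indep_setD_ev2[OF assms(1)] assms(2,3) by blast+
  show "prob (a \<inter> b) = prob a * prob b" if "a \<in> A'" "b \<in> B'" for a b
    using that assms by (intro indep_setD[OF assms(1)]) auto
qed

lemma indep_increments:
  assumes "strict_mono (\<tau> :: nat \<Rightarrow> real)"
  shows "indep_vars (\<lambda>_. borel) (\<lambda>(j, i). increment i (\<tau> j) (\<tau> (Suc j))) (UNIV :: (nat \<times> 'd) set)"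
  using wiener assms unfolding wiener_space_def by (elim conjE allE[of _ \<tau>] impE)

text \<open>Every finite set of times up to \<open>s\<close> can be completed to a strictly increasing sequence in which
  \<open>s\<close> and \<open>t\<close> are consecutive, so that independence of increments along sequences applies.\<close>

lemma finite_times_enumeration:
  fixes s t :: real
  assumes "finite S" "S \<subseteq> {0..s}" "0 \<le> s" "s < t"
  obtains \<tau> :: "nat \<Rightarrow> real" and m where "strict_mono \<tau>" "\<tau> 0 = 0" "\<tau> m = s" "\<tau> (Suc m) = t"
    "S \<subseteq> \<tau> ` {..m}"
proof -
  define l where "l = sorted_list_of_set (insert 0 (insert s S))"
  have fin: "finite (insert 0 (insert s S))" using assms by simp
  have set_l: "set l = insert 0 (insert s S)" unfolding l_def using fin by (rule set_sorted_list_of_set)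
  have sl: "sorted_wrt (<) l" unfolding l_def by (rule strict_sorted_list_of_set)
  have ne: "l \<noteq> []" using set_l by auto
  define m where "m = length l - 1"
  have len: "length l = Suc m" using ne by (cases l) (auto simp: m_def)
  define \<tau> where "\<tau> k = (if k \<le> m then l ! k else t + real (k - Suc m))" for k
  have bnd: "l ! k \<le> s" "0 \<le> l ! k" if "k \<le> m" for k
  proof -
    have "l ! k \<in> set l" using that len by auto
    then show "l ! k \<le> s" "0 \<le> l ! k" using set_l assms by auto
  qed
  have lm: "l ! j < l ! k" if "j < k" "k \<le> m" for j k
    using sl that len by (simp add: sorted_wrt_iff_nth_less)
  have 1: "strict_mono \<tau>"
  proof (rule strict_monoI)
    fix j k :: nat assume "j < k"
    then show "\<tau> j < \<tau> k"
      using bnd[of j] lm[of j k] assms(4) unfolding \<tau>_def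
      by (cases "j \<le> m"; cases "k \<le> m") (auto intro: order.strict_trans1 less_le_trans[of _ t] simp: algebra_simps of_nat_diff)
  qed
  have idx: "\<exists>k\<le>m. l ! k = x" if "x \<in> insert 0 (insert s S)" for x
    using that set_l len by (metis in_set_conv_nth less_Suc_eq_le)
  have 2: "\<tau> 0 = 0"
  proof -
    obtain k where k: "k \<le> m" "l ! k = 0" using idx[of 0] by auto
    have "k = 0" using lm[of 0 k] bnd[of 0] k by (cases k) auto
    then show ?thesis using k by (simp add: \<tau>_def)
  qed
  have 3: "\<tau> m = s"
  proof -
    obtain k where k: "k \<le> m" "l ! k = s" using idx[of s] by auto
    have "k = m" using lm[of k m] bnd[of m] k by (cases "k = m") auto
    then show ?thesis using k by (simp add: \<tau>_def)
  qed
  have 4: "\<tau> (Suc m) = t" by (simp add: \<tau>_def)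
  have 5: "S \<subseteq> \<tau> ` {..m}"
  proof
    fix x assume "x \<in> S"
    then obtain k where "k \<le> m" "l ! k = x" using idx[of x] by auto
    then show "x \<in> \<tau> ` {..m}" by (auto simp: \<tau>_def image_iff intro!: bexI[of _ k])
  qed
  show ?thesis using that 1 2 3 4 5 by blast
qed

text \<open>The value of a path at a time of the partition is the sum of its increments, since paths
  start in the origin; so cylinder events of the past depend on increments that are independent of
  the next one.\<close>

lemma cylinder_indep_increment:
  assumes st: "0 \<le> s" "s < t" and S: "finite S" "S \<subseteq> {0..s}"
    and U: "\<And>r. r \<in> S \<Longrightarrow> U r \<in> sets borel" and B: "B \<in> sets borel"
  shows "prob ({\<omega>\<in>space M. \<forall>r\<in>S. \<omega> r \<in> U r} \<inter> {\<omega>\<in>space M. increment i s t \<omega> \<in> B}) =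
    prob {\<omega>\<in>space M. \<forall>r\<in>S. \<omega> r \<in> U r} * prob {\<omega>\<in>space M. increment i s t \<omega> \<in> B}"
proof -
  obtain \<tau> m where \<tau>: "strict_mono \<tau>" "\<tau> 0 = 0" "\<tau> m = s" "\<tau> (Suc m) = t" "S \<subseteq> \<tau> ` {..m}"
    by (rule finite_times_enumeration[OF S st])
  define X where "X = (\<lambda>(j, i). increment i (\<tau> j) (\<tau> (Suc j)))"
  define P :: "(nat \<times> 'd) set" where "P = {..<m} \<times> UNIV"
  define Q :: "(nat \<times> 'd) set" where "Q = {(m, i)}"
  have iv: "indep_var (PiM P (\<lambda>_. borel)) (\<lambda>\<omega>. restrict (\<lambda>p. X p \<omega>) P)
      (PiM Q (\<lambda>_. borel)) (\<lambda>\<omega>. restrict (\<lambda>p. X p \<omega>) Q)"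
    by (rule indep_var_restrict[of _ _ UNIV])
       (use indep_increments[OF \<tau>(1)] in \<open>auto simp: X_def P_def Q_def\<close>)
  define val where "val k f = (\<chi> i. \<Sum>j<k. f (j, i))" for k and f :: "nat \<times> 'd \<Rightarrow> real"
  \<comment> \<open>\<open>val k\<close> recovers the position at time \<open>\<tau> k\<close> from the first \<open>k\<close> increments.\<close>
  have val_eq: "val k (restrict (\<lambda>p. X p \<omega>) P) = \<omega> (\<tau> k)" if "k \<le> m" "\<omega> \<in> space M" for k \<omega>
  proof -
    have "(\<Sum>j<k. restrict (\<lambda>p. X p \<omega>) P (j, i)) = \<omega> (\<tau> k) $ i" for i
    proof -
      have "(\<Sum>j<k. restrict (\<lambda>p. X p \<omega>) P (j, i)) = (\<Sum>j<k. \<omega> (\<tau> (Suc j)) $ i - \<omega> (\<tau> j) $ i)"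
        using that by (intro sum.cong) (auto simp: P_def X_def)
      also have "\<dots> = \<omega> (\<tau> k) $ i - \<omega> (\<tau> 0) $ i" by (rule sum_lessThan_telescope)
      finally show ?thesis using that \<tau>(2) by (simp add: space_M wiener_paths_def)
    qed
    then show ?thesis by (simp add: val_def vec_eq_iff)
  qed
  have val_meas: "val k \<in> measurable (PiM P (\<lambda>_. borel)) borel" if "k \<le> m" for k
  proof -
    have "(\<lambda>f :: nat \<times> 'd \<Rightarrow> real. \<Sum>j<k. f (j, i)) \<in> borel_measurable (PiM P (\<lambda>_. borel))" for i :: 'd
    proof (rule borel_measurable_sum)
      fix j assume "j \<in> {..<k}"
      then have "(j, i) \<in> P" using that by (simp add: P_def)
      then show "(\<lambda>f. f (j, i)) \<in> borel_measurable (PiM P (\<lambda>_. borel :: real measure))"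
        by (rule measurable_component_singleton)
    qed
    then show ?thesis by (intro borel_measurable_vecI) (simp add: val_def)
  qed
  have "\<exists>k. k \<le> m \<and> \<tau> k = r" if "r \<in> S" for r
    using \<tau>(5) that by auto
  then obtain \<kappa> where \<kappa>: "\<And>r. r \<in> S \<Longrightarrow> \<kappa> r \<le> m \<and> \<tau> (\<kappa> r) = r"
    by metis
  define A' where "A' = {f \<in> space (PiM P (\<lambda>_. borel :: real measure)). \<forall>r\<in>S. val (\<kappa> r) f \<in> U r}"
  define B' where "B' = {f \<in> space (PiM Q (\<lambda>_. borel :: real measure)). f (m, i) \<in> B}"
  have A': "A' \<in> sets (PiM P (\<lambda>_. borel))"
  proof -
    have "{f \<in> space (PiM P (\<lambda>_. borel :: real measure)). val (\<kappa> r) f \<in> U r} \<in> sets (PiM P (\<lambda>_. borel))"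
      if "r \<in> S" for r
      using measurable_sets[OF val_meas U[OF that], of "\<kappa> r"] \<kappa>[OF that] by (simp add: vimage_def Int_def conj_commute)
    then show ?thesis unfolding A'_def by (intro sets.sets_Collect_finite_All S(1) ) (auto)
  qed
  have B': "B' \<in> sets (PiM Q (\<lambda>_. borel))"
  proof -
    have "(\<lambda>f. f (m, i)) \<in> measurable (PiM Q (\<lambda>_. borel :: real measure)) borel"
      by (rule measurable_component_singleton) (simp add: Q_def)
    from measurable_sets[OF this B] show ?thesis by (simp add: B'_def vimage_def Int_def conj_commute)
  qed
  define f where "f \<omega> = restrict (\<lambda>p. X p \<omega>) P" for \<omega>
  define g where "g \<omega> = restrict (\<lambda>p. X p \<omega>) Q" for \<omega>
  have spP: "f \<omega> \<in> space (PiM P (\<lambda>_. borel))" and spQ: "g \<omega> \<in> space (PiM Q (\<lambda>_. borel))" for \<omega>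
    by (simp_all add: f_def g_def space_PiM)
  have "val (\<kappa> r) (f \<omega>) = \<omega> r" if "r \<in> S" "\<omega> \<in> space M" for r \<omega>
    using val_eq[of "\<kappa> r" \<omega>] \<kappa>[OF that(1)] that(2) by (simp add: f_def)
  then have eqA: "f -` A' \<inter> space M = {\<omega>\<in>space M. \<forall>r\<in>S. \<omega> r \<in> U r}"
    using spP unfolding A'_def by fastforce
  have "g \<omega> (m, i) = increment i s t \<omega>" for \<omega>
    using \<tau>(3,4) by (simp add: g_def Q_def X_def)
  then have eqB: "g -` B' \<inter> space M = {\<omega>\<in>space M. increment i s t \<omega> \<in> B}"
    using spQ unfolding B'_def by fastforce
  have "prob ((\<lambda>\<omega>. (f \<omega>, g \<omega>)) -` (A' \<times> B') \<inter> space M) = prob (f -` A' \<inter> space M) * prob (g -` B' \<inter> space M)"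
    using indep_varD[OF iv A' B'] unfolding f_def g_def .
  moreover have "(\<lambda>\<omega>. (f \<omega>, g \<omega>)) -` (A' \<times> B') \<inter> space M = (f -` A' \<inter> space M) \<inter> (g -` B' \<inter> space M)"
    by blast
  ultimately show ?thesis
    by (metis eqA eqB)
qed

text \<open>Cylinder events together with the null sets form a \<open>\<pi>\<close>-system that generates the augmented
  filtration; null sets are independent of everything.\<close>

lemma past_indep_increment:
  assumes st: "0 \<le> s" "s < t"
  shows "indep_set (sets (\<F> s)) {{\<omega>\<in>space M. increment i s t \<omega> \<in> B} | B. B \<in> sets borel}"
proof -
  define Cyl where "Cyl = {{\<omega>\<in>space M. \<forall>r\<in>S. \<omega> r \<in> U r} | S (U :: real \<Rightarrow> (real ^ 'd) set).
     finite S \<and> S \<subseteq> {0..s} \<and> (\<forall>r. U r \<in> sets borel)}"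
  define G where "G = Cyl \<union> null_sets M"
  define D where "D = {{\<omega>\<in>space M. increment i s t \<omega> \<in> B} | B. B \<in> sets borel}"
  have Cyl_meas: "Cyl \<subseteq> sets M"
  proof
    fix A assume "A \<in> Cyl"
    then obtain S U where *: "A = {\<omega>\<in>space M. \<forall>r\<in>S. \<omega> r \<in> U r}" "finite S" "\<forall>r. U r \<in> sets borel"
      by (auto simp: Cyl_def)
    have "{\<omega>\<in>space M. \<omega> r \<in> U r} \<in> sets M" for r using * by measurable
    then show "A \<in> sets M" unfolding *(1) by (intro sets.sets_Collect_finite_All * ) auto
  qed
  have D_meas: "D \<subseteq> sets M" by (auto simp: D_def)
  have "indep_set G D"
    unfolding indep_sets2_eq
  proof (intro conjI ballI)
    show "G \<subseteq> events" using Cyl_meas by (auto simp: G_def)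
    show "D \<subseteq> events" by (rule D_meas)
    fix a b assume a: "a \<in> G" and b: "b \<in> D"
    show "prob (a \<inter> b) = prob a * prob b"
    proof (cases "a \<in> null_sets M")
      case True
      then have "a \<inter> b \<in> null_sets M" using b D_meas by (intro null_set_Int2) auto
      then show ?thesis using True by (simp add: measure_eq_0_null_sets)
    next
      case False
      then have "a \<in> Cyl" using a by (simp add: G_def)
      then show ?thesis using b cylinder_indep_increment[OF st] by (auto simp: Cyl_def D_def)
    qed
  qed
  moreover have "Int_stable G"
  proof (rule Int_stableI)
    fix a b assume ab: "a \<in> G" "b \<in> G"
    have meas: "a \<in> sets M" "b \<in> sets M" using ab Cyl_meas by (auto simp: G_def)
    show "a \<inter> b \<in> G"
    proof (cases "a \<in> null_sets M \<or> b \<in> null_sets M")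
      case True
      then have "a \<inter> b \<in> null_sets M" using meas by (auto intro: null_set_Int1 null_set_Int2)
      then show ?thesis by (simp add: G_def)
    next
      case False
      then have "a \<in> Cyl" "b \<in> Cyl" using ab by (auto simp: G_def)
      then obtain S U T V where
        a: "a = {\<omega>\<in>space M. \<forall>r\<in>S. \<omega> r \<in> U r}" "finite S" "S \<subseteq> {0..s}" "\<forall>r. U r \<in> sets borel" and
        b: "b = {\<omega>\<in>space M. \<forall>r\<in>T. \<omega> r \<in> V r}" "finite T" "T \<subseteq> {0..s}" "\<forall>r. V r \<in> sets borel"
        unfolding Cyl_def by blast
      define R where "R r = (if r \<in> S then U r else UNIV) \<inter> (if r \<in> T then V r else UNIV)" for r
      have "a \<inter> b = {\<omega>\<in>space M. \<forall>r\<in>S \<union> T. \<omega> r \<in> R r}"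
        unfolding a b R_def by auto
      moreover have "\<forall>r. R r \<in> sets borel"
        using a(4) b(4) by (auto simp: R_def)
      moreover have "finite (S \<union> T)" "S \<union> T \<subseteq> {0..s}"
        using a(2,3) b(2,3) by auto
      ultimately have "a \<inter> b \<in> Cyl"
        unfolding Cyl_def by blast
      then show ?thesis by (simp add: G_def)
    qed
  qed
  moreover have "Int_stable D"
  proof (rule Int_stableI)
    fix a b assume "a \<in> D" "b \<in> D"
    then obtain B C where "a = {\<omega>\<in>space M. increment i s t \<omega> \<in> B}" "b = {\<omega>\<in>space M. increment i s t \<omega> \<in> C}"
      "B \<in> sets borel" "C \<in> sets borel" by (auto simp: D_def)
    then show "a \<inter> b \<in> D" by (auto simp: D_def intro!: exI[of _ "B \<inter> C"])
  qed
  ultimately have ind: "indep_set (sigma_sets (space M) G) (sigma_sets (space M) D)"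
    by (rule indep_set_sigma_sets)
  have "sets (\<F> s) \<subseteq> sigma_sets (space M) G"
    unfolding sets_filtration
  proof (rule sigma_sets_mono', safe)
    fix r :: real and U :: "(real ^ 'd) set" assume "0 \<le> r" "r \<le> s" "U \<in> sets borel"
    then have "{\<omega> \<in> space M. \<omega> r \<in> U} \<in> Cyl"
      unfolding Cyl_def by (intro CollectI exI[of _ "{r}"] exI[of _ "\<lambda>_. U"]) auto
    then show "{\<omega> \<in> space M. \<omega> r \<in> U} \<in> G" by (simp add: G_def)
  next
    fix x assume "x \<in> null_sets M"
    then show "x \<in> G" by (simp add: G_def)
  qed
  moreover have "D \<subseteq> sigma_sets (space M) D" by auto
  ultimately have "indep_set (sets (\<F> s)) D"
    by (rule indep_set_mono[OF ind])
  then show ?thesis by (simp only: D_def)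
qed

lemma past_indep_var_increment:
  assumes "0 \<le> s" "s < t" "(Z :: _ \<Rightarrow> real) \<in> borel_measurable (\<F> s)" "(f :: real \<Rightarrow> real) \<in> borel_measurable borel"
  shows "indep_var borel Z borel (\<lambda>\<omega>. f (increment i s t \<omega>))"
proof -
  have "indep_set (sigma_sets (space M) {Z -` A \<inter> space M | A. A \<in> sets borel})
     (sigma_sets (space M) {(increment i s t) -` A \<inter> space M | A. A \<in> sets borel})"
  proof (rule indep_set_sigma_sets)
    show "indep_set {Z -` A \<inter> space M | A. A \<in> sets borel}
       {(increment i s t) -` A \<inter> space M | A. A \<in> sets borel}"
    proof (rule indep_set_mono[OF past_indep_increment[OF assms(1,2), of i]])
      show "{Z -` A \<inter> space M | A. A \<in> sets borel} \<subseteq> sets (\<F> s)"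
        using measurable_sets[OF assms(3)] by auto
      show "{(increment i s t) -` A \<inter> space M | A. A \<in> sets borel} \<subseteq>
         {{\<omega>\<in>space M. increment i s t \<omega> \<in> B} | B. B \<in> sets borel}"
        by (fastforce simp: vimage_def)
    qed
    show "Int_stable {Z -` A \<inter> space M | A. A \<in> sets borel}"
      by (rule Int_stableI, safe, rule_tac x="A \<inter> Aa" in exI) auto
    show "Int_stable {(increment i s t) -` A \<inter> space M | A. A \<in> sets borel}"
      by (rule Int_stableI, safe, rule_tac x="A \<inter> Aa" in exI) auto
  qed
  then have "indep_var borel Z borel (increment i s t)"
    unfolding indep_var_eq using filtration_measurable[OF assms(3)] by auto
  from indep_var_compose[OF this measurable_ident assms(4)] show ?thesis
    by (simp add: comp_def)
qed

text \<open>This is the form in which independence of the past is used. The degenerate case \<open>s = t\<close>, where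
  the increment is constant, is included so that time intervals may be empty.\<close>

lemma
  fixes Z :: "_ \<Rightarrow> real" and f :: "real \<Rightarrow> real"
  assumes "0 \<le> s" "s \<le> t" "Z \<in> borel_measurable (\<F> s)" "integrable M Z" "f \<in> borel_measurable borel"
    "integrable M (\<lambda>\<omega>. f (increment i s t \<omega>))"
  shows integrable_past_times_increment: "integrable M (\<lambda>\<omega>. Z \<omega> * f (increment i s t \<omega>))"
    and expectation_past_times_increment:
      "expectation (\<lambda>\<omega>. Z \<omega> * f (increment i s t \<omega>)) = expectation Z * expectation (\<lambda>\<omega>. f (increment i s t \<omega>))"
proof -
  show "integrable M (\<lambda>\<omega>. Z \<omega> * f (increment i s t \<omega>))"
  proof (cases "s = t")
    case True
    then show ?thesis using integrable_mult_left[of "f 0" M Z] assms(4) by simp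
  next
    case False
    then show ?thesis
      using indep_var_integrable[OF past_indep_var_increment] assms by simp
  qed
  show "expectation (\<lambda>\<omega>. Z \<omega> * f (increment i s t \<omega>)) = expectation Z * expectation (\<lambda>\<omega>. f (increment i s t \<omega>))"
  proof (cases "s = t")
    case True
    then show ?thesis by (simp add: prob_space)
  next
    case False
    then show ?thesis
      using indep_var_lebesgue_integral[OF past_indep_var_increment] assms by simp
  qed
qed

subsection \<open>Moments of the increments\<close>

lemma increment_power_integrable: "integrable M (\<lambda>\<omega>. increment i s t \<omega> ^ k)"
proof -
  have *: "integrable M (\<lambda>\<omega>. increment i s t \<omega> ^ k)" if "s < t" for s t
  proof -
    have D: "distributed M lborel (increment i s t) (normal_density 0 (sqrt (t - s)))"
      using wiener that by (simp add: wiener_space_def)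
    show ?thesis
      using integrable_normal_moment[of "sqrt (t - s)" 0 k] that
        distributed_integrable[OF D, of "\<lambda>x. x ^ k"] by (simp add: mult.commute)
  qed
  consider "s < t" | "s = t" | "t < s" by linarith
  then show ?thesis
  proof cases
    case 3
    have "increment i s t \<omega> ^ k = (-1) ^ k * increment i t s \<omega> ^ k" for \<omega>
      by (metis minus_diff_eq power_minus)
    then show ?thesis using *[OF 3] by simp
  qed (use * in \<open>auto simp: zero_power2 power_0_left\<close>)
qed

lemma increment_integrable: "integrable M (increment i s t)"
  using increment_power_integrable[of _ _ _ 1] by simp

lemma
  assumes "s \<le> t"
  shows expectation_increment: "expectation (increment i s t) = 0"
    and expectation_increment_sq: "expectation (\<lambda>\<omega>. (increment i s t \<omega>)\<^sup>2) = t - s"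
    and expectation_increment_4: "expectation (\<lambda>\<omega>. increment i s t \<omega> ^ 4) = 3 * (t - s)\<^sup>2"
proof -
  have "expectation (increment i s t) = 0 \<and> expectation (\<lambda>\<omega>. (increment i s t \<omega>)\<^sup>2) = t - s \<and>
    expectation (\<lambda>\<omega>. increment i s t \<omega> ^ 4) = 3 * (t - s)\<^sup>2"
  proof (cases "s = t")
    case False
    then have st: "s < t" using assms by simp
    have D: "distributed M lborel (increment i s t) (normal_density 0 (sqrt (t - s)))"
      using wiener st by (simp add: wiener_space_def)
    have E: "expectation (\<lambda>\<omega>. increment i s t \<omega> ^ k) = (\<integral>x. normal_density 0 (sqrt (t - s)) x * x ^ k \<partial>lborel)" for k
      using distributed_integral[OF D, of "\<lambda>x. x ^ k"] by simp
    have "expectation (increment i s t) = 0"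
      using E[of 1] integral_normal_moment_odd[of "sqrt (t - s)" 0 0] st by simp
    moreover have "expectation (\<lambda>\<omega>. (increment i s t \<omega>)\<^sup>2) = t - s"
      using E[of 2] integral_normal_moment_even[of "sqrt (t - s)" 0 1] st by (simp add: fact_numeral)
    moreover have "expectation (\<lambda>\<omega>. increment i s t \<omega> ^ 4) = 3 * (t - s)\<^sup>2"
      using E[of 4] integral_normal_moment_even[of "sqrt (t - s)" 0 2] st
      by (simp add: fact_numeral power_divide field_simps)
    ultimately show ?thesis by simp
  qed simp
  then show "expectation (increment i s t) = 0" "expectation (\<lambda>\<omega>. (increment i s t \<omega>)\<^sup>2) = t - s"
    "expectation (\<lambda>\<omega>. increment i s t \<omega> ^ 4) = 3 * (t - s)\<^sup>2" by auto
qed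

end

section \<open>Square means\<close>

text \<open>The squared \<open>L\<^sup>2\<close> norm, with values in \<open>[0, \<infinity>]\<close> so that no integrability has to be assumed.\<close>

definition sqn :: "'a measure \<Rightarrow> ('a \<Rightarrow> real) \<Rightarrow> ennreal" where
  "sqn M f = (\<integral>\<^sup>+ x. ennreal ((f x)\<^sup>2) \<partial>M)"

lemma sqn_cong: "(\<And>x. x \<in> space M \<Longrightarrow> \<bar>f x\<bar> = \<bar>g x\<bar>) \<Longrightarrow> sqn M f = sqn M g"
  unfolding sqn_def by (intro nn_integral_cong) (metis power2_abs)

lemma sqn_mono: "(\<And>x. x \<in> space M \<Longrightarrow> \<bar>f x\<bar> \<le> \<bar>g x\<bar>) \<Longrightarrow> sqn M f \<le> sqn M g"
  unfolding sqn_def by (intro nn_integral_mono ennreal_leI) (simp add: abs_le_square_iff)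

lemma sqn_minus: "sqn M (\<lambda>x. f x - g x) = sqn M (\<lambda>x. g x - f x)"
  by (rule sqn_cong) simp

text \<open>This is \<open>2 f g \<le> e f\<^sup>2 + g\<^sup>2 / e\<close>. A small \<open>e\<close> keeps the constant in front of the first term
  close to \<open>1\<close>, which is what limits of norms need.\<close>

lemma sqn_weighted_triangle:
  assumes [measurable]: "f \<in> borel_measurable M" "g \<in> borel_measurable M" and e: "0 < e"
  shows "sqn M (\<lambda>x. f x + g x) \<le> ennreal (1 + e) * sqn M f + ennreal (1 + 1 / e) * sqn M g"
proof -
  have "(f x + g x)\<^sup>2 \<le> (1 + e) * (f x)\<^sup>2 + (1 + 1 / e) * (g x)\<^sup>2" for x
  proof -
    have "0 \<le> (e * f x - g x)\<^sup>2 / e" using e by simp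
    also have "\<dots> = e * (f x)\<^sup>2 - 2 * f x * g x + (g x)\<^sup>2 / e"
      using e by (simp add: field_simps power2_eq_square)
    finally show ?thesis by (simp add: power2_sum algebra_simps)
  qed
  then have "ennreal ((f x + g x)\<^sup>2) \<le> ennreal (1 + e) * ennreal ((f x)\<^sup>2) + ennreal (1 + 1 / e) * ennreal ((g x)\<^sup>2)" for x
    using e by (simp add: ennreal_mult[symmetric] ennreal_plus[symmetric] ennreal_leI del: ennreal_plus)
  then have "sqn M (\<lambda>x. f x + g x) \<le> (\<integral>\<^sup>+ x. ennreal (1 + e) * ennreal ((f x)\<^sup>2) + ennreal (1 + 1 / e) * ennreal ((g x)\<^sup>2) \<partial>M)"
    unfolding sqn_def by (intro nn_integral_mono) auto
  also have "\<dots> = ennreal (1 + e) * sqn M f + ennreal (1 + 1 / e) * sqn M g"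
    unfolding sqn_def by (subst nn_integral_add) (auto simp: nn_integral_cmult)
  finally show ?thesis .
qed

lemma sqn_triangle:
  assumes "f \<in> borel_measurable M" "g \<in> borel_measurable M"
  shows "sqn M (\<lambda>x. f x + g x) \<le> 2 * sqn M f + 2 * sqn M g"
  using sqn_weighted_triangle[OF assms, of 1] by simp

lemma sqn_tendsto_add:
  assumes "\<And>k. f k \<in> borel_measurable M" "\<And>k. g k \<in> borel_measurable M"
    "(\<lambda>k. sqn M (f k)) \<longlonglongrightarrow> 0" "(\<lambda>k. sqn M (g k)) \<longlonglongrightarrow> 0"
  shows "(\<lambda>k. sqn M (\<lambda>x. f k x + g k x)) \<longlonglongrightarrow> 0"
proof (rule tendsto_sandwich[OF _ _ tendsto_const])
  show "\<forall>\<^sub>F k in sequentially. sqn M (\<lambda>x. f k x + g k x) \<le> 2 * sqn M (f k) + 2 * sqn M (g k)"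
    using sqn_triangle assms by (intro always_eventually) blast
  have "(\<lambda>k. 2 * sqn M (f k) + 2 * sqn M (g k)) \<longlonglongrightarrow> 2 * 0 + 2 * 0"
    by (intro tendsto_add ennreal_tendsto_cmult assms) auto
  then show "(\<lambda>k. 2 * sqn M (f k) + 2 * sqn M (g k)) \<longlonglongrightarrow> 0" by simp
qed auto

lemma sqn_tendsto_diff:
  assumes "\<And>k. f k \<in> borel_measurable M" "\<And>k. g k \<in> borel_measurable M"
    "(\<lambda>k. sqn M (f k)) \<longlonglongrightarrow> 0" "(\<lambda>k. sqn M (g k)) \<longlonglongrightarrow> 0"
  shows "(\<lambda>k. sqn M (\<lambda>x. f k x - g k x)) \<longlonglongrightarrow> 0"
proof -
  have "sqn M (\<lambda>x. - g k x) = sqn M (g k)" for k by (rule sqn_cong) simp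
  with sqn_tendsto_add[of f M "\<lambda>k x. - g k x"] assms show ?thesis by simp
qed

text \<open>Isometries pass to limits: the weighted triangle inequality is applied twice with a weight
  \<open>e\<close> that tends to \<open>0\<close> after the index has been sent to infinity.\<close>

lemma sqn_limit_le:
  assumes meas: "\<And>k. f k \<in> borel_measurable M" "f' \<in> borel_measurable M"
    "\<And>k. g k \<in> borel_measurable N" "g' \<in> borel_measurable N"
    and f: "(\<lambda>k. sqn M (\<lambda>x. f k x - f' x)) \<longlonglongrightarrow> 0"
    and g: "(\<lambda>k. sqn N (\<lambda>x. g k x - g' x)) \<longlonglongrightarrow> 0"
    and le: "\<And>k. sqn M (f k) \<le> sqn N (g k)"
  shows "sqn M f' \<le> sqn N g'"
proof (cases "sqn N g' = \<top>")
  case False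
  have *: "sqn M f' \<le> ennreal ((1 + e)\<^sup>2) * sqn N g'" if e: "0 < e" for e
  proof (rule LIMSEQ_le_const)
    let ?b = "\<lambda>k. ennreal (1 + e) * (ennreal (1 + e) * sqn N g' + ennreal (1 + 1 / e) * sqn N (\<lambda>x. g k x - g' x))
       + ennreal (1 + 1 / e) * sqn M (\<lambda>x. f k x - f' x)"
    have "?b \<longlonglongrightarrow> ennreal (1 + e) * (ennreal (1 + e) * sqn N g' + ennreal (1 + 1 / e) * 0)
       + ennreal (1 + 1 / e) * 0"
      by (intro tendsto_add ennreal_tendsto_cmult tendsto_const f g) auto
    then show "?b \<longlonglongrightarrow> ennreal ((1 + e)\<^sup>2) * sqn N g'"
      using e by (simp add: power2_eq_square ennreal_mult mult.assoc)
    have "sqn M f' \<le> ?b k" for k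
    proof -
      have "sqn M f' = sqn M (\<lambda>x. f k x + (f' x - f k x))" by simp
      also have "\<dots> \<le> ennreal (1 + e) * sqn M (f k) + ennreal (1 + 1 / e) * sqn M (\<lambda>x. f' x - f k x)"
        using meas e by (intro sqn_weighted_triangle) auto
      also have "sqn M (\<lambda>x. f' x - f k x) = sqn M (\<lambda>x. f k x - f' x)" by (rule sqn_minus)
      also have "sqn M (f k) \<le> sqn N (\<lambda>x. g' x + (g k x - g' x))" using le[of k] by simp
      also have "\<dots> \<le> ennreal (1 + e) * sqn N g' + ennreal (1 + 1 / e) * sqn N (\<lambda>x. g k x - g' x)"
        using meas e by (intro sqn_weighted_triangle) auto
      finally show ?thesis by (simp add: mult_left_mono add_right_mono)
    qed
    then show "\<exists>N. \<forall>n\<ge>N. sqn M f' \<le> ?b n" by blast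
  qed
  show ?thesis
  proof (rule LIMSEQ_le_const)
    have "(\<lambda>n. (1 + 1 / real (Suc n))\<^sup>2) \<longlonglongrightarrow> (1 + 0)\<^sup>2"
      by (intro tendsto_intros LIMSEQ_Suc[OF lim_1_over_n])
    then have "(\<lambda>n. sqn N g' * ennreal ((1 + 1 / real (Suc n))\<^sup>2)) \<longlonglongrightarrow> sqn N g' * ennreal ((1 + 0)\<^sup>2)"
      using False by (intro ennreal_tendsto_cmult tendsto_ennrealI) (auto simp: less_top)
    then show "(\<lambda>n. ennreal ((1 + 1 / real (Suc n))\<^sup>2) * sqn N g') \<longlonglongrightarrow> sqn N g'"
      by (simp add: mult.commute)
    show "\<exists>N'. \<forall>n\<ge>N'. sqn M f' \<le> ennreal ((1 + 1 / real (Suc n))\<^sup>2) * sqn N g'"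
      using * by (intro exI[of _ 0]) simp
  qed
qed simp

lemma sqn_limit_eq:
  assumes "\<And>k. f k \<in> borel_measurable M" "f' \<in> borel_measurable M"
    "\<And>k. g k \<in> borel_measurable N" "g' \<in> borel_measurable N"
    "(\<lambda>k. sqn M (\<lambda>x. f k x - f' x)) \<longlonglongrightarrow> 0" "(\<lambda>k. sqn N (\<lambda>x. g k x - g' x)) \<longlonglongrightarrow> 0"
    "\<And>k. sqn M (f k) = sqn N (g k)"
  shows "sqn M f' = sqn N g'"
  using sqn_limit_le[of f M f' g N g'] sqn_limit_le[of g N g' f M f'] assms by (intro antisym) auto

section \<open>Ito integrals\<close>

type_synonym 'd elem = "(real \<times> real \<times> ((real \<Rightarrow> real ^ 'd) \<Rightarrow> real)) list"

context wiener
begin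

text \<open>Bounded functions that are known at time \<open>s\<close>: the factors with which increments after \<open>s\<close> may
  be multiplied.\<close>

definition bounded_past :: "real \<Rightarrow> ((real \<Rightarrow> real ^ 'd) \<Rightarrow> real) \<Rightarrow> bool" where
  "bounded_past s Z \<longleftrightarrow> Z \<in> borel_measurable (\<F> s) \<and> (\<exists>K. \<forall>\<omega>\<in>space M. \<bar>Z \<omega>\<bar> \<le> K)"

lemma bounded_past_measurable: "bounded_past s Z \<Longrightarrow> Z \<in> borel_measurable M"
  using filtration_measurable by (auto simp: bounded_past_def)

lemma bounded_past_mono: "bounded_past s Z \<Longrightarrow> s \<le> t \<Longrightarrow> bounded_past t Z"
  unfolding bounded_past_def using filtration_measurable_mono by blast

lemma bounded_past_mult:
  assumes "bounded_past s Y" "bounded_past s Z"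
  shows "bounded_past s (\<lambda>\<omega>. Y \<omega> * Z \<omega>)"
proof -
  obtain K L where KL: "\<forall>\<omega>\<in>space M. \<bar>Y \<omega>\<bar> \<le> K" "\<forall>\<omega>\<in>space M. \<bar>Z \<omega>\<bar> \<le> L"
    using assms by (auto simp: bounded_past_def)
  have "\<bar>Y \<omega> * Z \<omega>\<bar> \<le> K * L" if "\<omega> \<in> space M" for \<omega>
    unfolding abs_mult using KL that
    by (intro mult_mono order.trans[OF abs_ge_zero]) auto
  moreover have "(\<lambda>\<omega>. Y \<omega> * Z \<omega>) \<in> borel_measurable (\<F> s)"
    using assms by (auto simp: bounded_past_def)
  ultimately show ?thesis unfolding bounded_past_def by blast
qed

lemma bounded_past_uminus: "bounded_past s Z \<Longrightarrow> bounded_past s (\<lambda>\<omega>. - Z \<omega>)"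
  unfolding bounded_past_def by auto

lemma integrable_bounded_past_mult:
  assumes "bounded_past s Z" "integrable M f"
  shows "integrable M (\<lambda>\<omega>. Z \<omega> * f \<omega>)"
proof -
  obtain K where K: "\<forall>\<omega>\<in>space M. \<bar>Z \<omega>\<bar> \<le> K" using assms by (auto simp: bounded_past_def)
  have "AE \<omega> in M. norm (Z \<omega> * f \<omega>) \<le> norm (K * f \<omega>)"
  proof (rule AE_I2)
    fix \<omega> assume "\<omega> \<in> space M"
    then have "\<bar>Z \<omega>\<bar> \<le> \<bar>K\<bar>" using K by force
    then show "norm (Z \<omega> * f \<omega>) \<le> norm (K * f \<omega>)" by (simp add: abs_mult mult_right_mono)
  qed
  moreover have "(\<lambda>\<omega>. Z \<omega> * f \<omega>) \<in> borel_measurable M"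
    using bounded_past_measurable[OF assms(1)] assms(2) by measurable
  ultimately show ?thesis using assms(2) by (intro Bochner_Integration.integrable_bound[OF integrable_mult_right[OF assms(2), of K]]) auto
qed

lemma integrable_bounded_past: "bounded_past s Z \<Longrightarrow> integrable M Z"
  using integrable_bounded_past_mult[of s Z "\<lambda>_. 1"] by simp

lemma has_expectation_increment:
  assumes "0 \<le> s" "s \<le> t" "Z \<in> borel_measurable (\<F> s)" "integrable M Z"
  shows "has_bochner_integral M (\<lambda>\<omega>. Z \<omega> * increment i s t \<omega>) 0"
    and "has_bochner_integral M (\<lambda>\<omega>. Z \<omega> * (increment i s t \<omega>)\<^sup>2) (expectation Z * (t - s))"
  using integrable_past_times_increment[OF assms, where f = "\<lambda>x. x" and i = i]
    expectation_past_times_increment[OF assms, where f = "\<lambda>x. x" and i = i]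
    integrable_past_times_increment[OF assms, where f = "\<lambda>x. x\<^sup>2" and i = i]
    expectation_past_times_increment[OF assms, where f = "\<lambda>x. x\<^sup>2" and i = i]
    increment_power_integrable[where i = i and s = s and t = t and k = 2]
    increment_integrable[where i = i and s = s and t = t] assms(2)
  by (simp_all add: has_bochner_integral_iff expectation_increment expectation_increment_sq)

text \<open>Elementary integrands are lists of steps \<open>(a, b, \<xi>)\<close>, where the intervals \<open>{a<..b}\<close> may
  overlap; this makes the elementary integrands a vector space without any refinement of
  partitions.\<close>

definition elementary :: "'d elem \<Rightarrow> bool" where
  "elementary l \<longleftrightarrow> (\<forall>(a, b, \<xi>)\<in>set l. 0 \<le> a \<and> a \<le> b \<and> bounded_past a \<xi>)"

definition elem_value :: "'d elem \<Rightarrow> (real \<Rightarrow> real ^ 'd) \<times> real \<Rightarrow> real" where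
  "elem_value l p = (\<Sum>(a, b, \<xi>)\<leftarrow>l. \<xi> (fst p) * indicator {a<..b} (snd p))"

definition elem_integral :: "'d \<Rightarrow> 'd elem \<Rightarrow> (real \<Rightarrow> real ^ 'd) \<Rightarrow> real" where
  "elem_integral i l \<omega> = (\<Sum>(a, b, \<xi>)\<leftarrow>l. \<xi> \<omega> * increment i a b \<omega>)"

lemma elementary_simps [simp]:
  "elementary []"
  "elementary ((a, b, \<xi>) # l) \<longleftrightarrow> 0 \<le> a \<and> a \<le> b \<and> bounded_past a \<xi> \<and> elementary l"
  "elementary (l @ l') \<longleftrightarrow> elementary l \<and> elementary l'"
  unfolding elementary_def set_append ball_Un by simp_all

lemma elem_simps [simp]:
  "elem_value [] p = 0" "elem_integral i [] \<omega> = 0"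
  "elem_value ((a, b, \<xi>) # l) p = \<xi> (fst p) * indicator {a<..b} (snd p) + elem_value l p"
  "elem_integral i ((a, b, \<xi>) # l) \<omega> = \<xi> \<omega> * increment i a b \<omega> + elem_integral i l \<omega>"
  "elem_value (l @ l') p = elem_value l p + elem_value l' p"
  "elem_integral i (l @ l') \<omega> = elem_integral i l \<omega> + elem_integral i l' \<omega>"
  by (auto simp: elem_value_def elem_integral_def)

lemma elem_integral_measurable: "elementary l \<Longrightarrow> elem_integral i l \<in> borel_measurable M"
proof (induction l)
  case (Cons x l)
  obtain a b \<xi> where x: "x = (a, b, \<xi>)" by (cases x)
  have [measurable]: "\<xi> \<in> borel_measurable M" "elem_integral i l \<in> borel_measurable M"
    using Cons x by (auto intro: bounded_past_measurable)
  show ?case unfolding x elem_simps[abs_def] by measurable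
qed (simp add: elem_simps[abs_def])

lemma elem_value_measurable: "elementary l \<Longrightarrow> elem_value l \<in> borel_measurable (M \<Otimes>\<^sub>M lborel)"
proof (induction l)
  case (Cons x l)
  obtain a b \<xi> where x: "x = (a, b, \<xi>)" by (cases x)
  have [measurable]: "\<xi> \<in> borel_measurable M" "elem_value l \<in> borel_measurable (M \<Otimes>\<^sub>M lborel)"
    using Cons x by (auto intro: bounded_past_measurable)
  show ?case unfolding x elem_simps[abs_def] by measurable
qed (simp add: elem_simps[abs_def])

text \<open>On the common part of two overlapping steps the squared increment of the Wiener process
  contributes the length; all other products contain an increment of the future of the remaining
  factors.\<close>

lemma elem_step_product_ordered:
  assumes a: "0 \<le> a" "a \<le> b" "bounded_past a \<xi>" and c: "a \<le> c" "c \<le> d" "bounded_past c \<eta>"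
  shows "has_bochner_integral M (\<lambda>\<omega>. (\<xi> \<omega> * increment i a b \<omega>) * (\<eta> \<omega> * increment i c d \<omega>))
    (expectation (\<lambda>\<omega>. \<xi> \<omega> * \<eta> \<omega>) * measure lborel ({a<..b} \<inter> {c<..d}))"
proof -
  have pm: "bounded_past c (\<lambda>\<omega>. \<xi> \<omega> * \<eta> \<omega>)"
    by (rule bounded_past_mult[OF bounded_past_mono[OF a(3) c(1)] c(3)])
  have mp: "(\<lambda>\<omega>. \<xi> \<omega> * \<eta> \<omega>) \<in> borel_measurable (\<F> c)"
    using pm by (simp add: bounded_past_def)
  have c0: "0 \<le> c" using a c by simp
  have mt: "(\<lambda>\<omega>. \<xi> \<omega> * \<eta> \<omega> * increment i r t \<omega>) \<in> borel_measurable (\<F> u)"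
    if "0 \<le> r" "r \<le> t" "t \<le> u" "c \<le> u" for r t u
    by (intro borel_measurable_times[OF filtration_measurable_mono[OF mp]] increment_adapted that)
  show ?thesis
  proof (cases "b \<le> c")
    case True
    have "has_bochner_integral M (\<lambda>\<omega>. (\<xi> \<omega> * \<eta> \<omega> * increment i a b \<omega>) * increment i c d \<omega>) 0"
      using True a c0 c(2)
      by (intro has_expectation_increment integrable_bounded_past_mult[OF pm] increment_integrable mt) auto
    moreover have "{a<..b} \<inter> {c<..d} = {}" using True by auto
    ultimately show ?thesis by (simp add: mult_ac del: Int_greaterThanAtMost)
  next
    case False
    \<comment> \<open>The overlap is \<open>{c<..m}\<close>; the longer of the two steps continues until \<open>n\<close>.\<close>
    define m where "m = min b d"
    define n where "n = max b d"
    have cm: "c \<le> m" "m \<le> n" using False c by (auto simp: m_def n_def)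
    have "has_bochner_integral M (\<lambda>\<omega>. (\<xi> \<omega> * \<eta> \<omega> * increment i a c \<omega>) * increment i c d \<omega>) 0"
      using a c0 c
      by (intro has_expectation_increment integrable_bounded_past_mult[OF pm] increment_integrable mt) auto
    moreover have "has_bochner_integral M (\<lambda>\<omega>. (\<xi> \<omega> * \<eta> \<omega>) * (increment i c m \<omega>)\<^sup>2)
        (expectation (\<lambda>\<omega>. \<xi> \<omega> * \<eta> \<omega>) * (m - c))"
      using mp c0 cm by (intro has_expectation_increment integrable_bounded_past[OF pm])
    moreover have "has_bochner_integral M (\<lambda>\<omega>. (\<xi> \<omega> * \<eta> \<omega> * increment i c m \<omega>) * increment i m n \<omega>) 0"
      using c0 cm
      by (intro has_expectation_increment integrable_bounded_past_mult[OF pm] increment_integrable mt) auto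
    ultimately have "has_bochner_integral M (\<lambda>\<omega>. (\<xi> \<omega> * \<eta> \<omega> * increment i a c \<omega>) * increment i c d \<omega> +
        ((\<xi> \<omega> * \<eta> \<omega>) * (increment i c m \<omega>)\<^sup>2 + (\<xi> \<omega> * \<eta> \<omega> * increment i c m \<omega>) * increment i m n \<omega>))
        (0 + (expectation (\<lambda>\<omega>. \<xi> \<omega> * \<eta> \<omega>) * (m - c) + 0))"
      by (intro has_bochner_integral_add)
    moreover have "(\<xi> \<omega> * \<eta> \<omega> * increment i a c \<omega>) * increment i c d \<omega> +
        ((\<xi> \<omega> * \<eta> \<omega>) * (increment i c m \<omega>)\<^sup>2 + (\<xi> \<omega> * \<eta> \<omega> * increment i c m \<omega>) * increment i m n \<omega>)
        = (\<xi> \<omega> * increment i a b \<omega>) * (\<eta> \<omega> * increment i c d \<omega>)" for \<omega>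
    proof (cases "b \<le> d")
      case True
      then have "m = b" "n = d" by (auto simp: m_def n_def)
      then show ?thesis by (simp add: algebra_simps power2_eq_square)
    next
      case F: False
      then have "m = d" "n = b" by (auto simp: m_def n_def)
      then show ?thesis by (simp add: algebra_simps power2_eq_square)
    qed
    moreover have "{a<..b} \<inter> {c<..d} = {c<..m}" using c False by (auto simp: m_def)
    ultimately show ?thesis using cm by simp
  qed
qed

lemma elem_step_product:
  assumes "0 \<le> a" "a \<le> b" "bounded_past a \<xi>" "0 \<le> c" "c \<le> d" "bounded_past c \<eta>"
  shows "has_bochner_integral M (\<lambda>\<omega>. (\<xi> \<omega> * increment i a b \<omega>) * (\<eta> \<omega> * increment i c d \<omega>))
    (expectation (\<lambda>\<omega>. \<xi> \<omega> * \<eta> \<omega>) * measure lborel ({a<..b} \<inter> {c<..d}))"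
proof (cases "a \<le> c")
  case True
  then show ?thesis using elem_step_product_ordered assms by simp
next
  case False
  then have "has_bochner_integral M (\<lambda>\<omega>. (\<eta> \<omega> * increment i c d \<omega>) * (\<xi> \<omega> * increment i a b \<omega>))
    (expectation (\<lambda>\<omega>. \<eta> \<omega> * \<xi> \<omega>) * measure lborel ({c<..d} \<inter> {a<..b}))"
    using assms by (intro elem_step_product_ordered) auto
  then show ?thesis by (simp add: mult.commute Int_commute)
qed

text \<open>Both sides are the double sum, over pairs of steps, of the mean product of their values times the
  length of the overlap of their intervals.\<close>

theorem elem_isometry:
  assumes "elementary l"
  shows "sqn M (elem_integral i l) = sqn (M \<Otimes>\<^sub>M lborel) (elem_value l)"
proof -
  define n where "n = length l"
  define a where "a j = fst (l ! j)" for j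
  define b where "b j = fst (snd (l ! j))" for j
  define \<xi> where "\<xi> j = snd (snd (l ! j))" for j
  have step: "0 \<le> a j" "a j \<le> b j" "bounded_past (a j) (\<xi> j)" if "j < n" for j
    using assms nth_mem[of j l] that unfolding elementary_def n_def a_def b_def \<xi>_def
    by (auto simp: case_prod_beta)
  have I: "elem_integral i l \<omega> = (\<Sum>j<n. \<xi> j \<omega> * increment i (a j) (b j) \<omega>)" for \<omega>
    unfolding elem_integral_def n_def a_def b_def \<xi>_def
    by (simp add: sum_list_sum_nth case_prod_beta lessThan_atLeast0)
  have V: "elem_value l (\<omega>, u) = (\<Sum>j<n. \<xi> j \<omega> * indicator {a j<..b j} u)" for \<omega> u
    unfolding elem_value_def n_def a_def b_def \<xi>_def
    by (simp add: sum_list_sum_nth case_prod_beta lessThan_atLeast0)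
  define C where "C j k = measure lborel ({a j<..b j} \<inter> {a k<..b k})" for j k
  define E where "E = (\<Sum>j<n. \<Sum>k<n. expectation (\<lambda>\<omega>. \<xi> j \<omega> * \<xi> k \<omega>) * C j k)"
  have "has_bochner_integral M (\<lambda>\<omega>. \<Sum>j<n. \<Sum>k<n. (\<xi> j \<omega> * increment i (a j) (b j) \<omega>) * (\<xi> k \<omega> * increment i (a k) (b k) \<omega>)) E"
    unfolding E_def C_def using step by (intro has_bochner_integral_sum elem_step_product) auto
  then have "has_bochner_integral M (\<lambda>\<omega>. (elem_integral i l \<omega>)\<^sup>2) E"
    by (simp add: I power2_eq_square sum_product)
  then have lhs: "sqn M (elem_integral i l) = ennreal E"
    unfolding sqn_def by (subst nn_integral_eq_integral) (auto simp: has_bochner_integral_iff)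
  have inner: "has_bochner_integral lborel (\<lambda>u. (elem_value l (\<omega>, u))\<^sup>2) (\<Sum>j<n. \<Sum>k<n. \<xi> j \<omega> * \<xi> k \<omega> * C j k)" for \<omega>
  proof -
    have "has_bochner_integral lborel (\<lambda>u. indicator ({a j<..b j} \<inter> {a k<..b k}) u :: real) (C j k)" if "j < n" for j k
    proof -
      have "emeasure lborel ({a j<..b j} \<inter> {a k<..b k}) \<le> emeasure lborel {a j<..b j}"
        by (intro emeasure_mono) auto
      also have "\<dots> < \<infinity>" using step that by simp
      finally have "emeasure lborel ({a j<..b j} \<inter> {a k<..b k}) < \<infinity>" .
      then show ?thesis unfolding C_def by (intro has_bochner_integral_real_indicator) auto
    qed
    then have "has_bochner_integral lborel (\<lambda>u. \<Sum>j<n. \<Sum>k<n. \<xi> j \<omega> * \<xi> k \<omega> * indicator ({a j<..b j} \<inter> {a k<..b k}) u)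
       (\<Sum>j<n. \<Sum>k<n. \<xi> j \<omega> * \<xi> k \<omega> * C j k)"
      by (intro has_bochner_integral_sum has_bochner_integral_mult_right) auto
    moreover have "(elem_value l (\<omega>, u))\<^sup>2 = (\<Sum>j<n. \<Sum>k<n. \<xi> j \<omega> * \<xi> k \<omega> * indicator ({a j<..b j} \<inter> {a k<..b k}) u)" for u
      unfolding V power2_eq_square sum_product by (simp add: indicator_inter_arith mult_ac del: Int_greaterThanAtMost)
    ultimately show ?thesis by simp
  qed
  have "sqn (M \<Otimes>\<^sub>M lborel) (elem_value l) = (\<integral>\<^sup>+\<omega>. \<integral>\<^sup>+u. ennreal ((elem_value l (\<omega>, u))\<^sup>2) \<partial>lborel \<partial>M)"
    unfolding sqn_def using elem_value_measurable[OF assms] by (subst lborel.nn_integral_fst) auto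
  also have "\<dots> = (\<integral>\<^sup>+\<omega>. ennreal (\<Sum>j<n. \<Sum>k<n. \<xi> j \<omega> * \<xi> k \<omega> * C j k) \<partial>M)"
    using inner by (intro nn_integral_cong, subst nn_integral_eq_integral) (auto simp: has_bochner_integral_iff)
  also have "\<dots> = ennreal E"
  proof (subst nn_integral_eq_integral)
    have int: "integrable M (\<lambda>\<omega>. \<xi> j \<omega> * \<xi> k \<omega>)" if "j < n" "k < n" for j k
      using step that by (intro integrable_bounded_past_mult[of "a j"] integrable_bounded_past[of "a k"]) auto
    show "integrable M (\<lambda>\<omega>. \<Sum>j<n. \<Sum>k<n. \<xi> j \<omega> * \<xi> k \<omega> * C j k)"
      using int by (intro Bochner_Integration.integrable_sum integrable_mult_left) auto
    show "ennreal (\<integral>\<omega>. (\<Sum>j<n. \<Sum>k<n. \<xi> j \<omega> * \<xi> k \<omega> * C j k) \<partial>M) = ennreal E"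
      unfolding E_def using int
      by (subst Bochner_Integration.integral_sum) (auto simp: Bochner_Integration.integral_sum intro!: Bochner_Integration.integrable_sum integrable_mult_left)
    show "AE \<omega> in M. 0 \<le> (\<Sum>j<n. \<Sum>k<n. \<xi> j \<omega> * \<xi> k \<omega> * C j k)"
    proof (rule AE_I2)
      fix \<omega>
      have "0 \<le> (\<integral>u. (elem_value l (\<omega>, u))\<^sup>2 \<partial>lborel)" by simp
      then show "0 \<le> (\<Sum>j<n. \<Sum>k<n. \<xi> j \<omega> * \<xi> k \<omega> * C j k)"
        by (simp only: has_bochner_integral_integral_eq[OF inner])
    qed
  qed
  finally show ?thesis using lhs by simp
qed

text \<open>The Ito integral \<open>I\<close> of \<open>H\<close> over \<open>[0, \<infinity>)\<close> as a limit of elementary integrals. Indicator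
  functions of time intervals are part of the integrand.\<close>

definition ito :: "'d \<Rightarrow> ((real \<Rightarrow> real ^ 'd) \<times> real \<Rightarrow> real) \<Rightarrow> ((real \<Rightarrow> real ^ 'd) \<Rightarrow> real) \<Rightarrow> bool" where
  "ito i H I \<longleftrightarrow> H \<in> borel_measurable (M \<Otimes>\<^sub>M lborel) \<and> I \<in> borel_measurable M \<and>
     (\<exists>l. (\<forall>k. elementary (l k)) \<and>
        (\<lambda>k. sqn (M \<Otimes>\<^sub>M lborel) (\<lambda>p. elem_value (l k) p - H p)) \<longlonglongrightarrow> 0 \<and>
        (\<lambda>k. sqn M (\<lambda>\<omega>. elem_integral i (l k) \<omega> - I \<omega>)) \<longlonglongrightarrow> 0)"

theorem ito_isometry:
  assumes "ito i H I"
  shows "sqn M I = sqn (M \<Otimes>\<^sub>M lborel) H"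
proof -
  obtain l where l: "\<And>k. elementary (l k)"
    "(\<lambda>k. sqn (M \<Otimes>\<^sub>M lborel) (\<lambda>p. elem_value (l k) p - H p)) \<longlonglongrightarrow> 0"
    "(\<lambda>k. sqn M (\<lambda>\<omega>. elem_integral i (l k) \<omega> - I \<omega>)) \<longlonglongrightarrow> 0"
    using assms by (auto simp: ito_def)
  show ?thesis
    by (rule sqn_limit_eq[OF elem_integral_measurable[OF l(1)] _ elem_value_measurable[OF l(1)] _ l(3,2) elem_isometry[OF l(1)]])
      (use assms in \<open>auto simp: ito_def\<close>)
qed

definition elem_uminus :: "'d elem \<Rightarrow> 'd elem" where
  "elem_uminus l = map (\<lambda>(a, b, \<xi>). (a, b, \<lambda>\<omega>. - \<xi> \<omega>)) l"

lemma elem_uminus: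
  shows "elementary l \<Longrightarrow> elementary (elem_uminus l)"
    and "elem_value (elem_uminus l) p = - elem_value l p"
    and "elem_integral i (elem_uminus l) \<omega> = - elem_integral i l \<omega>"
  by (induction l) (auto simp: elem_uminus_def bounded_past_uminus)

lemma ito_diff:
  assumes "ito i H I" "ito i H' I'"
  shows "ito i (\<lambda>p. H p - H' p) (\<lambda>\<omega>. I \<omega> - I' \<omega>)"
proof -
  obtain l where l: "\<And>k. elementary (l k)"
    "(\<lambda>k. sqn (M \<Otimes>\<^sub>M lborel) (\<lambda>p. elem_value (l k) p - H p)) \<longlonglongrightarrow> 0"
    "(\<lambda>k. sqn M (\<lambda>\<omega>. elem_integral i (l k) \<omega> - I \<omega>)) \<longlonglongrightarrow> 0"
    using assms by (auto simp: ito_def)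
  obtain l' where l': "\<And>k. elementary (l' k)"
    "(\<lambda>k. sqn (M \<Otimes>\<^sub>M lborel) (\<lambda>p. elem_value (l' k) p - H' p)) \<longlonglongrightarrow> 0"
    "(\<lambda>k. sqn M (\<lambda>\<omega>. elem_integral i (l' k) \<omega> - I' \<omega>)) \<longlonglongrightarrow> 0"
    using assms by (auto simp: ito_def)
  have [measurable]: "H \<in> borel_measurable (M \<Otimes>\<^sub>M lborel)" "H' \<in> borel_measurable (M \<Otimes>\<^sub>M lborel)"
    "I \<in> borel_measurable M" "I' \<in> borel_measurable M"
    "\<And>k. elem_value (l k) \<in> borel_measurable (M \<Otimes>\<^sub>M lborel)" "\<And>k. elem_value (l' k) \<in> borel_measurable (M \<Otimes>\<^sub>M lborel)"
    "\<And>k. elem_integral i (l k) \<in> borel_measurable M" "\<And>k. elem_integral i (l' k) \<in> borel_measurable M"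
    using assms l(1) l'(1) by (auto simp: ito_def intro: elem_value_measurable elem_integral_measurable)
  have 1: "(\<lambda>k. sqn (M \<Otimes>\<^sub>M lborel) (\<lambda>p. (elem_value (l k) p - H p) - (elem_value (l' k) p - H' p))) \<longlonglongrightarrow> 0"
    by (rule sqn_tendsto_diff[OF _ _ l(2) l'(2)]) measurable
  have 2: "(\<lambda>k. sqn M (\<lambda>\<omega>. (elem_integral i (l k) \<omega> - I \<omega>) - (elem_integral i (l' k) \<omega> - I' \<omega>))) \<longlonglongrightarrow> 0"
    by (rule sqn_tendsto_diff[OF _ _ l(3) l'(3)]) measurable
  show ?thesis
    unfolding ito_def
  proof (intro conjI exI[of _ "\<lambda>k. l k @ elem_uminus (l' k)"] allI)
    show "elementary (l k @ elem_uminus (l' k))" for k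
      using l(1) l'(1) by (simp add: elem_uminus)
    show "(\<lambda>k. sqn (M \<Otimes>\<^sub>M lborel) (\<lambda>p. elem_value (l k @ elem_uminus (l' k)) p - (H p - H' p))) \<longlonglongrightarrow> 0"
      using 1 by (simp add: elem_uminus algebra_simps)
    show "(\<lambda>k. sqn M (\<lambda>\<omega>. elem_integral i (l k @ elem_uminus (l' k)) \<omega> - (I \<omega> - I' \<omega>))) \<longlonglongrightarrow> 0"
      using 2 by (simp add: elem_uminus algebra_simps)
  qed measurable
qed

lemma ito_step:
  assumes "0 \<le> s" "s \<le> t" "bounded_past s \<zeta>"
  shows "ito i (\<lambda>p. \<zeta> (fst p) * indicator {s<..t} (snd p)) (\<lambda>\<omega>. \<zeta> \<omega> * increment i s t \<omega>)"
proof -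
  have [measurable]: "\<zeta> \<in> borel_measurable M" using assms(3) by (rule bounded_past_measurable)
  show ?thesis
    unfolding ito_def
    by (intro conjI exI[of _ "\<lambda>_. [(s, t, \<zeta>)]"]) (use assms in \<open>auto simp: sqn_def\<close>)
qed

text \<open>The part of an elementary integrand before time \<open>s\<close>. A step that begins after \<open>s\<close> becomes empty;
  its value is replaced by \<open>0\<close> because it need not be known at time \<open>s\<close>.\<close>

definition elem_before :: "real \<Rightarrow> 'd elem \<Rightarrow> 'd elem" where
  "elem_before s l = map (\<lambda>(a, b, \<xi>). (min a s, min b s, if a \<le> s then \<xi> else (\<lambda>_. 0))) l"

lemma elem_before:
  assumes "0 \<le> s" "elementary l"
  shows "elementary (elem_before s l)"
    and "elem_value (elem_before s l) p = elem_value l p * indicator {..s} (snd p)"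
proof -
  have "elementary (elem_before s l) \<and> elem_value (elem_before s l) p = elem_value l p * indicator {..s} (snd p)"
    using assms(2)
  proof (induction l)
    case (Cons x l)
    obtain a b \<xi> where x: "x = (a, b, \<xi>)" by (cases x)
    have "bounded_past (min a s) (if a \<le> s then \<xi> else (\<lambda>_. 0))"
      using Cons.prems x by (auto simp: bounded_past_def)
    moreover have "(if a \<le> s then \<xi> else (\<lambda>_. 0)) (fst p) * indicator {min a s<..min b s} (snd p)
       = \<xi> (fst p) * indicator {a<..b} (snd p) * (indicator {..s} (snd p) :: real)"
      by (auto simp: indicator_def min_def split: if_splits)
    ultimately show ?case
      using Cons assms(1) unfolding x elem_before_def by (auto simp: algebra_simps)
  qed (simp add: elem_before_def)
  then show "elementary (elem_before s l)"
    "elem_value (elem_before s l) p = elem_value l p * indicator {..s} (snd p)" by auto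
qed

text \<open>When the part before time \<open>s\<close> is removed, steps remain that begin at \<open>s\<close> or later. Their values
  times \<open>Z\<close> are known when they begin.\<close>

lemma elem_integral_after_orthogonal:
  assumes "0 \<le> s" "elementary l" "bounded_past s Z"
  shows "has_bochner_integral M (\<lambda>\<omega>. Z \<omega> * (elem_integral i l \<omega> - elem_integral i (elem_before s l) \<omega>)) 0"
  using assms(2)
proof (induction l)
  case (Cons x l)
  obtain a b \<xi> where x: "x = (a, b, \<xi>)" by (cases x)
  define c where "c = max a s"
  define d where "d = max b s"
  have p: "bounded_past c (\<lambda>\<omega>. Z \<omega> * \<xi> \<omega>)" and cd: "c \<le> d" "0 \<le> c"
    using Cons.prems assms(1,3) x by (auto simp: c_def d_def intro!: bounded_past_mult intro: bounded_past_mono)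
  have "has_bochner_integral M (\<lambda>\<omega>. Z \<omega> * \<xi> \<omega> * increment i c d \<omega>) 0"
    using p cd by (intro has_expectation_increment integrable_bounded_past[OF p]) (auto simp: bounded_past_def)
  then have "has_bochner_integral M (\<lambda>\<omega>. Z \<omega> * \<xi> \<omega> * increment i c d \<omega> +
      Z \<omega> * (elem_integral i l \<omega> - elem_integral i (elem_before s l) \<omega>)) (0 + 0)"
    using Cons x by (intro has_bochner_integral_add) auto
  moreover have "Z \<omega> * \<xi> \<omega> * increment i c d \<omega> + Z \<omega> * (elem_integral i l \<omega> - elem_integral i (elem_before s l) \<omega>)
     = Z \<omega> * (elem_integral i (x # l) \<omega> - elem_integral i (elem_before s (x # l)) \<omega>)" for \<omega>
    using Cons.prems unfolding x elem_before_def c_def d_def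
    by (auto simp: algebra_simps max_def min_def)
  ultimately show ?case by simp
qed (simp add: elem_before_def has_bochner_integral_zero)

text \<open>Let \<open>l k\<close> approximate \<open>H\<close>. Since \<open>H\<close> vanishes up to time \<open>s\<close>, the part of \<open>l k\<close> before \<open>s\<close> tends
  to \<open>0\<close>, and by the isometry so does its integral. The remaining part is orthogonal to \<open>Z\<close>.\<close>

lemma ito_orthogonal_past:
  assumes I: "ito i H I" "integrable M I" and s: "0 \<le> s"
    and H: "\<And>p. snd p \<le> s \<Longrightarrow> H p = 0" and Z: "bounded_past s Z"
  shows "expectation (\<lambda>\<omega>. Z \<omega> * I \<omega>) = 0"
proof -
  obtain l where l: "\<And>k. elementary (l k)"
    "(\<lambda>k. sqn (M \<Otimes>\<^sub>M lborel) (\<lambda>p. elem_value (l k) p - H p)) \<longlonglongrightarrow> 0"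
    "(\<lambda>k. sqn M (\<lambda>\<omega>. elem_integral i (l k) \<omega> - I \<omega>)) \<longlonglongrightarrow> 0"
    using I by (auto simp: ito_def)
  define A where "A k \<omega> = elem_integral i (l k) \<omega> - elem_integral i (elem_before s (l k)) \<omega>" for k \<omega>
  have [measurable]: "I \<in> borel_measurable M"
    "\<And>k. elem_integral i (l k) \<in> borel_measurable M" "\<And>k. elem_integral i (elem_before s (l k)) \<in> borel_measurable M"
    using I l(1) by (auto simp: ito_def intro: elem_integral_measurable elem_before s)
  have "(\<lambda>k. sqn M (elem_integral i (elem_before s (l k)))) \<longlonglongrightarrow> 0"
  proof (rule tendsto_sandwich[OF _ _ tendsto_const l(2)])
    have "sqn M (elem_integral i (elem_before s (l k))) \<le> sqn (M \<Otimes>\<^sub>M lborel) (\<lambda>p. elem_value (l k) p - H p)" for k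
    proof -
      have "sqn M (elem_integral i (elem_before s (l k))) = sqn (M \<Otimes>\<^sub>M lborel) (elem_value (elem_before s (l k)))"
        by (rule elem_isometry[OF elem_before(1)[OF s l(1)]])
      also have "\<dots> \<le> sqn (M \<Otimes>\<^sub>M lborel) (\<lambda>p. elem_value (l k) p - H p)"
        by (rule sqn_mono) (auto simp: elem_before(2)[OF s l(1)] H indicator_def)
      finally show ?thesis .
    qed
    then show "\<forall>\<^sub>F k in sequentially. sqn M (elem_integral i (elem_before s (l k))) \<le> sqn (M \<Otimes>\<^sub>M lborel) (\<lambda>p. elem_value (l k) p - H p)"
      by simp
  qed auto
  then have lim: "(\<lambda>k. sqn M (\<lambda>\<omega>. (elem_integral i (l k) \<omega> - I \<omega>) - elem_integral i (elem_before s (l k)) \<omega>)) \<longlonglongrightarrow> 0"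
    by (intro sqn_tendsto_diff l(3)) measurable
  obtain K where K: "\<And>\<omega>. \<omega> \<in> space M \<Longrightarrow> \<bar>Z \<omega>\<bar> \<le> K" using Z by (auto simp: bounded_past_def)
  have [measurable]: "Z \<in> borel_measurable M" by (rule bounded_past_measurable[OF Z])
  have bound: "\<bar>expectation (\<lambda>\<omega>. Z \<omega> * I \<omega>)\<bar> \<le> \<bar>K\<bar> * (2 * \<delta>)" if \<delta>: "0 < \<delta>" for \<delta> :: real
  proof -
    have "\<forall>\<^sub>F k in sequentially. sqn M (\<lambda>\<omega>. (elem_integral i (l k) \<omega> - I \<omega>) - elem_integral i (elem_before s (l k)) \<omega>) < ennreal (\<delta>\<^sup>2)"
      using lim \<delta> by (intro order_tendstoD(2)) auto
    then obtain k where k: "sqn M (\<lambda>\<omega>. (elem_integral i (l k) \<omega> - I \<omega>) - elem_integral i (elem_before s (l k)) \<omega>) < ennreal (\<delta>\<^sup>2)"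
      by (auto simp: eventually_sequentially)
    \<comment> \<open>As \<open>A k\<close> is orthogonal to \<open>Z\<close>, only the error \<open>J\<close> of norm at most \<open>\<delta>\<close> contributes; its mean is
        bounded through \<open>\<bar>J\<bar> \<le> \<delta> + J\<^sup>2 / \<delta>\<close>.\<close>
    define J where "J \<omega> = A k \<omega> - I \<omega>" for \<omega>
    have Jm [measurable]: "J \<in> borel_measurable M" unfolding J_def A_def by measurable
    have J2: "(\<integral>\<^sup>+\<omega>. ennreal ((J \<omega>)\<^sup>2) \<partial>M) < ennreal (\<delta>\<^sup>2)"
      using k unfolding sqn_def J_def A_def by (simp add: algebra_simps)
    have iJ2: "integrable M (\<lambda>\<omega>. (J \<omega>)\<^sup>2)"
      using J2 by (intro integrableI_nonneg) (auto intro: order.strict_trans)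
    have EJ2: "expectation (\<lambda>\<omega>. (J \<omega>)\<^sup>2) \<le> \<delta>\<^sup>2"
      using J2 nn_integral_eq_integral[OF iJ2] \<delta> by (simp add: ennreal_less_iff)
    have hZA: "has_bochner_integral M (\<lambda>\<omega>. Z \<omega> * A k \<omega>) 0"
      unfolding A_def by (rule elem_integral_after_orthogonal[OF s l(1) Z])
    have hZI: "integrable M (\<lambda>\<omega>. Z \<omega> * I \<omega>)" by (rule integrable_bounded_past_mult[OF Z I(2)])
    have iZJ: "integrable M (\<lambda>\<omega>. Z \<omega> * J \<omega>)"
      using hZA hZI unfolding J_def right_diff_distrib by (auto simp: has_bochner_integral_iff)
    have "expectation (\<lambda>\<omega>. Z \<omega> * I \<omega>) = - expectation (\<lambda>\<omega>. Z \<omega> * J \<omega>)"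
      using hZA hZI unfolding J_def right_diff_distrib by (auto simp: has_bochner_integral_iff)
    then have "\<bar>expectation (\<lambda>\<omega>. Z \<omega> * I \<omega>)\<bar> \<le> expectation (\<lambda>\<omega>. \<bar>Z \<omega> * J \<omega>\<bar>)"
      by simp
    also have "\<dots> \<le> expectation (\<lambda>\<omega>. \<bar>K\<bar> * (\<delta> + (J \<omega>)\<^sup>2 / \<delta>))"
    proof (rule integral_mono)
      show "integrable M (\<lambda>\<omega>. \<bar>Z \<omega> * J \<omega>\<bar>)" using iZJ by (rule integrable_abs)
      show "integrable M (\<lambda>\<omega>. \<bar>K\<bar> * (\<delta> + (J \<omega>)\<^sup>2 / \<delta>))" using iJ2 by auto
      fix \<omega> assume w: "\<omega> \<in> space M"
      have "\<bar>J \<omega>\<bar> \<le> \<delta> + (J \<omega>)\<^sup>2 / \<delta>"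
      proof (cases "\<bar>J \<omega>\<bar> \<le> \<delta>")
        case False
        then have "\<bar>J \<omega>\<bar> * \<delta> \<le> \<bar>J \<omega>\<bar> * \<bar>J \<omega>\<bar>" using \<delta> by (intro mult_left_mono) auto
        then have "\<bar>J \<omega>\<bar> \<le> (J \<omega>)\<^sup>2 / \<delta>" using \<delta> by (simp add: field_simps power2_eq_square)
        then show ?thesis using \<delta> by simp
      qed (use \<delta> in \<open>auto intro: order.trans\<close>)
      moreover have "\<bar>Z \<omega>\<bar> \<le> \<bar>K\<bar>" using K[OF w] by simp
      ultimately show "\<bar>Z \<omega> * J \<omega>\<bar> \<le> \<bar>K\<bar> * (\<delta> + (J \<omega>)\<^sup>2 / \<delta>)"
        unfolding abs_mult by (intro mult_mono) auto
    qed
    also have "\<dots> = \<bar>K\<bar> * (\<delta> + expectation (\<lambda>\<omega>. (J \<omega>)\<^sup>2) / \<delta>)"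
      using iJ2 by (simp add: prob_space)
    also have "\<dots> \<le> \<bar>K\<bar> * (2 * \<delta>)"
      using EJ2 \<delta> by (intro mult_left_mono) (auto simp: field_simps power2_eq_square)
    finally show ?thesis .
  qed
  have "\<bar>expectation (\<lambda>\<omega>. Z \<omega> * I \<omega>)\<bar> \<le> 0 + e" if "0 < e" for e
  proof -
    have "\<bar>expectation (\<lambda>\<omega>. Z \<omega> * I \<omega>)\<bar> \<le> \<bar>K\<bar> * (2 * (e / (2 * (\<bar>K\<bar> + 1))))"
      using that by (intro bound) auto
    also have "\<dots> \<le> e" using that by (simp add: field_simps)
    finally show ?thesis by simp
  qed
  then have "\<bar>expectation (\<lambda>\<omega>. Z \<omega> * I \<omega>)\<bar> \<le> 0" by (rule field_le_epsilon)
  then show ?thesis by simp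
qed

text \<open>A simple integrand is supported in \<open>{0<..T}\<close>, so its distance to \<open>H\<close> on \<open>[0, T]\<close> bounds the
  distance to \<open>H\<close> cut off outside of that interval.\<close>

lemma has_ito_integral_ito:
  assumes I: "has_ito_integral M \<F> (\<lambda>t \<omega>. \<omega> t $ i) H T I"
    and [measurable]: "(\<lambda>p. H (snd p) (fst p)) \<in> borel_measurable (M \<Otimes>\<^sub>M lborel)"
  shows "ito i (\<lambda>p. H (snd p) (fst p) * indicator {0<..T} (snd p)) I"
proof -
  obtain n \<tau> \<xi> where simple: "\<And>k. simple_integrand M \<F> T (n k) (\<tau> k) (\<xi> k)"
    and lim: "(\<lambda>k. \<integral>\<^sup>+ \<omega>. (\<integral>\<^sup>+ s. ennreal ((H s \<omega> - simple_value (n k) (\<tau> k) (\<xi> k) s \<omega>)\<^sup>2)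
                * indicator {0..T} s \<partial>lborel) \<partial>M) \<longlonglongrightarrow> 0"
      "(\<lambda>k. \<integral>\<^sup>+ \<omega>. ennreal ((I \<omega> - simple_integral (\<lambda>t \<omega>. \<omega> t $ i) (n k) (\<tau> k) (\<xi> k) \<omega>)\<^sup>2) \<partial>M) \<longlonglongrightarrow> 0"
    using I unfolding has_ito_integral_def by blast
  define l where "l k = map (\<lambda>j. (\<tau> k j, \<tau> k (Suc j), \<xi> k j)) [0..<n k]" for k
  have val: "elem_value (l k) p = simple_value (n k) (\<tau> k) (\<xi> k) (snd p) (fst p)" for k p
    unfolding elem_value_def l_def simple_value_def
    by (simp add: comp_def interv_sum_list_conv_sum_set_nat lessThan_atLeast0)
  have int: "elem_integral i (l k) \<omega> = simple_integral (\<lambda>t \<omega>. \<omega> t $ i) (n k) (\<tau> k) (\<xi> k) \<omega>" for k \<omega>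
    unfolding elem_integral_def l_def simple_integral_def
    by (simp add: comp_def interv_sum_list_conv_sum_set_nat lessThan_atLeast0)
  have ends: "\<tau> k 0 = 0" "\<tau> k (n k) = T" and inc: "\<And>j. j < n k \<Longrightarrow> \<tau> k j \<le> \<tau> k (Suc j)" for k
    using simple[of k] by (auto simp: simple_integrand_def)
  have mono: "\<tau> k j \<le> \<tau> k j'" if "j \<le> j'" "j' \<le> n k" for k j j'
    using that
  proof (induction j' rule: dec_induct)
    case (step m)
    then show ?case using inc[of m k] by simp
  qed simp
  have range: "0 \<le> \<tau> k j" "\<tau> k j \<le> T" if "j \<le> n k" for k j
    using mono[of 0 j k] mono[of j "n k" k] that ends by auto
  have el: "elementary (l k)" for k
    using simple[of k] range[of _ k] unfolding l_def elementary_def simple_integrand_def bounded_past_def by auto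
  have supp: "elem_value (l k) p = 0" if "snd p \<notin> {0<..T}" for k p
    unfolding val simple_value_def
  proof (intro sum.neutral ballI)
    fix j assume "j \<in> {..<n k}"
    then have "snd p \<notin> {\<tau> k j<..\<tau> k (Suc j)}" using that range[of j k] range[of "Suc j" k] by auto
    then show "\<xi> k j (fst p) * indicator {\<tau> k j<..\<tau> k (Suc j)} (snd p) = 0" by simp
  qed
  have [measurable]: "elem_value (l k) \<in> borel_measurable (M \<Otimes>\<^sub>M lborel)" for k
    by (rule elem_value_measurable[OF el])
  have "(\<lambda>k. sqn (M \<Otimes>\<^sub>M lborel) (\<lambda>p. elem_value (l k) p - H (snd p) (fst p) * indicator {0<..T} (snd p))) \<longlonglongrightarrow> 0"
  proof (rule tendsto_sandwich[OF _ _ tendsto_const lim(1)])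
    have "sqn (M \<Otimes>\<^sub>M lborel) (\<lambda>p. elem_value (l k) p - H (snd p) (fst p) * indicator {0<..T} (snd p)) \<le>
      (\<integral>\<^sup>+ \<omega>. (\<integral>\<^sup>+ s. ennreal ((H s \<omega> - simple_value (n k) (\<tau> k) (\<xi> k) s \<omega>)\<^sup>2) * indicator {0..T} s \<partial>lborel) \<partial>M)" for k
    proof -
      have "sqn (M \<Otimes>\<^sub>M lborel) (\<lambda>p. elem_value (l k) p - H (snd p) (fst p) * indicator {0<..T} (snd p)) =
        (\<integral>\<^sup>+ \<omega>. (\<integral>\<^sup>+ s. ennreal ((elem_value (l k) (\<omega>, s) - H s \<omega> * indicator {0<..T} s)\<^sup>2) \<partial>lborel) \<partial>M)"
        unfolding sqn_def by (subst lborel.nn_integral_fst[symmetric]) auto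
      also have "\<dots> \<le> (\<integral>\<^sup>+ \<omega>. (\<integral>\<^sup>+ s. ennreal ((H s \<omega> - simple_value (n k) (\<tau> k) (\<xi> k) s \<omega>)\<^sup>2) * indicator {0..T} s \<partial>lborel) \<partial>M)"
      proof (intro nn_integral_mono)
        fix \<omega> s
        show "ennreal ((elem_value (l k) (\<omega>, s) - H s \<omega> * indicator {0<..T} s)\<^sup>2) \<le>
           ennreal ((H s \<omega> - simple_value (n k) (\<tau> k) (\<xi> k) s \<omega>)\<^sup>2) * indicator {0..T} s"
        proof (cases "s \<in> {0<..T}")
          case True
          then show ?thesis by (simp add: val power2_commute)
        next
          case False
          then show ?thesis using supp[of "(\<omega>, s)" k] by simp
        qed
      qed
      finally show ?thesis .
    qed
    then show "\<forall>\<^sub>F k in sequentially. sqn (M \<Otimes>\<^sub>M lborel) (\<lambda>p. elem_value (l k) p - H (snd p) (fst p) * indicator {0<..T} (snd p)) \<le>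
      (\<integral>\<^sup>+ \<omega>. (\<integral>\<^sup>+ s. ennreal ((H s \<omega> - simple_value (n k) (\<tau> k) (\<xi> k) s \<omega>)\<^sup>2) * indicator {0..T} s \<partial>lborel) \<partial>M)"
      by simp
  qed auto
  moreover have "(\<lambda>k. sqn M (\<lambda>\<omega>. elem_integral i (l k) \<omega> - I \<omega>)) \<longlonglongrightarrow> 0"
    using lim(2) unfolding sqn_def int by (simp add: power2_commute)
  moreover have "I \<in> borel_measurable M" using I by (simp add: has_ito_integral_def)
  ultimately show ?thesis
    unfolding ito_def using el by auto
qed

end

section \<open>Solutions of the stochastic logistic equation\<close>

text \<open>A step of the Euler scheme. The truncation of the increment keeps it inside the unit interval.\<close>

definition euler_step :: "real \<Rightarrow> real \<Rightarrow> real" where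
  "euler_step x w = x + x * (1 - x) * max (-1/2) (min (1/2) w)"

lemma euler_step_measurable [measurable (raw)]:
  assumes [measurable]: "f \<in> borel_measurable N" "g \<in> borel_measurable N"
  shows "(\<lambda>x. euler_step (f x) (g x)) \<in> borel_measurable N"
  unfolding euler_step_def by measurable

lemma euler_step_factors:
  assumes "w = max (-1/2) (min (1/2) v)"
  shows "euler_step x v = x * (1 + (1 - x) * w)" "1 - euler_step x v = (1 - x) * (1 - x * w)"
    "euler_step x v - euler_step y v = (x - y) * (1 + (1 - x - y) * w)"
  unfolding euler_step_def assms by (auto simp: algebra_simps)

lemma unit_interval_times_clamp:
  fixes w x :: real
  assumes "\<bar>w\<bar> \<le> 1/2" "0 \<le> x" "x \<le> 1"
  shows "0 < 1 + x * w" "0 < 1 - x * w"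
proof -
  have "\<bar>x * w\<bar> \<le> 1 * (1/2)" unfolding abs_mult using assms by (intro mult_mono) auto
  then show "0 < 1 + x * w" "0 < 1 - x * w" by auto
qed

lemma euler_step_bounds:
  assumes "0 \<le> x" "x \<le> 1"
  shows "0 \<le> euler_step x v" "euler_step x v \<le> 1"
    "0 < x \<Longrightarrow> 0 < euler_step x v" "x < 1 \<Longrightarrow> euler_step x v < 1"
proof -
  define w where "w = max (-1/2) (min (1/2) v)"
  have w: "\<bar>w\<bar> \<le> 1/2" unfolding w_def by auto
  have *: "0 < 1 + (1 - x) * w" "0 < 1 - x * w"
    using unit_interval_times_clamp[OF w, of "1 - x"] unit_interval_times_clamp[OF w, of x] assms by auto
  have e: "euler_step x v = x * (1 + (1 - x) * w)" "1 - euler_step x v = (1 - x) * (1 - x * w)"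
    using euler_step_factors[OF w_def] by auto
  show "0 \<le> euler_step x v" "0 < x \<Longrightarrow> 0 < euler_step x v" unfolding e(1) using * assms by auto
  have "0 \<le> 1 - euler_step x v" "x < 1 \<Longrightarrow> 0 < 1 - euler_step x v" unfolding e(2) using * assms by auto
  then show "euler_step x v \<le> 1" "x < 1 \<Longrightarrow> euler_step x v < 1" by auto
qed

text \<open>In terms of the odds ratio \<open>R = y (1 - x) / (x (1 - y))\<close> this is \<open>R + 1/R - 2\<close>, an increasing
  function of the distance \<open>\<bar>ln R\<bar>\<close> of \<open>ln (x / (1 - x))\<close> and \<open>ln (y / (1 - y))\<close>. It is rational and
  symmetric, so neither logarithms nor an order of the two points are needed.\<close>

definition separation :: "real \<Rightarrow> real \<Rightarrow> real" where
  "separation x y = (x - y)\<^sup>2 / (x * (1 - x) * (y * (1 - y)))"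

text \<open>A step multiplies the difference \<open>x - y\<close> by \<open>u = 1 + (1 - x - y) w\<close>, and each of the products
  \<open>x (1 - y)\<close> and \<open>y (1 - x)\<close> by \<open>u\<close> minus a nonnegative multiple of \<open>w\<^sup>2\<close>.\<close>

lemma separation_euler_step:
  assumes x: "0 < x" "x < 1" and y: "0 < y" "y < 1"
  shows "separation x y \<le> separation (euler_step x v) (euler_step y v)"
proof -
  define w where "w = max (-1/2) (min (1/2) v)"
  have w: "\<bar>w\<bar> \<le> 1/2" unfolding w_def by auto
  define u where "u = 1 + (1 - x - y) * w"
  define p where "p = (1 + (1 - x) * w) * (1 - y * w)"
  define q where "q = (1 + (1 - y) * w) * (1 - x * w)"
  have pos: "0 < 1 + (1 - x) * w" "0 < 1 - x * w" "0 < 1 + (1 - y) * w" "0 < 1 - y * w"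
    using unit_interval_times_clamp[OF w, of "1 - x"] unit_interval_times_clamp[OF w, of x]
      unit_interval_times_clamp[OF w, of "1 - y"] unit_interval_times_clamp[OF w, of y] x y by auto
  have p: "0 < p" "p \<le> u"
  proof -
    show "0 < p" unfolding p_def using pos by simp
    have "p = u - (1 - x) * y * w\<^sup>2" unfolding p_def u_def by (simp add: algebra_simps power2_eq_square)
    then show "p \<le> u" using x y by simp
  qed
  have q: "0 < q" "q \<le> u"
  proof -
    show "0 < q" unfolding q_def using pos by simp
    have "q = u - (1 - y) * x * w\<^sup>2" unfolding q_def u_def by (simp add: algebra_simps power2_eq_square)
    then show "q \<le> u" using x y by simp
  qed
  have pq: "p * q \<le> u\<^sup>2" unfolding power2_eq_square using p q by (intro mult_mono) auto
  have S: "0 < x * (1 - x) * (y * (1 - y))" using x y by simp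
  have "separation (euler_step x v) (euler_step y v) = ((x - y) * u)\<^sup>2 / (x * (1 - x) * (y * (1 - y)) * (p * q))"
  proof -
    note e = euler_step_factors[OF w_def]
    have "euler_step x v * (1 - euler_step x v) * (euler_step y v * (1 - euler_step y v)) =
      (x * (1 + (1 - x) * w)) * ((1 - x) * (1 - x * w)) * ((y * (1 + (1 - y) * w)) * ((1 - y) * (1 - y * w)))"
      by (intro arg_cong2[where f = "(*)"] e)
    also have "\<dots> = x * (1 - x) * (y * (1 - y)) * (p * q)"
      unfolding p_def q_def by (simp only: mult_ac)
    finally show ?thesis unfolding separation_def e(3) u_def by simp
  qed
  also have "\<dots> = separation x y * (u\<^sup>2 / (p * q))"
    unfolding separation_def by (simp add: power_mult_distrib)
  also have "\<dots> \<ge> separation x y * 1"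
    using S pq p q by (intro mult_left_mono) (auto simp: separation_def)
  finally show ?thesis by simp
qed

text \<open>The truncation error is compared with the fourth moment, which is of the order \<open>h\<^sup>2\<close> for an
  increment over time \<open>h\<close>: summed over the \<open>1 / h\<close> steps of the scheme it is negligible.\<close>

lemma clamp_error:
  fixes w :: real
  shows "\<bar>w - max (-1/2) (min (1/2) w)\<bar> \<le> 8 * w ^ 4" "(w - max (-1/2) (min (1/2) w))\<^sup>2 \<le> 4 * w ^ 4"
proof -
  have "\<bar>w - max (-1/2) (min (1/2) w)\<bar> \<le> 8 * w ^ 4 \<and> (w - max (-1/2) (min (1/2) w))\<^sup>2 \<le> 4 * w ^ 4"
  proof (cases "\<bar>w\<bar> \<le> 1/2")
    case True
    then have "w - max (-1/2) (min (1/2) w) = 0" by auto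
    then show ?thesis by simp
  next
    case False
    have le: "\<bar>w - max (-1/2) (min (1/2) w)\<bar> \<le> \<bar>w\<bar>" by auto
    have w2: "1 \<le> 4 * \<bar>w\<bar>\<^sup>2" using False power_mono[of "1/2" "\<bar>w\<bar>" 2] by (simp add: power2_eq_square)
    have w3: "1 \<le> 8 * \<bar>w\<bar> ^ 3" using False power_mono[of "1/2" "\<bar>w\<bar>" 3] by (simp add: power3_eq_cube)
    have "\<bar>w\<bar> * 1 \<le> \<bar>w\<bar> * (8 * \<bar>w\<bar> ^ 3)" using w3 by (intro mult_left_mono) auto
    also have "\<dots> = 8 * \<bar>w\<bar> ^ 4" by (simp add: power_Suc[symmetric] del: power_Suc)
    also have "\<dots> = 8 * w ^ 4" by simp
    finally have 1: "\<bar>w\<bar> \<le> 8 * w ^ 4" by simp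
    have "\<bar>w\<bar>\<^sup>2 * 1 \<le> \<bar>w\<bar>\<^sup>2 * (4 * \<bar>w\<bar>\<^sup>2)" using w2 by (intro mult_left_mono) auto
    also have "\<dots> = 4 * w ^ 4" by (simp add: power_add[symmetric])
    finally have "w\<^sup>2 \<le> 4 * w ^ 4" by simp
    moreover have "(w - max (-1/2) (min (1/2) w))\<^sup>2 \<le> w\<^sup>2"
      using le abs_le_square_iff by blast
    ultimately show ?thesis using 1 le by linarith
  qed
  then show "\<bar>w - max (-1/2) (min (1/2) w)\<bar> \<le> 8 * w ^ 4" "(w - max (-1/2) (min (1/2) w))\<^sup>2 \<le> 4 * w ^ 4" by auto
qed

lemma logistic_lipschitz:
  fixes x y :: real
  assumes "0 \<le> x" "x \<le> 1" "0 \<le> y" "y \<le> 1"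
  shows "(x * (1 - x) - y * (1 - y))\<^sup>2 \<le> (x - y)\<^sup>2"
proof -
  have "x * (1 - x) - y * (1 - y) = (x - y) * (1 - x - y)" by (simp add: algebra_simps)
  moreover have "(1 - x - y)\<^sup>2 \<le> 1\<^sup>2" using assms by (intro abs_le_square_iff[THEN iffD1]) auto
  ultimately show ?thesis
    using mult_left_mono[of "(1 - x - y)\<^sup>2" 1 "(x - y)\<^sup>2"] by (simp add: power_mult_distrib)
qed

lemma logistic_bounds:
  fixes x :: real
  assumes "0 \<le> x" "x \<le> 1"
  shows "0 \<le> x * (1 - x)" "x * (1 - x) \<le> 1"
  using assms mult_mono[of x 1 "1 - x" 1] by auto

lemma square_le_of_split: "(x - z)\<^sup>2 \<le> 2 * (x - y)\<^sup>2 + 2 * (y - z)\<^sup>2" for x y z :: real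
proof -
  have "0 \<le> ((x - y) - (y - z))\<^sup>2" by simp
  then show ?thesis by (simp add: power2_eq_square algebra_simps)
qed

lemma sqn_le_imp_integral_le:
  assumes [measurable]: "f \<in> borel_measurable N" and "sqn N f \<le> ennreal B" "0 \<le> B"
  shows "integrable N (\<lambda>x. (f x)\<^sup>2)" "(\<integral>x. (f x)\<^sup>2 \<partial>N) \<le> B"
proof -
  show int: "integrable N (\<lambda>x. (f x)\<^sup>2)"
    using assms(2) unfolding sqn_def by (intro integrableI_nonneg) (auto intro: le_less_trans)
  show "(\<integral>x. (f x)\<^sup>2 \<partial>N) \<le> B"
    using assms(2,3) nn_integral_eq_integral[OF int] unfolding sqn_def by (simp add: ennreal_le_iff)
qed

context wiener
begin

text \<open>A solution of the equation for one coordinate. Joint measurability and the range are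
  required for all times, also for negative ones, and for all paths.\<close>

definition logistic_solution :: "'d \<Rightarrow> real \<Rightarrow> (real \<Rightarrow> (real \<Rightarrow> real ^ 'd) \<Rightarrow> real) \<Rightarrow> bool" where
  "logistic_solution i c X \<longleftrightarrow> solves_ito_sde M \<F> (\<lambda>t \<omega>. \<omega> t $ i) (\<lambda>y. y * (1 - y)) c X \<and>
     (\<lambda>p. X (snd p) (fst p)) \<in> borel_measurable (M \<Otimes>\<^sub>M lborel) \<and>
     (\<forall>t. \<forall>\<omega>\<in>space M. 0 \<le> X t \<omega> \<and> X t \<omega> \<le> 1)"

lemma integrable_bounded:
  assumes "f \<in> borel_measurable M" "\<And>\<omega>. \<omega> \<in> space M \<Longrightarrow> \<bar>f \<omega>\<bar> \<le> K"
  shows "integrable M (f :: _ \<Rightarrow> real)"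
  using assms by (intro integrable_const_bound[where B=K]) auto

lemma integrable_unit_interval_diff_square:
  fixes f g :: "_ \<Rightarrow> real"
  assumes [measurable]: "f \<in> borel_measurable M" "g \<in> borel_measurable M"
    and r: "\<And>\<omega>. \<omega> \<in> space M \<Longrightarrow> 0 \<le> f \<omega> \<and> f \<omega> \<le> 1" "\<And>\<omega>. \<omega> \<in> space M \<Longrightarrow> 0 \<le> g \<omega> \<and> g \<omega> \<le> 1"
  shows "integrable M (\<lambda>\<omega>. (f \<omega> - g \<omega>)\<^sup>2)"
proof (rule integrable_bounded[where K=1])
  fix \<omega> assume "\<omega> \<in> space M"
  then have "\<bar>f \<omega> - g \<omega>\<bar> \<le> \<bar>1\<bar>" using r[of \<omega>] by auto
  then have "(f \<omega> - g \<omega>)\<^sup>2 \<le> 1\<^sup>2" by (simp only: abs_le_square_iff)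
  then show "\<bar>(f \<omega> - g \<omega>)\<^sup>2\<bar> \<le> 1" by simp
qed measurable

context
  fixes i c X assumes sol: "logistic_solution i c X"
begin

lemma solution_range: "\<omega> \<in> space M \<Longrightarrow> 0 \<le> X t \<omega>" "\<omega> \<in> space M \<Longrightarrow> X t \<omega> \<le> 1"
  using sol by (auto simp: logistic_solution_def)

lemma solution_jointly_measurable [measurable]:
  "(\<lambda>p. X (snd p) (fst p)) \<in> borel_measurable (M \<Otimes>\<^sub>M lborel)"
  using sol by (simp add: logistic_solution_def)

lemma solution_adapted: "0 \<le> t \<Longrightarrow> X t \<in> borel_measurable (\<F> t)"
  using sol by (simp add: logistic_solution_def solves_ito_sde_def)

lemma solution_continuous: "\<omega> \<in> space M \<Longrightarrow> continuous_on {0..} (\<lambda>t. X t \<omega>)"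
  using sol by (simp add: logistic_solution_def solves_ito_sde_def)

lemma solution_measurable [measurable]: "X t \<in> borel_measurable M"
proof -
  have "(\<lambda>\<omega>. (\<omega>, t)) \<in> measurable M (M \<Otimes>\<^sub>M lborel)" by measurable
  from measurable_compose[OF this solution_jointly_measurable] show ?thesis by simp
qed

lemma solution_bounded_past: "0 \<le> t \<Longrightarrow> bounded_past t (X t)"
  using solution_adapted solution_range unfolding bounded_past_def by (auto intro!: exI[of _ 1])

lemma solution_integrable: "integrable M (X t)"
  using solution_range by (intro integrable_bounded[where K=1]) auto

lemma solution_ito:
  assumes "0 \<le> t"
  shows "ito i (\<lambda>p. X (snd p) (fst p) * (1 - X (snd p) (fst p)) * indicator {0<..t} (snd p)) (\<lambda>\<omega>. X t \<omega> - c)"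
proof (rule has_ito_integral_ito)
  show "has_ito_integral M \<F> (\<lambda>t \<omega>. \<omega> t $ i) (\<lambda>s \<omega>. X s \<omega> * (1 - X s \<omega>)) t (\<lambda>\<omega>. X t \<omega> - c)"
    using sol assms by (simp add: logistic_solution_def solves_ito_sde_def)
qed measurable

text \<open>The cases of interest are \<open>\<zeta> = 0\<close>, for the increments of the solution, and \<open>\<zeta> = Y (1 - Y)\<close>, for the
  error of an Euler step that starts in \<open>Y\<close>.\<close>

lemma solution_increment_ito:
  assumes st: "0 \<le> s" "s \<le> t" and \<zeta>: "bounded_past s \<zeta>"
  shows "ito i (\<lambda>p. (X (snd p) (fst p) * (1 - X (snd p) (fst p)) - \<zeta> (fst p)) * indicator {s<..t} (snd p))
    (\<lambda>\<omega>. X t \<omega> - X s \<omega> - \<zeta> \<omega> * increment i s t \<omega>)"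
proof -
  define H where "H p = X (snd p) (fst p) * (1 - X (snd p) (fst p))" for p
  have "ito i (\<lambda>p. H p * indicator {0<..t} (snd p) - H p * indicator {0<..s} (snd p) - \<zeta> (fst p) * indicator {s<..t} (snd p))
    (\<lambda>\<omega>. (X t \<omega> - c) - (X s \<omega> - c) - \<zeta> \<omega> * increment i s t \<omega>)"
    unfolding H_def using st \<zeta> by (intro ito_diff solution_ito ito_step) auto
  moreover have "(\<lambda>p. H p * indicator {0<..t} (snd p) - H p * indicator {0<..s} (snd p) - \<zeta> (fst p) * indicator {s<..t} (snd p))
     = (\<lambda>p. (H p - \<zeta> (fst p)) * indicator {s<..t} (snd p))"
    using st by (auto simp: fun_eq_iff indicator_def)
  ultimately show ?thesis by (simp add: H_def)
qed

lemma bounded_past_0: "bounded_past s (\<lambda>_. 0)"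
  by (auto simp: bounded_past_def)

lemma solution_increment_orthogonal:
  assumes st: "0 \<le> s" "s \<le> t" and \<zeta>: "bounded_past s \<zeta>" and Z: "bounded_past s Z"
  shows "expectation (\<lambda>\<omega>. Z \<omega> * (X t \<omega> - X s \<omega> - \<zeta> \<omega> * increment i s t \<omega>)) = 0"
proof (rule ito_orthogonal_past[OF solution_increment_ito[OF st \<zeta>] _ st(1) _ Z])
  show "integrable M (\<lambda>\<omega>. X t \<omega> - X s \<omega> - \<zeta> \<omega> * increment i s t \<omega>)"
    using integrable_bounded_past_mult[OF \<zeta> increment_integrable] solution_integrable by auto
qed auto

lemma solution_martingale:
  assumes "0 \<le> s" "s \<le> t" "bounded_past s Z"
  shows "expectation (\<lambda>\<omega>. Z \<omega> * (X t \<omega> - X s \<omega>)) = 0"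
  using solution_increment_orthogonal[OF assms(1,2) bounded_past_0 assms(3)] by simp

lemma solution_isometry:
  assumes st: "0 \<le> s" "s \<le> t" and \<zeta>: "bounded_past s \<zeta>"
  shows "sqn M (\<lambda>\<omega>. X t \<omega> - X s \<omega> - \<zeta> \<omega> * increment i s t \<omega>) =
    (\<integral>\<^sup>+u. sqn M (\<lambda>\<omega>. X u \<omega> * (1 - X u \<omega>) - \<zeta> \<omega>) * indicator {s<..t} u \<partial>lborel)"
proof -
  interpret P: pair_sigma_finite M lborel ..
  have [measurable]: "\<zeta> \<in> borel_measurable M" by (rule bounded_past_measurable[OF \<zeta>])
  let ?H = "\<lambda>p. (X (snd p) (fst p) * (1 - X (snd p) (fst p)) - \<zeta> (fst p)) * indicator {s<..t} (snd p)"
  have "sqn M (\<lambda>\<omega>. X t \<omega> - X s \<omega> - \<zeta> \<omega> * increment i s t \<omega>) = sqn (M \<Otimes>\<^sub>M lborel) ?H"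
    by (rule ito_isometry[OF solution_increment_ito[OF st \<zeta>]])
  also have "\<dots> = (\<integral>\<^sup>+u. (\<integral>\<^sup>+\<omega>. ennreal ((?H (\<omega>, u))\<^sup>2) \<partial>M) \<partial>lborel)"
    unfolding sqn_def by (subst P.nn_integral_snd) auto
  also have "\<dots> = (\<integral>\<^sup>+u. sqn M (\<lambda>\<omega>. X u \<omega> * (1 - X u \<omega>) - \<zeta> \<omega>) * indicator {s<..t} u \<partial>lborel)"
    unfolding sqn_def by (intro nn_integral_cong) (auto simp: indicator_def)
  finally show ?thesis .
qed

lemma solution_increment_square_le:
  assumes st: "0 \<le> s" "s \<le> t" and \<zeta>: "bounded_past s \<zeta>" and B: "0 \<le> B"
    and le: "\<And>u. s < u \<Longrightarrow> u \<le> t \<Longrightarrow> expectation (\<lambda>\<omega>. (X u \<omega> * (1 - X u \<omega>) - \<zeta> \<omega>)\<^sup>2) \<le> B"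
  shows "integrable M (\<lambda>\<omega>. (X t \<omega> - X s \<omega> - \<zeta> \<omega> * increment i s t \<omega>)\<^sup>2)"
    "expectation (\<lambda>\<omega>. (X t \<omega> - X s \<omega> - \<zeta> \<omega> * increment i s t \<omega>)\<^sup>2) \<le> (t - s) * B"
proof -
  have [measurable]: "\<zeta> \<in> borel_measurable M" by (rule bounded_past_measurable[OF \<zeta>])
  obtain K where K: "\<And>\<omega>. \<omega> \<in> space M \<Longrightarrow> \<bar>\<zeta> \<omega>\<bar> \<le> K" using \<zeta> by (auto simp: bounded_past_def)
  have "sqn M (\<lambda>\<omega>. X u \<omega> * (1 - X u \<omega>) - \<zeta> \<omega>) \<le> ennreal B" if "s < u" "u \<le> t" for u
  proof -
    have "integrable M (\<lambda>\<omega>. (X u \<omega> * (1 - X u \<omega>) - \<zeta> \<omega>)\<^sup>2)"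
    proof (rule integrable_bounded)
      fix \<omega> assume w: "\<omega> \<in> space M"
      have "\<bar>X u \<omega> * (1 - X u \<omega>) - \<zeta> \<omega>\<bar> \<le> \<bar>1 + K\<bar>"
        using logistic_bounds[OF solution_range[OF w, of u]] K[OF w] by auto
      then show "\<bar>(X u \<omega> * (1 - X u \<omega>) - \<zeta> \<omega>)\<^sup>2\<bar> \<le> (1 + K)\<^sup>2"
        by (simp add: abs_le_square_iff)
    qed measurable
    then show ?thesis
      using le[OF that] unfolding sqn_def by (subst nn_integral_eq_integral) (auto intro: ennreal_leI)
  qed
  then have "sqn M (\<lambda>\<omega>. X t \<omega> - X s \<omega> - \<zeta> \<omega> * increment i s t \<omega>) \<le> (\<integral>\<^sup>+u. ennreal B * indicator {s<..t} u \<partial>lborel)"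
    unfolding solution_isometry[OF st \<zeta>] by (intro nn_integral_mono) (auto simp: indicator_def)
  also have "\<dots> = ennreal ((t - s) * B)"
    using st B by (simp add: nn_integral_cmult_indicator ennreal_mult[symmetric] mult.commute)
  finally have "sqn M (\<lambda>\<omega>. X t \<omega> - X s \<omega> - \<zeta> \<omega> * increment i s t \<omega>) \<le> ennreal ((t - s) * B)" .
  from sqn_le_imp_integral_le[OF _ this] st B
  show "integrable M (\<lambda>\<omega>. (X t \<omega> - X s \<omega> - \<zeta> \<omega> * increment i s t \<omega>)\<^sup>2)"
    "expectation (\<lambda>\<omega>. (X t \<omega> - X s \<omega> - \<zeta> \<omega> * increment i s t \<omega>)\<^sup>2) \<le> (t - s) * B" by auto
qed

lemma solution_modulus:
  assumes st: "0 \<le> s" "s \<le> t"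
  shows "expectation (\<lambda>\<omega>. (X t \<omega> - X s \<omega>)\<^sup>2) \<le> t - s"
proof -
  have "expectation (\<lambda>\<omega>. (X u \<omega> * (1 - X u \<omega>) - 0)\<^sup>2) \<le> 1" for u
  proof -
    have "(X u \<omega> * (1 - X u \<omega>))\<^sup>2 \<le> 1" if "\<omega> \<in> space M" for \<omega>
      using logistic_bounds[OF solution_range[OF that, of u]] by (intro power_le_one) auto
    then have "expectation (\<lambda>\<omega>. (X u \<omega> * (1 - X u \<omega>) - 0)\<^sup>2) \<le> expectation (\<lambda>\<omega>. 1)"
      by (intro integral_mono integrable_bounded[where K=1]) auto
    then show ?thesis by (simp add: prob_space)
  qed
  from solution_increment_square_le(2)[OF st bounded_past_0, of 1] this show ?thesis by simp
qed

text \<open>One step of the Euler scheme from an approximation \<open>Y\<close> of \<open>X s\<close>. The new error consists of the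
  old one, of an Ito integral that is orthogonal to it, and of the effect of truncating a Gaussian
  increment, whose moments are of the order \<open>(t - s)\<^sup>2\<close>.\<close>

lemma euler_step_error:
  assumes st: "0 \<le> s" "s \<le> t" and Y: "Y \<in> borel_measurable (\<F> s)"
    and Yr: "\<And>\<omega>. \<omega> \<in> space M \<Longrightarrow> 0 \<le> Y \<omega> \<and> Y \<omega> \<le> 1"
  shows "expectation (\<lambda>\<omega>. (X t \<omega> - euler_step (Y \<omega>) (increment i s t \<omega>))\<^sup>2) \<le>
    (1 + 4 * (t - s)) * expectation (\<lambda>\<omega>. (X s \<omega> - Y \<omega>)\<^sup>2) + 76 * (t - s)\<^sup>2"
proof -
  define h where "h = t - s"
  have h: "0 \<le> h" using st by (simp add: h_def)
  define cl :: "real \<Rightarrow> real" where "cl w = max (-1/2) (min (1/2) w)" for w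
  define \<zeta> where "\<zeta> \<omega> = Y \<omega> * (1 - Y \<omega>)" for \<omega>
  \<comment> \<open>The new error is \<open>D + A + B\<close>: the old error, the Ito integral and the truncation error.\<close>
  define D where "D \<omega> = X s \<omega> - Y \<omega>" for \<omega>
  define A where "A \<omega> = X t \<omega> - X s \<omega> - \<zeta> \<omega> * increment i s t \<omega>" for \<omega>
  define w where "w \<omega> = increment i s t \<omega>" for \<omega>
  define B where "B \<omega> = \<zeta> \<omega> * (w \<omega> - cl (w \<omega>))" for \<omega>
  have [measurable]: "Y \<in> borel_measurable M" using Y by (rule filtration_measurable)
  have wm [measurable]: "w \<in> borel_measurable M" unfolding w_def by measurable
  have [measurable]: "cl \<in> borel_measurable borel" unfolding cl_def by measurable
  have [measurable]: "A \<in> borel_measurable M" "B \<in> borel_measurable M" "D \<in> borel_measurable M"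
    unfolding A_def B_def D_def \<zeta>_def by measurable
  have \<zeta>r: "0 \<le> \<zeta> \<omega>" "\<zeta> \<omega> \<le> 1" if "\<omega> \<in> space M" for \<omega>
    using logistic_bounds[of "Y \<omega>"] Yr[OF that] by (auto simp: \<zeta>_def)
  have Dr: "\<bar>D \<omega>\<bar> \<le> 1" if "\<omega> \<in> space M" for \<omega>
    using solution_range[OF that, of s] Yr[OF that] by (auto simp: D_def)
  have b\<zeta>: "bounded_past s \<zeta>"
    unfolding bounded_past_def using \<zeta>r Y by (auto simp: \<zeta>_def[abs_def] intro!: exI[of _ 1])
  have bD: "bounded_past s D"
    unfolding bounded_past_def using Dr Y solution_adapted[OF st(1)] by (auto simp: D_def[abs_def] intro!: exI[of _ 1])
  have D1: "(D \<omega>)\<^sup>2 \<le> 1" if "\<omega> \<in> space M" for \<omega>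
    using Dr[OF that] abs_le_square_iff[of "D \<omega>" 1] by simp
  have iD2: "integrable M (\<lambda>\<omega>. (D \<omega>)\<^sup>2)"
    using D1 by (intro integrable_bounded[where K=1]) auto
  define \<delta> where "\<delta> = expectation (\<lambda>\<omega>. (D \<omega>)\<^sup>2)"
  have \<delta>: "0 \<le> \<delta>" unfolding \<delta>_def by simp
  have inner: "expectation (\<lambda>\<omega>. (X u \<omega> * (1 - X u \<omega>) - \<zeta> \<omega>)\<^sup>2) \<le> 2 * h + 2 * \<delta>" if u: "s < u" "u \<le> t" for u
  proof -
    have iu: "integrable M (\<lambda>\<omega>. (X u \<omega> - X s \<omega>)\<^sup>2)"
      using solution_range by (intro integrable_unit_interval_diff_square) auto
    have pw: "(X u \<omega> * (1 - X u \<omega>) - \<zeta> \<omega>)\<^sup>2 \<le> 2 * (X u \<omega> - X s \<omega>)\<^sup>2 + 2 * (D \<omega>)\<^sup>2" if "\<omega> \<in> space M" for \<omega>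
      using logistic_lipschitz[of "X u \<omega>" "Y \<omega>"] square_le_of_split[of "X u \<omega>" "Y \<omega>" "X s \<omega>"]
        solution_range[OF that, of u] Yr[OF that] unfolding \<zeta>_def D_def by linarith
    have "expectation (\<lambda>\<omega>. (X u \<omega> * (1 - X u \<omega>) - \<zeta> \<omega>)\<^sup>2) \<le> expectation (\<lambda>\<omega>. 2 * (X u \<omega> - X s \<omega>)\<^sup>2 + 2 * (D \<omega>)\<^sup>2)"
    proof (rule integral_mono)
      show "integrable M (\<lambda>\<omega>. (X u \<omega> * (1 - X u \<omega>) - \<zeta> \<omega>)\<^sup>2)"
        by (rule Bochner_Integration.integrable_bound[of M "\<lambda>\<omega>. 2 * (X u \<omega> - X s \<omega>)\<^sup>2 + 2 * (D \<omega>)\<^sup>2"])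
          (use iu iD2 pw in \<open>auto simp: \<zeta>_def intro!: AE_I2\<close>)
      show "integrable M (\<lambda>\<omega>. 2 * (X u \<omega> - X s \<omega>)\<^sup>2 + 2 * (D \<omega>)\<^sup>2)" using iu iD2 by auto
    qed (rule pw)
    also have "\<dots> = 2 * expectation (\<lambda>\<omega>. (X u \<omega> - X s \<omega>)\<^sup>2) + 2 * \<delta>"
      using iu iD2 by (simp add: \<delta>_def)
    also have "\<dots> \<le> 2 * h + 2 * \<delta>"
      using solution_modulus[OF st(1), of u] u by (simp add: h_def)
    finally show ?thesis .
  qed
  have iA2: "integrable M (\<lambda>\<omega>. (A \<omega>)\<^sup>2)" and EA2: "expectation (\<lambda>\<omega>. (A \<omega>)\<^sup>2) \<le> h * (2 * h + 2 * \<delta>)"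
    using solution_increment_square_le[OF st b\<zeta> _ inner] h \<delta> unfolding A_def h_def by auto
  have iw: "integrable M (\<lambda>\<omega>. w \<omega> ^ k)" for k
    unfolding w_def by (rule increment_power_integrable)
  have Ew4: "expectation (\<lambda>\<omega>. w \<omega> ^ 4) = 3 * h\<^sup>2"
    unfolding w_def h_def by (rule expectation_increment_4[OF st(2)])
  have Bb: "\<bar>B \<omega>\<bar> \<le> 8 * w \<omega> ^ 4" "(B \<omega>)\<^sup>2 \<le> 4 * w \<omega> ^ 4" if "\<omega> \<in> space M" for \<omega>
  proof -
    have "\<bar>B \<omega>\<bar> \<le> 1 * \<bar>w \<omega> - cl (w \<omega>)\<bar>"
      unfolding B_def abs_mult using \<zeta>r[OF that] by (intro mult_right_mono) auto
    then have *: "\<bar>B \<omega>\<bar> \<le> \<bar>w \<omega> - cl (w \<omega>)\<bar>" by simp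
    then show "\<bar>B \<omega>\<bar> \<le> 8 * w \<omega> ^ 4" using clamp_error(1)[of "w \<omega>"] unfolding cl_def by linarith
    have "(B \<omega>)\<^sup>2 \<le> (w \<omega> - cl (w \<omega>))\<^sup>2" using * by (simp add: abs_le_square_iff)
    then show "(B \<omega>)\<^sup>2 \<le> 4 * w \<omega> ^ 4" using clamp_error(2)[of "w \<omega>"] unfolding cl_def by linarith
  qed
  have iB2: "integrable M (\<lambda>\<omega>. (B \<omega>)\<^sup>2)"
    by (rule Bochner_Integration.integrable_bound[of M "\<lambda>\<omega>. 4 * w \<omega> ^ 4"])
      (use iw[of 4] Bb in \<open>auto intro!: AE_I2\<close>)
  have EB2: "expectation (\<lambda>\<omega>. (B \<omega>)\<^sup>2) \<le> 12 * h\<^sup>2"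
  proof -
    have "expectation (\<lambda>\<omega>. (B \<omega>)\<^sup>2) \<le> expectation (\<lambda>\<omega>. 4 * w \<omega> ^ 4)"
      using iB2 iw[of 4] Bb by (intro integral_mono) auto
    then show ?thesis using Ew4 by simp
  qed
  have DBb: "\<bar>D \<omega> * B \<omega>\<bar> \<le> 8 * w \<omega> ^ 4" if "\<omega> \<in> space M" for \<omega>
    using mult_mono[OF Dr[OF that] Bb(1)[OF that]] unfolding abs_mult by simp
  have iDB: "integrable M (\<lambda>\<omega>. D \<omega> * B \<omega>)"
    by (rule Bochner_Integration.integrable_bound[of M "\<lambda>\<omega>. 8 * w \<omega> ^ 4"])
      (use iw[of 4] DBb in \<open>auto intro!: AE_I2\<close>)
  have EDB: "expectation (\<lambda>\<omega>. D \<omega> * B \<omega>) \<le> 24 * h\<^sup>2"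
  proof -
    have "expectation (\<lambda>\<omega>. D \<omega> * B \<omega>) \<le> expectation (\<lambda>\<omega>. 8 * w \<omega> ^ 4)"
      using iDB iw[of 4] DBb by (intro integral_mono) (auto intro: order.trans[OF abs_ge_self])
    then show ?thesis using Ew4 by simp
  qed
  have iA: "integrable M A"
    unfolding A_def using integrable_bounded_past_mult[OF b\<zeta> increment_integrable] solution_integrable by auto
  have iDA: "integrable M (\<lambda>\<omega>. D \<omega> * A \<omega>)" by (rule integrable_bounded_past_mult[OF bD iA])
  have EDA: "expectation (\<lambda>\<omega>. D \<omega> * A \<omega>) = 0"
    unfolding A_def by (rule solution_increment_orthogonal[OF st b\<zeta> bD])
  have split: "X t \<omega> - euler_step (Y \<omega>) (increment i s t \<omega>) = D \<omega> + A \<omega> + B \<omega>" for \<omega>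
    unfolding D_def A_def B_def w_def \<zeta>_def euler_step_def cl_def by (simp add: algebra_simps)
  have "expectation (\<lambda>\<omega>. (X t \<omega> - euler_step (Y \<omega>) (increment i s t \<omega>))\<^sup>2) \<le>
     expectation (\<lambda>\<omega>. (D \<omega>)\<^sup>2 + 2 * (D \<omega> * A \<omega>) + 2 * (D \<omega> * B \<omega>) + 2 * (A \<omega>)\<^sup>2 + 2 * (B \<omega>)\<^sup>2)"
    unfolding split
  proof (rule integral_mono')
    show "integrable M (\<lambda>\<omega>. (D \<omega>)\<^sup>2 + 2 * (D \<omega> * A \<omega>) + 2 * (D \<omega> * B \<omega>) + 2 * (A \<omega>)\<^sup>2 + 2 * (B \<omega>)\<^sup>2)"
      using iD2 iDA iDB iA2 iB2 by auto
    fix \<omega>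
    have "0 \<le> (A \<omega> - B \<omega>)\<^sup>2" by simp
    then show "(D \<omega> + A \<omega> + B \<omega>)\<^sup>2 \<le> (D \<omega>)\<^sup>2 + 2 * (D \<omega> * A \<omega>) + 2 * (D \<omega> * B \<omega>) + 2 * (A \<omega>)\<^sup>2 + 2 * (B \<omega>)\<^sup>2"
      by (simp add: power2_eq_square algebra_simps)
    then show "0 \<le> (D \<omega>)\<^sup>2 + 2 * (D \<omega> * A \<omega>) + 2 * (D \<omega> * B \<omega>) + 2 * (A \<omega>)\<^sup>2 + 2 * (B \<omega>)\<^sup>2"
      using zero_le_power2 order.trans by blast
  qed
  also have "\<dots> = \<delta> + 2 * expectation (\<lambda>\<omega>. D \<omega> * A \<omega>) + 2 * expectation (\<lambda>\<omega>. D \<omega> * B \<omega>)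
      + 2 * expectation (\<lambda>\<omega>. (A \<omega>)\<^sup>2) + 2 * expectation (\<lambda>\<omega>. (B \<omega>)\<^sup>2)"
    using iD2 iDA iDB iA2 iB2 by (simp add: \<delta>_def)
  \<comment> \<open>The multiples of \<open>h\<^sup>2\<close> are \<open>2 * 24\<close> from \<open>D B\<close>, \<open>2 * 2\<close> from \<open>A\<^sup>2\<close> and \<open>2 * 12\<close> from \<open>B\<^sup>2\<close>.\<close>
  also have "\<dots> \<le> (1 + 4 * h) * \<delta> + 76 * h\<^sup>2"
    using EDA EDB EA2 EB2 by (simp add: algebra_simps power2_eq_square)
  finally show ?thesis unfolding \<delta>_def D_def h_def .
qed

end

primrec euler :: "'d \<Rightarrow> real \<Rightarrow> real \<Rightarrow> ((real \<Rightarrow> real ^ 'd) \<Rightarrow> real) \<Rightarrow> nat \<Rightarrow> (real \<Rightarrow> real ^ 'd) \<Rightarrow> real" where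
  "euler i s h Y 0 \<omega> = Y \<omega>"
| "euler i s h Y (Suc k) \<omega> = euler_step (euler i s h Y k \<omega>) (increment i (s + real k * h) (s + real (Suc k) * h) \<omega>)"

lemma euler_range:
  assumes "0 \<le> Y \<omega>" "Y \<omega> \<le> 1"
  shows "0 \<le> euler i s h Y k \<omega> \<and> euler i s h Y k \<omega> \<le> 1"
  by (induction k) (use assms euler_step_bounds in auto)

lemma euler_range_open:
  assumes "0 < Y \<omega>" "Y \<omega> < 1"
  shows "0 < euler i s h Y k \<omega> \<and> euler i s h Y k \<omega> < 1"
  by (induction k) (use assms euler_step_bounds in \<open>auto simp: less_imp_le\<close>)

lemma separation_euler:
  assumes "0 < Y \<omega>" "Y \<omega> < 1" "0 < Z \<omega>" "Z \<omega> < 1"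
  shows "separation (Y \<omega>) (Z \<omega>) \<le> separation (euler i s h Y k \<omega>) (euler i s h Z k \<omega>)"
proof (induction k)
  case (Suc k)
  have r: "0 < euler i s h Y k \<omega>" "euler i s h Y k \<omega> < 1" "0 < euler i s h Z k \<omega>" "euler i s h Z k \<omega> < 1"
    using euler_range_open[of Y \<omega>, OF assms(1,2)] euler_range_open[of Z \<omega>, OF assms(3,4)] by auto
  show ?case
    unfolding euler.simps(2) by (rule order.trans[OF Suc separation_euler_step[OF r]])
qed simp

lemma euler_adapted:
  assumes "0 \<le> s" "0 \<le> h" "Y \<in> borel_measurable (\<F> s)"
  shows "euler i s h Y k \<in> borel_measurable (\<F> (s + real k * h))"
proof (induction k)
  case 0
  then show ?case using assms by (simp add: euler.simps(1)[abs_def])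
next
  case (Suc k)
  have le: "s + real k * h \<le> s + real (Suc k) * h" using assms by (simp add: algebra_simps)
  have "0 \<le> s + real k * h" using assms by simp
  then have "increment i (s + real k * h) (s + real (Suc k) * h) \<in> borel_measurable (\<F> (s + real (Suc k) * h))"
    using le by (intro increment_adapted) auto
  from euler_step_measurable[OF filtration_measurable_mono[OF Suc le] this]
  show ?case by (simp add: euler.simps(2)[abs_def])
qed

text \<open>A discrete Gronwall estimate: every step multiplies the error by \<open>1 + 4 h\<close> and adds \<open>76 h\<^sup>2\<close>.\<close>

lemma euler_error:
  assumes sol: "logistic_solution i c X" and s: "0 \<le> s" "0 \<le> h" and Y: "Y \<in> borel_measurable (\<F> s)"
    and Yr: "\<And>\<omega>. \<omega> \<in> space M \<Longrightarrow> 0 \<le> Y \<omega> \<and> Y \<omega> \<le> 1" and eq: "AE \<omega> in M. X s \<omega> = Y \<omega>"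
  shows "expectation (\<lambda>\<omega>. (X (s + real k * h) \<omega> - euler i s h Y k \<omega>)\<^sup>2) \<le> 76 * h\<^sup>2 * real k * (1 + 4 * h) ^ k"
proof (induction k)
  case 0
  have "expectation (\<lambda>\<omega>. (X s \<omega> - Y \<omega>)\<^sup>2) = expectation (\<lambda>\<omega>. 0)"
    by (rule Bochner_Integration.integral_cong_AE)
      (use eq solution_measurable[OF sol] filtration_measurable[OF Y] in auto)
  then show ?case by simp
next
  case (Suc k)
  let ?D = "\<lambda>k. expectation (\<lambda>\<omega>. (X (s + real k * h) \<omega> - euler i s h Y k \<omega>)\<^sup>2)"
  have d: "s + real (Suc k) * h - (s + real k * h) = h" by (simp add: algebra_simps)
  have "?D (Suc k) \<le> (1 + 4 * h) * ?D k + 76 * h\<^sup>2"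
    using euler_step_error[OF sol, of "s + real k * h" "s + real (Suc k) * h" "euler i s h Y k",
        unfolded d, OF _ _ euler_adapted[OF s Y] euler_range] Yr s
    by (simp add: algebra_simps)
  also have "\<dots> \<le> (1 + 4 * h) * (76 * h\<^sup>2 * real k * (1 + 4 * h) ^ k) + 76 * h\<^sup>2 * (1 + 4 * h) ^ Suc k"
  proof (rule add_mono)
    show "(1 + 4 * h) * ?D k \<le> (1 + 4 * h) * (76 * h\<^sup>2 * real k * (1 + 4 * h) ^ k)"
      using Suc s by (intro mult_left_mono) auto
    show "76 * h\<^sup>2 \<le> 76 * h\<^sup>2 * (1 + 4 * h) ^ Suc k"
      using s one_le_power[of "1 + 4 * h" "Suc k"] mult_left_mono[of 1 "(1 + 4 * h) ^ Suc k" "76 * h\<^sup>2"] by simp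
  qed
  also have "\<dots> = 76 * h\<^sup>2 * real (Suc k) * (1 + 4 * h) ^ Suc k"
    by (simp add: algebra_simps)
  finally show ?case .
qed

text \<open>With \<open>n\<close> steps up to time \<open>t\<close> the mean square error is of the order \<open>1 / n\<close>.\<close>

lemma euler_converges:
  assumes sol: "logistic_solution i c X" and s: "0 \<le> s" "s \<le> t" and Y: "Y \<in> borel_measurable (\<F> s)"
    and Yr: "\<And>\<omega>. \<omega> \<in> space M \<Longrightarrow> 0 \<le> Y \<omega> \<and> Y \<omega> \<le> 1" and eq: "AE \<omega> in M. X s \<omega> = Y \<omega>"
  shows "(\<lambda>n. expectation (\<lambda>\<omega>. (X t \<omega> - euler i s ((t - s) / real (Suc n)) Y (Suc n) \<omega>)\<^sup>2)) \<longlonglongrightarrow> 0"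
proof (rule tendsto_sandwich[OF _ _ tendsto_const])
  define T where "T = t - s"
  have T: "0 \<le> T" using s by (simp add: T_def)
  show "\<forall>\<^sub>F n in sequentially. expectation (\<lambda>\<omega>. (X t \<omega> - euler i s ((t - s) / real (Suc n)) Y (Suc n) \<omega>)\<^sup>2) \<le>
     76 * T\<^sup>2 * exp (4 * T) * inverse (real (Suc n))"
  proof (intro always_eventually allI)
    fix n
    define h where "h = T / real (Suc n)"
    have h: "0 \<le> h" using T by (simp add: h_def)
    have st: "s + real (Suc n) * h = t" by (simp add: h_def T_def)
    have "expectation (\<lambda>\<omega>. (X t \<omega> - euler i s h Y (Suc n) \<omega>)\<^sup>2) \<le> 76 * h\<^sup>2 * real (Suc n) * (1 + 4 * h) ^ Suc n"
      using euler_error[OF sol s(1) h Y Yr eq, of "Suc n"] unfolding st .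
    also have "\<dots> \<le> 76 * h\<^sup>2 * real (Suc n) * exp (4 * T)"
    proof (intro mult_left_mono)
      have "(1 + 4 * h) ^ Suc n \<le> exp (4 * h) ^ Suc n" using h by (intro power_mono) auto
      also have "\<dots> = exp (4 * T)"
        unfolding exp_of_nat_mult[symmetric] by (simp add: h_def field_simps)
      finally show "(1 + 4 * h) ^ Suc n \<le> exp (4 * T)" .
    qed auto
    also have "76 * h\<^sup>2 * real (Suc n) * exp (4 * T) = 76 * T\<^sup>2 * exp (4 * T) * inverse (real (Suc n))"
    proof -
      have "76 * (T / N)\<^sup>2 * N * exp (4 * T) = 76 * T\<^sup>2 * exp (4 * T) * inverse N" if "0 < N" for N :: real
        using that by (simp add: power2_eq_square field_simps)
      from this[of "real (Suc n)"] show ?thesis by (simp only: h_def of_nat_0_less_iff zero_less_Suc)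
    qed
    finally show "expectation (\<lambda>\<omega>. (X t \<omega> - euler i s ((t - s) / real (Suc n)) Y (Suc n) \<omega>)\<^sup>2) \<le>
       76 * T\<^sup>2 * exp (4 * T) * inverse (real (Suc n))" by (simp add: h_def T_def)
  qed
  show "(\<lambda>n. 76 * T\<^sup>2 * exp (4 * T) * inverse (real (Suc n))) \<longlonglongrightarrow> 0"
    using tendsto_mult[OF tendsto_const LIMSEQ_inverse_real_of_nat, of "76 * T\<^sup>2 * exp (4 * T)"] by simp
qed (auto intro!: always_eventually)

end

context wiener
begin

section \<open>Consequences of the Euler approximation\<close>

(* The number of steps is a successor below; the scheme must not be unfolded there. *)
declare euler.simps(2) [simp del]

lemma integrable_euler_error:
  assumes sol: "logistic_solution i c X" and s: "0 \<le> s" "0 \<le> h" and Y: "Y \<in> borel_measurable (\<F> s)"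
    and Yr: "\<And>\<omega>. \<omega> \<in> space M \<Longrightarrow> 0 \<le> Y \<omega> \<and> Y \<omega> \<le> 1"
  shows "integrable M (\<lambda>\<omega>. (X t \<omega> - euler i s h Y k \<omega>)\<^sup>2)"
  using solution_range[OF sol] euler_range Yr solution_measurable[OF sol]
  by (intro integrable_unit_interval_diff_square filtration_measurable[OF euler_adapted[OF s Y]]) auto

lemma tendsto_if_square_error:
  fixes a :: "nat \<Rightarrow> real"
  assumes "(\<lambda>n. (x - a n)\<^sup>2) \<longlonglongrightarrow> 0"
  shows "a \<longlonglongrightarrow> x"
proof -
  have "(\<lambda>n. sqrt ((x - a n)\<^sup>2)) \<longlonglongrightarrow> sqrt 0" by (intro tendsto_intros assms)
  then have "(\<lambda>n. \<bar>x - a n\<bar>) \<longlonglongrightarrow> 0" by simp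
  then have "(\<lambda>n. x - a n) \<longlonglongrightarrow> 0" by (rule tendsto_rabs_zero_cancel)
  then have "(\<lambda>n. x - (x - a n)) \<longlonglongrightarrow> x - 0" by (intro tendsto_intros)
  then show ?thesis by simp
qed

text \<open>No Euler step decreases the separation of two approximate solutions that are driven by the
  same increments; the inequality passes to an almost surely convergent subsequence.\<close>

theorem separation_solutions_mono:
  assumes X: "logistic_solution i c X" and Y: "logistic_solution i c' Y" and st: "0 \<le> s" "s \<le> t"
    and Xr: "\<And>r \<omega>. \<omega> \<in> space M \<Longrightarrow> 0 < X r \<omega> \<and> X r \<omega> < 1"
    and Yr: "\<And>r \<omega>. \<omega> \<in> space M \<Longrightarrow> 0 < Y r \<omega> \<and> Y r \<omega> < 1"
  shows "AE \<omega> in M. separation (X s \<omega>) (Y s \<omega>) \<le> separation (X t \<omega>) (Y t \<omega>)"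
proof -
  define x where "x n = euler i s ((t - s) / real (Suc n)) (X s) (Suc n)" for n
  define y where "y n = euler i s ((t - s) / real (Suc n)) (Y s) (Suc n)" for n
  define u where "u n \<omega> = (X t \<omega> - x n \<omega>)\<^sup>2 + (Y t \<omega> - y n \<omega>)\<^sup>2" for n \<omega>
  have h: "0 \<le> (t - s) / real (Suc n)" for n using st by simp
  have Xr': "\<And>\<omega>. \<omega> \<in> space M \<Longrightarrow> 0 \<le> X s \<omega> \<and> X s \<omega> \<le> 1" and Yr': "\<And>\<omega>. \<omega> \<in> space M \<Longrightarrow> 0 \<le> Y s \<omega> \<and> Y s \<omega> \<le> 1"
    using solution_range[OF X] solution_range[OF Y] by auto
  have ix: "integrable M (\<lambda>\<omega>. (X t \<omega> - x n \<omega>)\<^sup>2)" for n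
    unfolding x_def by (rule integrable_euler_error[OF X st(1) h solution_adapted[OF X st(1)] Xr'])
  have iy: "integrable M (\<lambda>\<omega>. (Y t \<omega> - y n \<omega>)\<^sup>2)" for n
    unfolding y_def by (rule integrable_euler_error[OF Y st(1) h solution_adapted[OF Y st(1)] Yr'])
  have iu: "integrable M (u n)" for n unfolding u_def using ix iy by auto
  have "(\<lambda>n. expectation (\<lambda>\<omega>. (X t \<omega> - x n \<omega>)\<^sup>2) + expectation (\<lambda>\<omega>. (Y t \<omega> - y n \<omega>)\<^sup>2)) \<longlonglongrightarrow> 0 + 0"
    unfolding x_def y_def
    by (intro tendsto_add euler_converges[OF X st solution_adapted[OF X st(1)] Xr']
        euler_converges[OF Y st solution_adapted[OF Y st(1)] Yr']) auto
  moreover have "expectation (\<lambda>\<omega>. norm (u n \<omega>)) = expectation (\<lambda>\<omega>. (X t \<omega> - x n \<omega>)\<^sup>2) + expectation (\<lambda>\<omega>. (Y t \<omega> - y n \<omega>)\<^sup>2)" for n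
    unfolding u_def using ix iy by simp
  ultimately have "(\<lambda>n. expectation (\<lambda>\<omega>. norm (u n \<omega>))) \<longlonglongrightarrow> 0" by simp
  from tendsto_L1_AE_subseq[OF iu this] obtain r :: "nat \<Rightarrow> nat" where
    r: "AE \<omega> in M. (\<lambda>n. u (r n) \<omega>) \<longlonglongrightarrow> 0" by auto
  from r AE_space show ?thesis
  proof eventually_elim
    case (elim \<omega>)
    have "(\<lambda>n. (X t \<omega> - x (r n) \<omega>)\<^sup>2) \<longlonglongrightarrow> 0"
      by (rule tendsto_sandwich[OF _ _ tendsto_const elim(1)]) (auto simp: u_def)
    then have x: "(\<lambda>n. x (r n) \<omega>) \<longlonglongrightarrow> X t \<omega>" by (rule tendsto_if_square_error)
    have "(\<lambda>n. (Y t \<omega> - y (r n) \<omega>)\<^sup>2) \<longlonglongrightarrow> 0"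
      by (rule tendsto_sandwich[OF _ _ tendsto_const elim(1)]) (auto simp: u_def)
    then have y: "(\<lambda>n. y (r n) \<omega>) \<longlonglongrightarrow> Y t \<omega>" by (rule tendsto_if_square_error)
    have "X t \<omega> * (1 - X t \<omega>) * (Y t \<omega> * (1 - Y t \<omega>)) \<noteq> 0"
      using Xr[OF elim(2), of t] Yr[OF elim(2), of t] by simp
    then have "(\<lambda>n. separation (x (r n) \<omega>) (y (r n) \<omega>)) \<longlonglongrightarrow> separation (X t \<omega>) (Y t \<omega>)"
      unfolding separation_def by (intro tendsto_intros x y)
    moreover have "separation (X s \<omega>) (Y s \<omega>) \<le> separation (x (r n) \<omega>) (y (r n) \<omega>)" for n
      unfolding x_def y_def using Xr[OF elim(2), of s] Yr[OF elim(2), of s] by (intro separation_euler) auto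
    ultimately show ?case by (intro LIMSEQ_le_const) auto
  qed
qed

lemma solution_start:
  assumes sol: "logistic_solution i c X"
  shows "AE \<omega> in M. X 0 \<omega> = c"
proof -
  note [measurable] = solution_measurable[OF sol]
  from ito_isometry[OF solution_ito[OF sol order_refl]] have "(\<integral>\<^sup>+\<omega>. ennreal ((X 0 \<omega> - c)\<^sup>2) \<partial>M) = 0"
    by (simp add: sqn_def)
  then have "AE \<omega> in M. ennreal ((X 0 \<omega> - c)\<^sup>2) = 0"
    by (subst (asm) nn_integral_0_iff_AE) auto
  then show ?thesis by eventually_elim (simp add: ennreal_eq_0_iff)
qed

lemma solution_expectation:
  assumes sol: "logistic_solution i c X" and t: "0 \<le> t"
  shows "expectation (X t) = c"
proof -
  note [measurable] = solution_measurable[OF sol]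
  have "bounded_past 0 (\<lambda>_. 1)" by (auto simp: bounded_past_def)
  from solution_martingale[OF sol order_refl t this]
  have "expectation (X t) = expectation (X 0)"
    using solution_integrable[OF sol] by simp
  also have "\<dots> = expectation (\<lambda>_. c)"
    by (rule Bochner_Integration.integral_cong_AE) (use solution_start[OF sol] in auto)
  finally show ?thesis by (simp add: prob_space)
qed

text \<open>Approximate solutions of different equations use increments of different components of the
  Wiener process.\<close>

lemma euler_independent:
  assumes "0 < h"
  shows "indep_vars (\<lambda>_. borel) (\<lambda>i. euler i 0 h (\<lambda>_. c i) k) (UNIV :: 'd set)"
proof -
  define \<tau> where "\<tau> j = real j * h" for j :: nat
  have "strict_mono \<tau>" unfolding \<tau>_def using assms by (auto intro!: strict_monoI)
  note ind = indep_increments[OF this]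
  define X where "X = (\<lambda>(j, i). increment i (\<tau> j) (\<tau> (Suc j)))"
  define K :: "'d \<Rightarrow> (nat \<times> 'd) set" where "K i = UNIV \<times> {i}" for i
  have 1: "indep_vars (\<lambda>i. PiM (K i) (\<lambda>_. borel)) (\<lambda>i \<omega>. restrict (\<lambda>p. X p \<omega>) (K i)) UNIV"
    by (rule indep_vars_restrict[of _ _ UNIV]) (use ind in \<open>auto simp: X_def K_def disjoint_family_on_def\<close>)
  \<comment> \<open>The scheme for the component \<open>i\<close> as a function of the increments of that component.\<close>
  define G :: "'d \<Rightarrow> nat \<Rightarrow> (nat \<times> 'd \<Rightarrow> real) \<Rightarrow> real" where
    "G i n f = rec_nat (c i) (\<lambda>j x. euler_step x (f (j, i))) n" for i n f
  have Gm: "G i n \<in> borel_measurable (PiM (K i) (\<lambda>_. borel))" for i n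
  proof (induction n)
    case 0
    then show ?case by (simp add: G_def[abs_def])
  next
    case (Suc n)
    have "(\<lambda>f. f (n, i)) \<in> borel_measurable (PiM (K i) (\<lambda>_. borel :: real measure))"
      by (rule measurable_component_singleton) (simp add: K_def)
    from euler_step_measurable[OF Suc this] show ?case by (simp add: G_def[abs_def])
  qed
  have G: "G i n (restrict (\<lambda>p. X p \<omega>) (K i)) = euler i 0 h (\<lambda>_. c i) n \<omega>" for i n \<omega>
  proof (induction n)
    case (Suc n)
    then show ?case by (simp add: G_def X_def K_def \<tau>_def euler.simps(2))
  qed (simp add: G_def)
  show ?thesis
    using indep_vars_compose2[OF 1, of "\<lambda>i. G i k" "\<lambda>_. borel"] Gm unfolding G by simp
qed

lemma abs_prod_diff_le:
  fixes a b :: "'i \<Rightarrow> real"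
  assumes "\<And>i. i \<in> I \<Longrightarrow> 0 \<le> a i \<and> a i \<le> 1" "\<And>i. i \<in> I \<Longrightarrow> 0 \<le> b i \<and> b i \<le> 1"
  shows "\<bar>(\<Prod>i\<in>I. a i) - (\<Prod>i\<in>I. b i)\<bar> \<le> (\<Sum>i\<in>I. \<bar>a i - b i\<bar>)"
  using norm_prod_diff[of I a b] assms by auto

lemma tendsto_expectation_of_square_error:
  fixes y :: "_ \<Rightarrow> real"
  assumes "\<And>n. x n \<in> borel_measurable M" "y \<in> borel_measurable M"
    and int: "\<And>n. integrable M (\<lambda>\<omega>. (y \<omega> - x n \<omega>)\<^sup>2)"
    and lim: "(\<lambda>n. expectation (\<lambda>\<omega>. (y \<omega> - x n \<omega>)\<^sup>2)) \<longlonglongrightarrow> 0"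
  shows "(\<lambda>n. expectation (\<lambda>\<omega>. \<bar>y \<omega> - x n \<omega>\<bar>)) \<longlonglongrightarrow> 0"
proof (rule tendsto_sandwich[OF _ _ tendsto_const])
  have [measurable]: "\<And>n. x n \<in> borel_measurable M" "y \<in> borel_measurable M" using assms by auto
  have "expectation (\<lambda>\<omega>. \<bar>y \<omega> - x n \<omega>\<bar>) \<le> sqrt (expectation (\<lambda>\<omega>. (y \<omega> - x n \<omega>)\<^sup>2))" for n
  proof (rule real_le_rsqrt)
    have "integrable M (\<lambda>\<omega>. \<bar>y \<omega> - x n \<omega>\<bar>)"
    proof (rule Bochner_Integration.integrable_bound[of M "\<lambda>\<omega>. 1 + (y \<omega> - x n \<omega>)\<^sup>2"])
      show "AE \<omega> in M. norm \<bar>y \<omega> - x n \<omega>\<bar> \<le> norm (1 + (y \<omega> - x n \<omega>)\<^sup>2)"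
      proof (rule AE_I2)
        fix \<omega>
        have half: "a \<le> b" if "2 * a \<le> b" "0 \<le> a" for a b :: real using that by linarith
        have "0 \<le> (\<bar>y \<omega> - x n \<omega>\<bar> - 1)\<^sup>2" by simp
        then have "2 * \<bar>y \<omega> - x n \<omega>\<bar> \<le> 1 + (y \<omega> - x n \<omega>)\<^sup>2" by (simp add: power2_diff)
        then have "\<bar>y \<omega> - x n \<omega>\<bar> \<le> 1 + (y \<omega> - x n \<omega>)\<^sup>2"
          using abs_ge_zero[of "y \<omega> - x n \<omega>"] half by blast
        then show "norm \<bar>y \<omega> - x n \<omega>\<bar> \<le> norm (1 + (y \<omega> - x n \<omega>)\<^sup>2)" by simp
      qed
    qed (use int in auto)
    moreover have "integrable M (\<lambda>\<omega>. \<bar>y \<omega> - x n \<omega>\<bar>\<^sup>2)" using int[of n] by simp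
    ultimately have "0 \<le> expectation (\<lambda>\<omega>. \<bar>y \<omega> - x n \<omega>\<bar>\<^sup>2) - (expectation (\<lambda>\<omega>. \<bar>y \<omega> - x n \<omega>\<bar>))\<^sup>2"
      using variance_eq[of "\<lambda>\<omega>. \<bar>y \<omega> - x n \<omega>\<bar>"] variance_positive[of "\<lambda>\<omega>. \<bar>y \<omega> - x n \<omega>\<bar>"] by linarith
    then show "(expectation (\<lambda>\<omega>. \<bar>y \<omega> - x n \<omega>\<bar>))\<^sup>2 \<le> expectation (\<lambda>\<omega>. (y \<omega> - x n \<omega>)\<^sup>2)" by simp
  qed
  then show "\<forall>\<^sub>F n in sequentially. expectation (\<lambda>\<omega>. \<bar>y \<omega> - x n \<omega>\<bar>) \<le> sqrt (expectation (\<lambda>\<omega>. (y \<omega> - x n \<omega>)\<^sup>2))"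
    by simp
  show "(\<lambda>n. sqrt (expectation (\<lambda>\<omega>. (y \<omega> - x n \<omega>)\<^sup>2))) \<longlonglongrightarrow> 0"
    using tendsto_real_sqrt[OF lim] by simp
qed auto

text \<open>The expectations of products of independent approximations factorize. In the limit the factors
  are the means of martingales that start in \<open>c i\<close>.\<close>

theorem expectation_prod_solutions:
  assumes sol: "\<And>i. logistic_solution i (c i) (X i)" and t: "0 < t" and c: "\<And>i. 0 \<le> c i \<and> c i \<le> 1"
  shows "expectation (\<lambda>\<omega>. \<Prod>i\<in>(UNIV :: 'd set). X i t \<omega>) = (\<Prod>i\<in>UNIV. c i)"
proof -
  define x where "x n i = euler i 0 ((t - 0) / real (Suc n)) (\<lambda>_. c i) (Suc n)" for n and i :: 'd
  have h: "0 \<le> (t - 0) / real (Suc n)" for n using t by simp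
  have cm: "(\<lambda>_. c i) \<in> borel_measurable (\<F> 0)" for i by simp
  have [measurable]: "x n i \<in> borel_measurable M" for n i
    unfolding x_def by (rule filtration_measurable[OF euler_adapted[OF order_refl h cm]])
  note [measurable] = solution_measurable[OF sol]
  have xr: "0 \<le> x n i \<omega> \<and> x n i \<omega> \<le> 1" for n i \<omega>
    unfolding x_def by (rule euler_range) (use c in auto)
  have Xr: "0 \<le> X i t \<omega> \<and> X i t \<omega> \<le> 1" if "\<omega> \<in> space M" for i \<omega>
    using solution_range[OF sol that] by auto
  have ix: "integrable M (x n i)" for n i
    using xr by (intro integrable_bounded[where K=1]) auto
  have iX: "integrable M (X i t)" for i by (rule solution_integrable[OF sol])
  have L1: "(\<lambda>n. expectation (\<lambda>\<omega>. \<bar>X i t \<omega> - x n i \<omega>\<bar>)) \<longlonglongrightarrow> 0" for i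
  proof (rule tendsto_expectation_of_square_error)
    show "integrable M (\<lambda>\<omega>. (X i t \<omega> - x n i \<omega>)\<^sup>2)" for n
      unfolding x_def by (rule integrable_euler_error[OF sol order_refl h cm c])
    show "(\<lambda>n. expectation (\<lambda>\<omega>. (X i t \<omega> - x n i \<omega>)\<^sup>2)) \<longlonglongrightarrow> 0"
      unfolding x_def using t by (intro euler_converges[OF sol order_refl _ cm c solution_start[OF sol]]) auto
  qed measurable
  have iPx: "integrable M (\<lambda>\<omega>. \<Prod>i\<in>UNIV. x n i \<omega>)" for n
    using xr by (intro integrable_bounded[where K=1]) (auto simp: abs_prod intro!: prod_le_1)
  have iPX: "integrable M (\<lambda>\<omega>. \<Prod>i\<in>UNIV. X i t \<omega>)"
    using Xr by (intro integrable_bounded[where K=1]) (auto simp: abs_prod intro!: prod_le_1)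
  have "(\<lambda>n. expectation (\<lambda>\<omega>. \<Prod>i\<in>UNIV. x n i \<omega>)) \<longlonglongrightarrow> expectation (\<lambda>\<omega>. \<Prod>i\<in>UNIV. X i t \<omega>)"
  proof (rule Lim_transform_bound[THEN LIM_zero_cancel[of _ _ sequentially]])
    have "\<bar>expectation (\<lambda>\<omega>. \<Prod>i\<in>UNIV. x n i \<omega>) - expectation (\<lambda>\<omega>. \<Prod>i\<in>UNIV. X i t \<omega>)\<bar> \<le>
      (\<Sum>i\<in>UNIV. expectation (\<lambda>\<omega>. \<bar>X i t \<omega> - x n i \<omega>\<bar>))" for n
    proof -
      have "\<bar>expectation (\<lambda>\<omega>. \<Prod>i\<in>UNIV. x n i \<omega>) - expectation (\<lambda>\<omega>. \<Prod>i\<in>UNIV. X i t \<omega>)\<bar> =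
        \<bar>expectation (\<lambda>\<omega>. (\<Prod>i\<in>UNIV. x n i \<omega>) - (\<Prod>i\<in>UNIV. X i t \<omega>))\<bar>"
        using iPx iPX by simp
      also have "\<dots> \<le> expectation (\<lambda>\<omega>. \<bar>(\<Prod>i\<in>UNIV. x n i \<omega>) - (\<Prod>i\<in>UNIV. X i t \<omega>)\<bar>)"
        by (rule integral_abs_bound)
      also have "\<dots> \<le> expectation (\<lambda>\<omega>. \<Sum>i\<in>UNIV. \<bar>X i t \<omega> - x n i \<omega>\<bar>)"
      proof (rule integral_mono)
        show "integrable M (\<lambda>\<omega>. \<bar>(\<Prod>i\<in>UNIV. x n i \<omega>) - (\<Prod>i\<in>UNIV. X i t \<omega>)\<bar>)"
          using iPx iPX by auto
        show "integrable M (\<lambda>\<omega>. \<Sum>i\<in>UNIV. \<bar>X i t \<omega> - x n i \<omega>\<bar>)" using ix iX by auto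
        fix \<omega> assume "\<omega> \<in> space M"
        then show "\<bar>(\<Prod>i\<in>UNIV. x n i \<omega>) - (\<Prod>i\<in>UNIV. X i t \<omega>)\<bar> \<le> (\<Sum>i\<in>UNIV. \<bar>X i t \<omega> - x n i \<omega>\<bar>)"
          using abs_prod_diff_le[where I = UNIV and a = "\<lambda>i. x n i \<omega>" and b = "\<lambda>i. X i t \<omega>"] xr Xr by (simp add: abs_minus_commute)
      qed
      also have "\<dots> = (\<Sum>i\<in>UNIV. expectation (\<lambda>\<omega>. \<bar>X i t \<omega> - x n i \<omega>\<bar>))"
        using ix iX by (intro Bochner_Integration.integral_sum) auto
      finally show ?thesis .
    qed
    then show "\<forall>\<^sub>F n in sequentially. norm (expectation (\<lambda>\<omega>. \<Prod>i\<in>UNIV. x n i \<omega>) - expectation (\<lambda>\<omega>. \<Prod>i\<in>UNIV. X i t \<omega>)) \<le>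
      norm (\<Sum>i\<in>UNIV. expectation (\<lambda>\<omega>. \<bar>X i t \<omega> - x n i \<omega>\<bar>))"
      unfolding real_norm_def by (intro always_eventually allI) (rule order.trans[OF _ abs_ge_self])
    show "(\<lambda>n. \<Sum>i\<in>UNIV. expectation (\<lambda>\<omega>. \<bar>X i t \<omega> - x n i \<omega>\<bar>)) \<longlonglongrightarrow> 0"
      using tendsto_sum[OF L1, where I = UNIV] by simp
  qed
  moreover have "(\<lambda>n. expectation (\<lambda>\<omega>. \<Prod>i\<in>UNIV. x n i \<omega>)) \<longlonglongrightarrow> (\<Prod>i\<in>UNIV. c i)"
  proof -
    have "expectation (\<lambda>\<omega>. \<Prod>i\<in>UNIV. x n i \<omega>) = (\<Prod>i\<in>UNIV. expectation (x n i))" for n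
      using ix euler_independent[of "(t - 0) / real (Suc n)" c "Suc n"] t unfolding x_def
      by (intro indep_vars_lebesgue_integral) auto
    moreover have "(\<lambda>n. expectation (x n i)) \<longlonglongrightarrow> c i" for i
    proof -
      have "\<bar>expectation (x n i) - c i\<bar> \<le> expectation (\<lambda>\<omega>. \<bar>X i t \<omega> - x n i \<omega>\<bar>)" for n
      proof -
        have "\<bar>expectation (x n i) - c i\<bar> = \<bar>expectation (\<lambda>\<omega>. X i t \<omega> - x n i \<omega>)\<bar>"
          using ix[of n i] iX[of i] solution_expectation[OF sol, of t i] t by simp
        then show ?thesis by simp
      qed
      then have "(\<lambda>n. expectation (x n i) - c i) \<longlonglongrightarrow> 0"
        by (intro Lim_null_comparison[OF _ L1[of i]]) auto
      then show ?thesis by (rule LIM_zero_cancel)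
    qed
    ultimately show ?thesis by (auto intro!: tendsto_prod)
  qed
  ultimately show ?thesis by (rule LIMSEQ_unique)
qed

section \<open>Convergence of the solutions\<close>

text \<open>Rounding down to multiples of \<open>2 ^ - n\<close> preserves the order of two times.\<close>

definition dyadic :: "nat \<Rightarrow> real \<Rightarrow> real" where
  "dyadic n x = of_int \<lfloor>x * 2 ^ n\<rfloor> / 2 ^ n"

lemma dyadic_rat: "\<exists>q. dyadic n x = real_of_rat q"
  by (rule exI[of _ "of_int \<lfloor>x * 2 ^ n\<rfloor> / 2 ^ n"]) (simp add: dyadic_def of_rat_divide of_rat_power)

lemma dyadic_mono: "x \<le> y \<Longrightarrow> dyadic n x \<le> dyadic n y"
  unfolding dyadic_def by (intro divide_right_mono) (auto intro!: floor_mono mult_right_mono)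

lemma dyadic_nonneg: "0 \<le> x \<Longrightarrow> 0 \<le> dyadic n x"
  by (simp add: dyadic_def)

lemma dyadic_tendsto: "(\<lambda>n. dyadic n x) \<longlonglongrightarrow> x"
proof (rule tendsto_sandwich)
  have "dyadic n x \<le> x \<and> x - (1 / 2) ^ n \<le> dyadic n x" for n
  proof -
    have "of_int \<lfloor>x * 2 ^ n\<rfloor> \<le> x * 2 ^ n" "x * 2 ^ n - 1 \<le> of_int \<lfloor>x * 2 ^ n\<rfloor>" by linarith+
    then have "of_int \<lfloor>x * 2 ^ n\<rfloor> / 2 ^ n \<le> x * 2 ^ n / 2 ^ n" "(x * 2 ^ n - 1) / 2 ^ n \<le> of_int \<lfloor>x * 2 ^ n\<rfloor> / 2 ^ n"
      by (intro divide_right_mono; simp)+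
    then show ?thesis by (simp add: dyadic_def diff_divide_distrib power_one_over)
  qed
  then show "\<forall>\<^sub>F n in sequentially. dyadic n x \<le> x" "\<forall>\<^sub>F n in sequentially. x - (1 / 2) ^ n \<le> dyadic n x" by auto
  have "(\<lambda>n. (1 / 2 :: real) ^ n) \<longlonglongrightarrow> 0" by (rule LIMSEQ_realpow_zero) auto
  from tendsto_diff[OF tendsto_const this, of x] show "(\<lambda>n. x - (1 / 2) ^ n) \<longlonglongrightarrow> x" by simp
qed (rule tendsto_const)

context
  fixes i c X assumes sol: "logistic_solution i c X"
begin

lemma solution_diff_square_integrable: "integrable M (\<lambda>\<omega>. (X t \<omega> - X s \<omega>)\<^sup>2)"
  using solution_range[OF sol] solution_measurable[OF sol]
  by (intro integrable_unit_interval_diff_square) auto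

text \<open>Kolmogorov's maximal inequality: on the event that the threshold is first exceeded at step
  \<open>k\<close>, the later increments are orthogonal to the value reached.\<close>

lemma solution_maximal_inequality:
  assumes s: "0 \<le> s" "0 \<le> h" and l: "0 < l"
  shows "l\<^sup>2 * prob {\<omega>\<in>space M. \<exists>k\<le>n. l \<le> \<bar>X (s + real k * h) \<omega> - X s \<omega>\<bar>} \<le>
    expectation (\<lambda>\<omega>. (X (s + real n * h) \<omega> - X s \<omega>)\<^sup>2)"
proof -
  note [measurable] = solution_measurable[OF sol]
  define m where "m k \<omega> = X (s + real k * h) \<omega> - X s \<omega>" for k \<omega>
  define A where "A k = {\<omega>\<in>space M. l \<le> \<bar>m k \<omega>\<bar> \<and> (\<forall>j\<in>{..<k}. \<bar>m j \<omega>\<bar> < l)}" for k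
  have [measurable]: "m k \<in> borel_measurable M" for k unfolding m_def by measurable
  have le: "s + real j * h \<le> s + real k * h" if "j \<le> k" for j k
    using that s by (simp add: mult_right_mono)
  have mad: "m j \<in> borel_measurable (\<F> (s + real k * h))" if "j \<le> k" for j k
  proof -
    have "X (s + real j * h) \<in> borel_measurable (\<F> (s + real k * h))"
      by (rule filtration_measurable_mono[OF solution_adapted[OF sol] le[OF that]]) (use s in simp)
    moreover have "X s \<in> borel_measurable (\<F> (s + real k * h))"
      by (rule filtration_measurable_mono[OF solution_adapted[OF sol]]) (use s in auto)
    ultimately show ?thesis unfolding m_def by (rule borel_measurable_diff)
  qed
  have Aad: "A k \<in> sets (\<F> (s + real k * h))" for k
  proof -
    let ?F = "\<F> (s + real k * h)"
    have "{\<omega>\<in>space ?F. l \<le> \<bar>m k \<omega>\<bar>} \<in> sets ?F"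
      using mad[of k k] by measurable
    moreover have "{\<omega>\<in>space ?F. \<forall>j\<in>{..<k}. \<bar>m j \<omega>\<bar> < l} \<in> sets ?F"
    proof (rule sets.sets_Collect_finite_All)
      fix j assume "j \<in> {..<k}"
      then have "m j \<in> borel_measurable ?F" by (intro mad) simp
      then show "{\<omega>\<in>space ?F. \<bar>m j \<omega>\<bar> < l} \<in> sets ?F" by measurable
    qed simp
    ultimately have "{\<omega>\<in>space ?F. l \<le> \<bar>m k \<omega>\<bar> \<and> (\<forall>j\<in>{..<k}. \<bar>m j \<omega>\<bar> < l)} \<in> sets ?F"
      by (rule sets.sets_Collect_conj[rotated])
    then show ?thesis by (simp add: A_def)
  qed
  have [measurable]: "A k \<in> sets M" for k
    using Aad[of k] subalgebra_filtration[of "s + real k * h"] by (auto simp: subalgebra_def)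
  have mr: "\<bar>m k \<omega>\<bar> \<le> 1" if "\<omega> \<in> space M" for k \<omega>
    using solution_range[OF sol that, of s] solution_range[OF sol that, of "s + real k * h"] by (auto simp: m_def)
  have im2: "integrable M (\<lambda>\<omega>. (m n \<omega>)\<^sup>2)" unfolding m_def by (rule solution_diff_square_integrable)
  have step: "l\<^sup>2 * prob (A k) \<le> expectation (\<lambda>\<omega>. indicator (A k) \<omega> * (m n \<omega>)\<^sup>2)" if k: "k \<le> n" for k
  proof -
    have bp: "bounded_past (s + real k * h) (\<lambda>\<omega>. indicator (A k) \<omega> * m k \<omega>)"
    proof (rule bounded_past_mult)
      show "bounded_past (s + real k * h) (indicator (A k))"
        unfolding bounded_past_def using Aad[of k] by (auto simp: indicator_def intro!: exI[of _ 1])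
      show "bounded_past (s + real k * h) (m k)"
        unfolding bounded_past_def using mad[of k k] mr by auto
    qed
    have E0: "expectation (\<lambda>\<omega>. indicator (A k) \<omega> * m k \<omega> * (m n \<omega> - m k \<omega>)) = 0"
      using solution_martingale[OF sol _ le[OF k] bp] s by (simp add: m_def)
    have i0: "integrable M (\<lambda>\<omega>. indicator (A k) \<omega> * m k \<omega> * (m n \<omega> - m k \<omega>))"
      by (rule integrable_bounded_past_mult[OF bp]) (auto simp: m_def solution_integrable[OF sol])
    have "l\<^sup>2 * prob (A k) = expectation (\<lambda>\<omega>. l\<^sup>2 * indicator (A k) \<omega> + 2 * (indicator (A k) \<omega> * m k \<omega> * (m n \<omega> - m k \<omega>)))"
      using E0 i0 by (simp add: less_top[symmetric])
    also have "\<dots> \<le> expectation (\<lambda>\<omega>. indicator (A k) \<omega> * (m n \<omega>)\<^sup>2)"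
    proof (rule integral_mono)
      show "integrable M (\<lambda>\<omega>. l\<^sup>2 * indicator (A k) \<omega> + 2 * (indicator (A k) \<omega> * m k \<omega> * (m n \<omega> - m k \<omega>)))"
        using i0 by (intro Bochner_Integration.integrable_add integrable_mult_right) (auto simp: less_top[symmetric])
      show "integrable M (\<lambda>\<omega>. indicator (A k) \<omega> * (m n \<omega>)\<^sup>2)"
        using integrable_real_mult_indicator[of "A k" M, OF _ im2] by (simp add: mult.commute)
      fix \<omega>
      show "l\<^sup>2 * indicator (A k) \<omega> + 2 * (indicator (A k) \<omega> * m k \<omega> * (m n \<omega> - m k \<omega>)) \<le> indicator (A k) \<omega> * (m n \<omega>)\<^sup>2"
      proof (cases "\<omega> \<in> A k")
        case True
        then have "\<bar>l\<bar> \<le> \<bar>m k \<omega>\<bar>" using l by (simp add: A_def)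
        then have "l\<^sup>2 \<le> (m k \<omega>)\<^sup>2" by (simp only: abs_le_square_iff)
        moreover have "0 \<le> (m n \<omega> - m k \<omega>)\<^sup>2" by simp
        ultimately show ?thesis using True by (simp add: power2_eq_square algebra_simps)
      qed simp
    qed
    finally show ?thesis .
  qed
  have lt: "A j \<inter> A k = {}" if "j < k" for j k
  proof (rule equals0I)
    fix \<omega> assume "\<omega> \<in> A j \<inter> A k"
    then have "l \<le> \<bar>m j \<omega>\<bar>" "\<bar>m j \<omega>\<bar> < l" using that by (auto simp: A_def)
    then show False by simp
  qed
  have disj: "disjoint_family_on A {..n}"
    unfolding disjoint_family_on_def using lt by (metis Int_commute linorder_neqE_nat)
  have "{\<omega>\<in>space M. \<exists>k\<le>n. l \<le> \<bar>m k \<omega>\<bar>} = (\<Union>k\<in>{..n}. A k)"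
  proof (intro set_eqI iffI)
    fix \<omega> assume "\<omega> \<in> {\<omega>\<in>space M. \<exists>k\<le>n. l \<le> \<bar>m k \<omega>\<bar>}"
    then obtain k where k: "\<omega> \<in> space M" "k \<le> n" "l \<le> \<bar>m k \<omega>\<bar>" by auto
    define k0 where "k0 = (LEAST k. l \<le> \<bar>m k \<omega>\<bar>)"
    have "l \<le> \<bar>m k0 \<omega>\<bar>" "k0 \<le> k" unfolding k0_def using k(3) by (auto intro: LeastI Least_le)
    moreover have "\<bar>m j \<omega>\<bar> < l" if "j < k0" for j
      using not_less_Least[of j "\<lambda>k. l \<le> \<bar>m k \<omega>\<bar>"] that unfolding k0_def by force
    ultimately have "\<omega> \<in> A k0" "k0 \<le> n" using k by (auto simp: A_def)
    then show "\<omega> \<in> (\<Union>k\<in>{..n}. A k)" by auto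
  qed (auto simp: A_def)
  moreover have "prob (\<Union>k\<in>{..n}. A k) = (\<Sum>k\<le>n. prob (A k))"
    by (rule finite_measure_finite_Union[OF _ _ disj]) auto
  ultimately have "l\<^sup>2 * prob {\<omega>\<in>space M. \<exists>k\<le>n. l \<le> \<bar>m k \<omega>\<bar>} = (\<Sum>k\<le>n. l\<^sup>2 * prob (A k))"
    by (simp add: sum_distrib_left)
  also have "\<dots> \<le> (\<Sum>k\<le>n. expectation (\<lambda>\<omega>. indicator (A k) \<omega> * (m n \<omega>)\<^sup>2))"
    by (intro sum_mono step) simp
  also have "\<dots> = expectation (\<lambda>\<omega>. \<Sum>k\<le>n. indicator (A k) \<omega> * (m n \<omega>)\<^sup>2)"
  proof (rule Bochner_Integration.integral_sum[symmetric])
    show "integrable M (\<lambda>\<omega>. indicator (A k) \<omega> * (m n \<omega>)\<^sup>2)" for k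
      using integrable_real_mult_indicator[of "A k" M, OF _ im2] by (simp add: mult.commute)
  qed
  also have "\<dots> \<le> expectation (\<lambda>\<omega>. (m n \<omega>)\<^sup>2)"
  proof (rule integral_mono')
    show "integrable M (\<lambda>\<omega>. (m n \<omega>)\<^sup>2)" by (rule im2)
    fix \<omega>
    have "(\<Sum>k\<le>n. indicator (A k) \<omega>) \<le> (1 :: real)"
    proof -
      have "(\<Sum>k\<le>n. indicator (A k) \<omega>) = real (card {k\<in>{..n}. \<omega> \<in> A k})"
        by (simp add: indicator_def sum.If_cases Int_def)
      moreover have "card {k\<in>{..n}. \<omega> \<in> A k} \<le> Suc 0"
        using disj unfolding disjoint_family_on_def by (subst card_le_Suc0_iff_eq) auto
      ultimately show ?thesis by simp
    qed
    then show "(\<Sum>k\<le>n. indicator (A k) \<omega> * (m n \<omega>)\<^sup>2) \<le> (m n \<omega>)\<^sup>2"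
      using mult_right_mono[of "\<Sum>k\<le>n. indicator (A k) \<omega>" 1 "(m n \<omega>)\<^sup>2"] by (simp add: sum_distrib_right)
  qed auto
  finally show ?thesis unfolding m_def .
qed

text \<open>Pythagoras: the increment after \<open>s\<close> is orthogonal to \<open>X s\<close>.\<close>

lemma solution_second_moment:
  assumes "0 \<le> s" "s \<le> t"
  shows "expectation (\<lambda>\<omega>. (X t \<omega> - X s \<omega>)\<^sup>2) = expectation (\<lambda>\<omega>. (X t \<omega>)\<^sup>2) - expectation (\<lambda>\<omega>. (X s \<omega>)\<^sup>2)"
proof -
  note [measurable] = solution_measurable[OF sol]
  have i2: "integrable M (\<lambda>\<omega>. (X r \<omega>)\<^sup>2)" for r
    using solution_range[OF sol] by (intro integrable_bounded[where K=1]) (auto simp: power_le_one)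
  have bp: "bounded_past s (X s)" by (rule solution_bounded_past[OF sol assms(1)])
  have i0: "integrable M (\<lambda>\<omega>. X s \<omega> * (X t \<omega> - X s \<omega>))"
    by (rule integrable_bounded_past_mult[OF bp]) (auto simp: solution_integrable[OF sol])
  have "(X t \<omega> - X s \<omega>)\<^sup>2 = (X t \<omega>)\<^sup>2 - (X s \<omega>)\<^sup>2 - 2 * (X s \<omega> * (X t \<omega> - X s \<omega>))" for \<omega>
    by (simp add: power2_eq_square algebra_simps)
  then have "expectation (\<lambda>\<omega>. (X t \<omega> - X s \<omega>)\<^sup>2) =
     expectation (\<lambda>\<omega>. (X t \<omega>)\<^sup>2 - (X s \<omega>)\<^sup>2 - 2 * (X s \<omega> * (X t \<omega> - X s \<omega>)))" by simp
  also have "\<dots> = expectation (\<lambda>\<omega>. (X t \<omega>)\<^sup>2) - expectation (\<lambda>\<omega>. (X s \<omega>)\<^sup>2) - 2 * expectation (\<lambda>\<omega>. X s \<omega> * (X t \<omega> - X s \<omega>))"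
    using i2 i0 by simp
  also have "expectation (\<lambda>\<omega>. X s \<omega> * (X t \<omega> - X s \<omega>)) = 0"
    by (rule solution_martingale[OF sol assms bp])
  finally show ?thesis by simp
qed

lemma solution_second_moment_limit:
  "\<exists>L. (\<lambda>n. expectation (\<lambda>\<omega>. (X (real n) \<omega>)\<^sup>2)) \<longlonglongrightarrow> L \<and> (\<forall>t\<ge>0. expectation (\<lambda>\<omega>. (X t \<omega>)\<^sup>2) \<le> L)"
proof -
  note [measurable] = solution_measurable[OF sol]
  define v where "v t = expectation (\<lambda>\<omega>. (X t \<omega>)\<^sup>2)" for t
  have mono: "v s \<le> v t" if "0 \<le> s" "s \<le> t" for s t
  proof -
    have "0 \<le> expectation (\<lambda>\<omega>. (X t \<omega> - X s \<omega>)\<^sup>2)" by simp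
    then show ?thesis using solution_second_moment[OF that] unfolding v_def by simp
  qed
  have bd: "v t \<le> 1" for t
  proof -
    have "v t \<le> expectation (\<lambda>\<omega>. 1)"
      unfolding v_def using solution_range[OF sol]
      by (intro integral_mono integrable_bounded[where K=1]) (auto simp: power_le_one)
    then show ?thesis by (simp add: prob_space)
  qed
  have "incseq (\<lambda>n. v (real n))" by (rule incseq_SucI) (simp add: mono)
  then obtain L where L: "(\<lambda>n. v (real n)) \<longlonglongrightarrow> L" "\<And>n. v (real n) \<le> L"
    using bd by (metis incseq_convergent)
  have "v t \<le> L" if "0 \<le> t" for t
    using mono[OF that real_nat_ceiling_ge] L(2) by (rule order.trans)
  with L(1) show ?thesis unfolding v_def by blast
qed

text \<open>The maximal inequality on dyadic times gives, by continuity of paths, a bound on the whole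
  half line. The second moments converge, so the probability of a large oscillation is
  small after a late time.\<close>

lemma solution_oscillation:
  assumes l: "0 < l"
  shows "AE \<omega> in M. \<exists>N::nat. \<forall>t\<ge>real N. \<bar>X t \<omega> - X (real N) \<omega>\<bar> \<le> l"
proof -
  note [measurable] = solution_measurable[OF sol]
  define G where "G N = {\<omega>\<in>space M. \<forall>j k::nat. \<bar>X (real N + real k * (1 / 2 ^ j)) \<omega> - X (real N) \<omega>\<bar> < l}" for N :: nat
  have [measurable]: "G N \<in> sets M" for N unfolding G_def by measurable
  have big: "1 - e \<le> prob (\<Union>N. G N)" if e: "0 < e" for e
  proof -
    obtain L where L: "(\<lambda>n. expectation (\<lambda>\<omega>. (X (real n) \<omega>)\<^sup>2)) \<longlonglongrightarrow> L"
      "\<And>t. 0 \<le> t \<Longrightarrow> expectation (\<lambda>\<omega>. (X t \<omega>)\<^sup>2) \<le> L"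
      using solution_second_moment_limit by blast
    have "0 < e * l\<^sup>2" using e l by simp
    then have "\<forall>\<^sub>F n in sequentially. L - e * l\<^sup>2 < expectation (\<lambda>\<omega>. (X (real n) \<omega>)\<^sup>2)"
      using L(1) by (intro order_tendstoD(1)) auto
    then obtain N :: nat where N: "L - e * l\<^sup>2 < expectation (\<lambda>\<omega>. (X (real N) \<omega>)\<^sup>2)"
      by (auto simp: eventually_sequentially)
    \<comment> \<open>The grids of mesh \<open>1 / 2 ^ j\<close> with \<open>4 ^ j\<close> steps reach up to \<open>N + 2 ^ j\<close>; they increase and exhaust
        the dyadic times after \<open>N\<close>.\<close>
    define U where "U j = {\<omega>\<in>space M. \<exists>k\<le>(4::nat) ^ j. l \<le> \<bar>X (real N + real k * (1 / 2 ^ j)) \<omega> - X (real N) \<omega>\<bar>}" for j :: nat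
    have [measurable]: "U j \<in> sets M" for j unfolding U_def by measurable
    have Ue: "prob (U j) \<le> e" for j
    proof -
      have "l\<^sup>2 * prob (U j) \<le> expectation (\<lambda>\<omega>. (X (real N + real ((4::nat) ^ j) * (1 / 2 ^ j)) \<omega> - X (real N) \<omega>)\<^sup>2)"
        unfolding U_def using l by (intro solution_maximal_inequality) auto
      also have "\<dots> \<le> e * l\<^sup>2"
        using N L(2)[of "real N + real ((4::nat) ^ j) * (1 / 2 ^ j)"] by (subst solution_second_moment) auto
      finally show ?thesis using l by (simp add: mult.commute)
    qed
    have "incseq U"
    proof (rule incseq_SucI, rule subsetI)
      fix j \<omega> assume "\<omega> \<in> U j"
      then obtain k where k: "\<omega> \<in> space M" "k \<le> (4::nat) ^ j" "l \<le> \<bar>X (real N + real k * (1 / 2 ^ j)) \<omega> - X (real N) \<omega>\<bar>"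
        by (auto simp: U_def)
      have "real (2 * k) * (1 / 2 ^ Suc j) = real k * (1 / 2 ^ j)" by simp
      then show "\<omega> \<in> U (Suc j)" unfolding U_def using k by (auto intro!: exI[of _ "2 * k"])
    qed
    then have "(\<lambda>j. prob (U j)) \<longlonglongrightarrow> prob (\<Union>j. U j)"
      by (intro finite_Lim_measure_incseq) auto
    then have UU: "prob (\<Union>j. U j) \<le> e" using Ue by (intro LIMSEQ_le_const2) auto
    have "space M - (\<Union>j. U j) \<subseteq> G N"
    proof
      fix \<omega> assume w: "\<omega> \<in> space M - (\<Union>j. U j)"
      have "\<bar>X (real N + real k * (1 / 2 ^ j)) \<omega> - X (real N) \<omega>\<bar> < l" for j k :: nat
      proof -
        \<comment> \<open>The time \<open>N + k / 2 ^ j\<close> belongs to the grid \<open>j + k\<close>, where it has the index \<open>k * 2 ^ k\<close>.\<close>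
        have "k * 2 ^ k \<le> 2 ^ k * 2 ^ k" using less_exp[of k] by (intro mult_right_mono) auto
        also have "\<dots> = (4::nat) ^ k" by (simp add: power_mult_distrib[symmetric])
        also have "\<dots> \<le> 4 ^ (j + k)" by (intro power_increasing) auto
        finally have "k * 2 ^ k \<le> (4::nat) ^ (j + k)" .
        moreover have "\<omega> \<notin> U (j + k)" using w by auto
        ultimately have "\<bar>X (real N + real (k * 2 ^ k) * (1 / 2 ^ (j + k))) \<omega> - X (real N) \<omega>\<bar> < l"
          using w unfolding U_def by force
        moreover have "real (k * 2 ^ k) * (1 / 2 ^ (j + k)) = real k * (1 / 2 ^ j)"
          by (simp add: power_add)
        ultimately show ?thesis by (simp only:)
      qed
      then show "\<omega> \<in> G N" using w by (simp add: G_def)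
    qed
    then have "prob (space M - (\<Union>j. U j)) \<le> prob (\<Union>N. G N)"
      by (intro finite_measure_mono) auto
    moreover have "prob (space M - (\<Union>j. U j)) = 1 - prob (\<Union>j. U j)"
      by (intro prob_compl) auto
    ultimately show ?thesis using UU by simp
  qed
  have "1 \<le> prob (\<Union>N. G N) + e" if "0 < e" for e using big[OF that] by simp
  then have "1 \<le> prob (\<Union>N. G N)" by (rule field_le_epsilon)
  then have "prob (\<Union>N. G N) = 1" using prob_le_1 by (intro antisym) auto
  then have "AE \<omega> in M. \<omega> \<in> (\<Union>N. G N)" by (intro AE_prob_1) auto
  then show ?thesis
  proof eventually_elim
    case (elim \<omega>)
    then obtain N where N: "\<omega> \<in> G N" by auto
    have "\<bar>X t \<omega> - X (real N) \<omega>\<bar> \<le> l" if t: "real N \<le> t" for t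
    proof -
      define q where "q j = real (nat \<lfloor>(t - real N) * 2 ^ j\<rfloor>) * (1 / 2 ^ j)" for j
      have "q j = dyadic j (t - real N)" for j
        using t by (simp add: q_def dyadic_def)
      then have "q \<longlonglongrightarrow> t - real N"
        using dyadic_tendsto[of "t - real N"] by presburger
      then have "(\<lambda>j. real N + q j) \<longlonglongrightarrow> real N + (t - real N)" by (intro tendsto_intros)
      then have lim: "(\<lambda>j. real N + q j) \<longlonglongrightarrow> t" by simp
      have cont: "continuous_on {0..} (\<lambda>t. X t \<omega>)" using N by (intro solution_continuous[OF sol]) (simp add: G_def)
      have "(\<lambda>j. X (real N + q j) \<omega>) \<longlonglongrightarrow> X t \<omega>"
        by (rule continuous_on_tendsto_compose[OF cont lim]) (use t in \<open>auto simp: q_def\<close>)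
      then have "(\<lambda>j. \<bar>X (real N + q j) \<omega> - X (real N) \<omega>\<bar>) \<longlonglongrightarrow> \<bar>X t \<omega> - X (real N) \<omega>\<bar>"
        by (intro tendsto_intros)
      moreover have "\<bar>X (real N + q j) \<omega> - X (real N) \<omega>\<bar> \<le> l" for j
        using N unfolding G_def q_def by (auto intro: less_imp_le)
      ultimately show ?thesis by (intro LIMSEQ_le_const2) auto
    qed
    then show ?case by auto
  qed
qed

lemma solution_converges: "AE \<omega> in M. \<exists>x. ((\<lambda>t. X t \<omega>) \<longlongrightarrow> x) at_top"
proof -
  have "AE \<omega> in M. \<forall>m::nat. \<exists>N::nat. \<forall>t\<ge>real N. \<bar>X t \<omega> - X (real N) \<omega>\<bar> \<le> 1 / real (Suc m)"
    by (subst AE_all_countable) (auto intro!: solution_oscillation)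
  then show ?thesis
  proof eventually_elim
    case (elim \<omega>)
    have osc: "\<exists>N::nat. \<forall>t\<ge>real N. \<bar>X t \<omega> - X (real N) \<omega>\<bar> < e" if e: "0 < e" for e
    proof -
      obtain m :: nat where m: "1 / real (Suc m) < e" using e by (metis nat_approx_posE)
      obtain N :: nat where "\<forall>t\<ge>real N. \<bar>X t \<omega> - X (real N) \<omega>\<bar> \<le> 1 / real (Suc m)" using elim by blast
      then show ?thesis using m by (intro exI[of _ N]) force
    qed
    have "Cauchy (\<lambda>n::nat. X (real n) \<omega>)"
    proof (rule CauchyI')
      fix e :: real assume "0 < e"
      then obtain N :: nat where N: "\<forall>t\<ge>real N. \<bar>X t \<omega> - X (real N) \<omega>\<bar> < e / 2" using osc[of "e / 2"] by auto
      have "dist (X (real m) \<omega>) (X (real n) \<omega>) < e" if "N \<le> m" "m < n" for m n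
      proof -
        have "\<bar>X (real m) \<omega> - X (real N) \<omega>\<bar> < e / 2" "\<bar>X (real n) \<omega> - X (real N) \<omega>\<bar> < e / 2" using N that by auto
        then show ?thesis unfolding dist_real_def by linarith
      qed
      then show "\<exists>M. \<forall>m\<ge>M. \<forall>n>m. dist (X (real m) \<omega>) (X (real n) \<omega>) < e" by blast
    qed
    then obtain x where x: "(\<lambda>n::nat. X (real n) \<omega>) \<longlonglongrightarrow> x"
      using Cauchy_convergent convergent_def by blast
    have "((\<lambda>t. X t \<omega>) \<longlongrightarrow> x) at_top"
    proof (rule tendstoI)
      fix e :: real assume "0 < e"
      then obtain N :: nat where N: "\<forall>t\<ge>real N. \<bar>X t \<omega> - X (real N) \<omega>\<bar> < e / 2" using osc[of "e / 2"] by auto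
      have "(\<lambda>n. \<bar>X (real n) \<omega> - X (real N) \<omega>\<bar>) \<longlonglongrightarrow> \<bar>x - X (real N) \<omega>\<bar>" by (intro tendsto_intros x)
      then have "\<bar>x - X (real N) \<omega>\<bar> \<le> e / 2"
        by (rule LIMSEQ_le_const2) (use N in \<open>auto intro!: exI[of _ N] less_imp_le\<close>)
      then have "dist (X t \<omega>) x < e" if "real N \<le> t" for t
      proof -
        have "\<bar>X t \<omega> - X (real N) \<omega>\<bar> < e / 2" using N that by blast
        with \<open>\<bar>x - X (real N) \<omega>\<bar> \<le> e / 2\<close> show ?thesis unfolding dist_real_def by linarith
      qed
      then show "\<forall>\<^sub>F t in at_top. dist (X t \<omega>) x < e" by (auto simp: eventually_at_top_linorder)
    qed
    then show ?case by blast
  qed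
qed

text \<open>The accumulated variance of the increments is bounded, so the coefficient \<open>X (1 - X)\<close> is small
  at suitable late times; hence it vanishes in the limit.\<close>

lemma solution_limit:
  obtains L where "L \<in> borel_measurable M" "AE \<omega> in M. ((\<lambda>t. X t \<omega>) \<longlongrightarrow> L \<omega>) at_top \<and> (L \<omega> = 0 \<or> L \<omega> = 1)"
proof -
  note [measurable] = solution_measurable[OF sol]
  define L where "L \<omega> = lim (\<lambda>n::nat. X (real n) \<omega>)" for \<omega>
  have [measurable]: "L \<in> borel_measurable M" unfolding L_def by measurable
  have nat_top: "filterlim (\<lambda>n::nat. real n) at_top sequentially" by (rule filterlim_real_sequentially)
  have conv: "AE \<omega> in M. ((\<lambda>t. X t \<omega>) \<longlongrightarrow> L \<omega>) at_top"
    using solution_converges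
  proof eventually_elim
    case (elim \<omega>)
    then obtain x where x: "((\<lambda>t. X t \<omega>) \<longlongrightarrow> x) at_top" by auto
    from filterlim_compose[OF this nat_top] have "L \<omega> = x" unfolding L_def by (simp add: limI)
    with x show ?case by simp
  qed
  define f where "f u \<omega> = X u \<omega> * (1 - X u \<omega>)" for u \<omega>
  define J where "J n = expectation (\<lambda>\<omega>. (X (real (Suc n)) \<omega> - X (real n) \<omega>)\<^sup>2)" for n :: nat
  have J0: "0 \<le> J n" for n unfolding J_def by simp
  have "J \<longlonglongrightarrow> 0"
  proof -
    obtain l where l: "(\<lambda>n. expectation (\<lambda>\<omega>. (X (real n) \<omega>)\<^sup>2)) \<longlonglongrightarrow> l"
      using solution_second_moment_limit by blast
    have "(\<lambda>n. expectation (\<lambda>\<omega>. (X (real (Suc n)) \<omega>)\<^sup>2) - expectation (\<lambda>\<omega>. (X (real n) \<omega>)\<^sup>2)) \<longlonglongrightarrow> l - l"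
      by (intro tendsto_diff l LIMSEQ_Suc[OF l])
    moreover have "J = (\<lambda>n. expectation (\<lambda>\<omega>. (X (real (Suc n)) \<omega>)\<^sup>2) - expectation (\<lambda>\<omega>. (X (real n) \<omega>)\<^sup>2))"
      unfolding J_def by (intro ext solution_second_moment) auto
    ultimately show ?thesis by (simp only: diff_self)
  qed
  have if2: "integrable M (\<lambda>\<omega>. (f u \<omega>)\<^sup>2)" for u
    using logistic_bounds[OF solution_range[OF sol]]
    by (intro integrable_bounded[where K=1]) (auto simp: f_def power_le_one)
  \<comment> \<open>If the coefficient were larger throughout \<open>(n, n + 1]\<close>, then by the isometry the increment over this
      interval would be too large. The additional \<open>1 / (n + 1)\<close> makes the contradiction strict.\<close>
  have "\<exists>u. real n < u \<and> expectation (\<lambda>\<omega>. (f u \<omega>)\<^sup>2) \<le> J n + 1 / real (Suc n)" for n :: nat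
  proof (rule ccontr)
    assume neg: "\<nexists>u. real n < u \<and> expectation (\<lambda>\<omega>. (f u \<omega>)\<^sup>2) \<le> J n + 1 / real (Suc n)"
    let ?B = "J n + 1 / real (Suc n)"
    have B: "0 \<le> ?B" using J0[of n] by simp
    have "ennreal ?B = (\<integral>\<^sup>+u. ennreal ?B * indicator {real n<..real (Suc n)} u \<partial>lborel)"
      by (simp add: nn_integral_cmult_indicator)
    also have "\<dots> \<le> (\<integral>\<^sup>+u. sqn M (\<lambda>\<omega>. X u \<omega> * (1 - X u \<omega>) - 0) * indicator {real n<..real (Suc n)} u \<partial>lborel)"
    proof (rule nn_integral_mono)
      fix u
      have "ennreal ?B \<le> sqn M (f u)" if "real n < u"
        unfolding sqn_def using neg that if2[of u]
        by (subst nn_integral_eq_integral) (auto intro!: ennreal_leI intro: less_imp_le simp: not_le)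
      then show "ennreal ?B * indicator {real n<..real (Suc n)} u \<le>
         sqn M (\<lambda>\<omega>. X u \<omega> * (1 - X u \<omega>) - 0) * indicator {real n<..real (Suc n)} u"
        by (auto simp: indicator_def f_def[abs_def])
    qed
    also have "\<dots> = sqn M (\<lambda>\<omega>. X (real (Suc n)) \<omega> - X (real n) \<omega> - 0 * increment i (real n) (real (Suc n)) \<omega>)"
      by (rule solution_isometry[OF sol _ _ bounded_past_0[OF sol], symmetric]) auto
    also have "\<dots> = ennreal (J n)"
      unfolding sqn_def J_def using solution_diff_square_integrable by (subst nn_integral_eq_integral) auto
    finally show False using J0[of n] B by (simp add: ennreal_le_iff)
  qed
  then obtain u where u: "\<And>n::nat. real n < u n" "\<And>n. expectation (\<lambda>\<omega>. (f (u n) \<omega>)\<^sup>2) \<le> J n + 1 / real (Suc n)"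
    by metis
  have u_top: "filterlim u at_top sequentially"
    by (rule filterlim_at_top_mono[OF nat_top]) (use u(1) in \<open>auto intro!: always_eventually less_imp_le\<close>)
  have "(\<lambda>n. expectation (\<lambda>\<omega>. (f (u n) \<omega>)\<^sup>2)) \<longlonglongrightarrow> expectation (\<lambda>\<omega>. (L \<omega> * (1 - L \<omega>))\<^sup>2)"
  proof (rule integral_dominated_convergence[where w = "\<lambda>_. 1"])
    show "AE \<omega> in M. (\<lambda>n. (f (u n) \<omega>)\<^sup>2) \<longlonglongrightarrow> (L \<omega> * (1 - L \<omega>))\<^sup>2"
      using conv
    proof eventually_elim
      case (elim \<omega>)
      from filterlim_compose[OF elim u_top] have "(\<lambda>n. X (u n) \<omega>) \<longlonglongrightarrow> L \<omega>" .
      then show ?case unfolding f_def by (intro tendsto_intros)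
    qed
    show "AE \<omega> in M. norm ((f (u n) \<omega>)\<^sup>2) \<le> 1" for n
      using logistic_bounds[OF solution_range[OF sol]] by (intro AE_I2) (auto simp: f_def power_le_one)
  qed (auto simp: f_def)
  moreover have "(\<lambda>n. expectation (\<lambda>\<omega>. (f (u n) \<omega>)\<^sup>2)) \<longlonglongrightarrow> 0"
  proof (rule tendsto_sandwich[OF _ _ tendsto_const])
    have "(\<lambda>n. J n + inverse (real (Suc n))) \<longlonglongrightarrow> 0 + 0"
      by (intro tendsto_add \<open>J \<longlonglongrightarrow> 0\<close> LIMSEQ_inverse_real_of_nat)
    then show "(\<lambda>n. J n + 1 / real (Suc n)) \<longlonglongrightarrow> 0" by (simp add: inverse_eq_divide)
  qed (use u(2) in auto)
  ultimately have z: "expectation (\<lambda>\<omega>. (L \<omega> * (1 - L \<omega>))\<^sup>2) = 0" by (rule LIMSEQ_unique)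
  have Lr: "AE \<omega> in M. 0 \<le> L \<omega> \<and> L \<omega> \<le> 1"
    using conv AE_space
  proof eventually_elim
    case (elim \<omega>)
    show ?case
      using tendsto_lowerbound[OF elim(1)] tendsto_upperbound[OF elim(1)] solution_range[OF sol elim(2)] by simp
  qed
  have "AE \<omega> in M. (L \<omega> * (1 - L \<omega>))\<^sup>2 = 0"
  proof (subst integral_nonneg_eq_0_iff_AE[symmetric])
    show "integrable M (\<lambda>\<omega>. (L \<omega> * (1 - L \<omega>))\<^sup>2)"
    proof (rule integrable_const_bound[where B=1])
      show "AE \<omega> in M. norm ((L \<omega> * (1 - L \<omega>))\<^sup>2) \<le> 1"
        using Lr by eventually_elim (use logistic_bounds in \<open>auto simp: power_le_one\<close>)
    qed measurable
  qed (use z in auto)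
  then have "AE \<omega> in M. ((\<lambda>t. X t \<omega>) \<longlongrightarrow> L \<omega>) at_top \<and> (L \<omega> = 0 \<or> L \<omega> = 1)"
    using conv by eventually_elim auto
  then show ?thesis by (intro that[of L]) auto
qed

end

text \<open>The limits take the values \<open>0\<close> and \<open>1\<close>, so their product is the indicator function of the event
  that all of them are \<open>1\<close>.\<close>

theorem solutions_limits:
  assumes sol: "\<And>i. logistic_solution i (c i) (X i)" and c: "\<And>i. 0 \<le> c i \<and> c i \<le> 1"
  obtains L where "\<And>i. L i \<in> borel_measurable M"
    "AE \<omega> in M. \<forall>i::'d. ((\<lambda>t. X i t \<omega>) \<longlongrightarrow> L i \<omega>) at_top \<and> (L i \<omega> = 0 \<or> L i \<omega> = 1)"
    "prob {\<omega>\<in>space M. \<forall>i. L i \<omega> = 1} = (\<Prod>i\<in>UNIV. c i)"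
proof -
  note [measurable] = solution_measurable[OF sol]
  have "\<exists>L. L \<in> borel_measurable M \<and> (AE \<omega> in M. ((\<lambda>t. X i t \<omega>) \<longlongrightarrow> L \<omega>) at_top \<and> (L \<omega> = 0 \<or> L \<omega> = 1))" for i
    by (rule solution_limit[OF sol[of i]]) (intro exI conjI)
  from choice[OF allI[OF this]] obtain L where
    "\<forall>i. L i \<in> borel_measurable M \<and> (AE \<omega> in M. ((\<lambda>t. X i t \<omega>) \<longlongrightarrow> L i \<omega>) at_top \<and> (L i \<omega> = 0 \<or> L i \<omega> = 1))" ..
  then have L: "\<And>i. L i \<in> borel_measurable M"
    "\<And>i. AE \<omega> in M. ((\<lambda>t. X i t \<omega>) \<longlongrightarrow> L i \<omega>) at_top \<and> (L i \<omega> = 0 \<or> L i \<omega> = 1)"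
    by simp_all
  note [measurable] = L(1)
  have all: "AE \<omega> in M. \<forall>i. ((\<lambda>t. X i t \<omega>) \<longlongrightarrow> L i \<omega>) at_top \<and> (L i \<omega> = 0 \<or> L i \<omega> = 1)"
    by (rule eventually_all_finite) (rule L(2))
  have "(\<lambda>n. expectation (\<lambda>\<omega>. \<Prod>i\<in>UNIV. X i (real (Suc n)) \<omega>)) \<longlonglongrightarrow> expectation (\<lambda>\<omega>. \<Prod>i\<in>UNIV. L i \<omega>)"
  proof (rule integral_dominated_convergence[where w = "\<lambda>_. 1"])
    show "AE \<omega> in M. (\<lambda>n. \<Prod>i\<in>UNIV. X i (real (Suc n)) \<omega>) \<longlonglongrightarrow> (\<Prod>i\<in>UNIV. L i \<omega>)"
      using all
    proof eventually_elim
      case (elim \<omega>)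
      have "(\<lambda>n. X i (real (Suc n)) \<omega>) \<longlonglongrightarrow> L i \<omega>" for i
        using filterlim_compose[OF _ filterlim_real_sequentially] elim LIMSEQ_Suc by blast
      then show ?case by (intro tendsto_prod)
    qed
    show "AE \<omega> in M. norm (\<Prod>i\<in>UNIV. X i (real (Suc n)) \<omega>) \<le> 1" for n
      using solution_range[OF sol] by (intro AE_I2) (auto simp: abs_prod intro!: prod_le_1)
  qed auto
  moreover have "expectation (\<lambda>\<omega>. \<Prod>i\<in>UNIV. X i (real (Suc n)) \<omega>) = (\<Prod>i\<in>UNIV. c i)" for n
    by (rule expectation_prod_solutions[OF sol _ c]) simp
  ultimately have "expectation (\<lambda>\<omega>. \<Prod>i\<in>UNIV. L i \<omega>) = (\<Prod>i\<in>UNIV. c i)"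
    by (simp add: LIMSEQ_const_iff)
  moreover have "expectation (\<lambda>\<omega>. \<Prod>i\<in>UNIV. L i \<omega>) = expectation (indicator {\<omega>\<in>space M. \<forall>i. L i \<omega> = 1})"
  proof (rule Bochner_Integration.integral_cong_AE)
    show "AE \<omega> in M. (\<Prod>i\<in>UNIV. L i \<omega>) = indicator {\<omega>\<in>space M. \<forall>i. L i \<omega> = 1} \<omega>"
      using all AE_space
    proof eventually_elim
      case (elim \<omega>)
      show ?case
      proof (cases "\<forall>i. L i \<omega> = 1")
        case False
        then obtain j where "L j \<omega> = 0" using elim by auto
        then have "(\<Prod>i\<in>UNIV. L i \<omega>) = 0" by (intro prod_zero) auto
        then show ?thesis using False by simp
      qed (use elim in simp)
    qed
  qed auto
  ultimately have "prob {\<omega>\<in>space M. \<forall>i. L i \<omega> = 1} = (\<Prod>i\<in>UNIV. c i)"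
    by (simp add: less_top[symmetric])
  with L(1) all show ?thesis by (rule that)
qed

end

section \<open>The flow on the cube\<close>

lemma tendsto_at_top_shift:
  fixes f :: "real \<Rightarrow> real"
  shows "((\<lambda>s. f (s + t)) \<longlongrightarrow> l) at_top \<longleftrightarrow> (f \<longlongrightarrow> l) at_top"
proof
  have top: "filterlim (\<lambda>s. s + r) at_top at_top" for r :: real
    using filterlim_tendsto_add_at_top[OF tendsto_const[of r] filterlim_ident] by (simp add: add.commute)
  show "(f \<longlongrightarrow> l) at_top" if "((\<lambda>s. f (s + t)) \<longlongrightarrow> l) at_top"
    using filterlim_compose[OF that top[of "- t"]] by simp
  show "((\<lambda>s. f (s + t)) \<longlongrightarrow> l) at_top" if "(f \<longlongrightarrow> l) at_top"
    using filterlim_compose[OF that top[of t]] .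
qed

text \<open>Countably many times suffice to decide convergence of a continuous path; this makes the basin
  of \<open>0\<close> a measurable event.\<close>

lemma tendsto_0_at_top_iff_rational:
  fixes f :: "real \<Rightarrow> real"
  assumes f: "continuous_on UNIV f"
  shows "(f \<longlongrightarrow> 0) at_top \<longleftrightarrow>
    (\<forall>m::nat. \<exists>N::nat. \<forall>r::rat. real N \<le> of_rat r \<longrightarrow> \<bar>f (of_rat r)\<bar> \<le> 1 / real (Suc m))"
proof
  assume lim: "(f \<longlongrightarrow> 0) at_top"
  show "\<forall>m::nat. \<exists>N::nat. \<forall>r::rat. real N \<le> of_rat r \<longrightarrow> \<bar>f (of_rat r)\<bar> \<le> 1 / real (Suc m)"
  proof
    fix m :: nat
    have "\<forall>\<^sub>F t in at_top. dist (f t) 0 < 1 / real (Suc m)"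
      by (rule tendstoD[OF lim]) simp
    then obtain T where T: "\<And>t. T \<le> t \<Longrightarrow> \<bar>f t\<bar> < 1 / real (Suc m)"
      by (auto simp: eventually_at_top_linorder)
    obtain N :: nat where "T \<le> real N" using real_arch_simple by blast
    then show "\<exists>N::nat. \<forall>r::rat. real N \<le> of_rat r \<longrightarrow> \<bar>f (of_rat r)\<bar> \<le> 1 / real (Suc m)"
    proof (intro exI[of _ N] allI impI)
      fix r :: rat assume "real N \<le> of_rat r"
      then have "T \<le> of_rat r" using \<open>T \<le> real N\<close> by (rule order.trans[rotated])
      then show "\<bar>f (of_rat r)\<bar> \<le> 1 / real (Suc m)" by (rule less_imp_le[OF T])
    qed
  qed
next
  assume R: "\<forall>m::nat. \<exists>N::nat. \<forall>r::rat. real N \<le> of_rat r \<longrightarrow> \<bar>f (of_rat r)\<bar> \<le> 1 / real (Suc m)"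
  show "(f \<longlongrightarrow> 0) at_top"
  proof (rule tendstoI)
    fix e :: real assume "0 < e"
    then obtain m :: nat where m: "1 / real (Suc m) < e" by (metis nat_approx_posE)
    obtain N :: nat where N: "\<And>r::rat. real N \<le> of_rat r \<Longrightarrow> \<bar>f (of_rat r)\<bar> \<le> 1 / real (Suc m)" using R by blast
    have "dist (f t) 0 < e" if t: "real N < t" for t
    proof (rule ccontr)
      assume "\<not> dist (f t) 0 < e"
      then have "1 / real (Suc m) < \<bar>f t\<bar>" using m by simp
      moreover have "isCont (\<lambda>t. \<bar>f t\<bar>) t"
        using f by (auto simp: continuous_on_eq_continuous_at intro!: continuous_intros)
      ultimately have "\<forall>\<^sub>F s in at t. 1 / real (Suc m) < \<bar>f s\<bar>"
        unfolding isCont_def by (intro order_tendstoD(1)) auto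
      then obtain d where d: "0 < d" "\<And>s. s \<noteq> t \<Longrightarrow> dist s t < d \<Longrightarrow> 1 / real (Suc m) < \<bar>f s\<bar>"
        unfolding eventually_at by auto
      obtain r :: rat where r: "max (real N) (t - d) < of_rat r" "of_rat r < t"
        using of_rat_dense[of "max (real N) (t - d)" t] t d(1) by auto
      have "1 / real (Suc m) < \<bar>f (of_rat r)\<bar>" using r by (intro d(2)) (auto simp: dist_real_def)
      with N[of r] r show False by simp
    qed
    then show "\<forall>\<^sub>F t in at_top. dist (f t) 0 < e"
      by (intro eventually_mono[OF eventually_gt_at_top[of "real N"]])
  qed
qed

locale logistic_flow = wiener M
  for M :: "(real \<Rightarrow> real ^ 'd) measure" +
  fixes \<phi> :: "real \<Rightarrow> (real \<Rightarrow> real ^ 'd) \<Rightarrow> real ^ 'd \<Rightarrow> real ^ 'd"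
    and \<phi>c :: "'d \<Rightarrow> real \<Rightarrow> (real \<Rightarrow> real ^ 'd) \<Rightarrow> real \<Rightarrow> real"
  assumes generated: "generated_rds M \<phi> \<phi>c"
begin

abbreviation "\<theta> \<equiv> wiener_shift"

lemma rds: "random_dynamical_system M \<theta> unit_cube uniform_dist \<phi>"
  using generated by (simp add: generated_rds_def)

sublocale cube: Metric_space "unit_cube :: (real ^ 'd) set" uniform_dist
  using rds by (simp add: random_dynamical_system_def)

subsection \<open>The Wiener shift\<close>

lemma mds: "metric_dynamical_system M \<theta>"
  using rds by (simp add: random_dynamical_system_def)

lemma shift_measurable [measurable]: "\<theta> t \<in> measurable M M"
proof -
  have "(\<lambda>(t, \<omega>). \<theta> t \<omega>) \<in> measurable (borel \<Otimes>\<^sub>M M) M"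
    using mds by (simp add: metric_dynamical_system_def)
  from measurable_Pair2[OF this, of t] show ?thesis by simp
qed

lemma shift_space: "\<omega> \<in> space M \<Longrightarrow> \<theta> t \<omega> \<in> space M"
  using measurable_space[OF shift_measurable] .

lemma distr_shift: "distr M M (\<theta> t) = M"
  using mds by (simp add: metric_dynamical_system_def)

lemma shift_add: "\<omega> \<in> space M \<Longrightarrow> \<theta> t (\<theta> s \<omega>) = \<theta> (t + s) \<omega>"
  using mds by (simp add: metric_dynamical_system_def)

lemma shift_0: "\<omega> \<in> space M \<Longrightarrow> \<theta> 0 \<omega> = \<omega>"
  using mds by (simp add: metric_dynamical_system_def)

text \<open>The shift preserves the measure, so almost sure statements, and below also probabilities, can be
  transported by it. This is how pullback and forward statements are exchanged.\<close>

lemma AE_shift: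
  assumes "AE \<omega> in M. P \<omega>"
  shows "AE \<omega> in M. P (\<theta> t \<omega>)"
  using AE_distrD[OF shift_measurable, of P t] assms unfolding distr_shift by blast

lemma prob_shift:
  assumes [measurable]: "Measurable.pred M P"
  shows "prob {\<omega>\<in>space M. P (\<theta> t \<omega>)} = prob {\<omega>\<in>space M. P \<omega>}"
proof -
  have "prob {\<omega>\<in>space M. P \<omega>} = measure (distr M M (\<theta> t)) {\<omega>\<in>space M. P \<omega>}"
    by (simp add: distr_shift)
  also have "\<dots> = prob (\<theta> t -` {\<omega>\<in>space M. P \<omega>} \<inter> space M)"
    by (rule measure_distr) measurable
  also have "\<theta> t -` {\<omega>\<in>space M. P \<omega>} \<inter> space M = {\<omega>\<in>space M. P (\<theta> t \<omega>)}"
    using shift_space by auto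
  finally show ?thesis ..
qed

subsection \<open>Coordinates of the flow\<close>

lemma vec_in_cube: "0 \<le> c \<Longrightarrow> c \<le> 1 \<Longrightarrow> (\<chi> j. c) \<in> unit_cube"
  by (simp add: unit_cube_def)

lemma flow_0: "\<omega> \<in> space M \<Longrightarrow> x \<in> unit_cube \<Longrightarrow> \<phi> 0 \<omega> x = x"
  using rds by (simp add: random_dynamical_system_def)

lemma flow_add: "\<omega> \<in> space M \<Longrightarrow> x \<in> unit_cube \<Longrightarrow> \<phi> (t + s) \<omega> x = \<phi> t (\<theta> s \<omega>) (\<phi> s \<omega> x)"
  using rds by (simp add: random_dynamical_system_def)

lemma flow_coordinates: "\<omega> \<in> space M \<Longrightarrow> x \<in> unit_cube \<Longrightarrow> \<phi> t \<omega> x = (\<chi> i. \<phi>c i t \<omega> (x $ i))"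
  using generated by (simp add: generated_rds_def acts_coordinatewise_def)

lemma coordinate_strict_mono: "\<omega> \<in> space M \<Longrightarrow> strict_mono_on {0..1} (\<phi>c i t \<omega>)"
  using generated by (simp add: generated_rds_def acts_coordinatewise_def)

lemma coordinate_bij: "\<omega> \<in> space M \<Longrightarrow> bij_betw (\<phi>c i t \<omega>) {0..1} {0..1}"
  using generated by (simp add: generated_rds_def acts_coordinatewise_def)

lemma coordinate_less:
  "\<omega> \<in> space M \<Longrightarrow> 0 \<le> x \<Longrightarrow> x < y \<Longrightarrow> y \<le> 1 \<Longrightarrow> \<phi>c i t \<omega> x < \<phi>c i t \<omega> y"
  using coordinate_strict_mono[of \<omega> i t] by (auto simp: strict_mono_on_def)

lemma coordinate_le:
  "\<omega> \<in> space M \<Longrightarrow> 0 \<le> x \<Longrightarrow> x \<le> y \<Longrightarrow> y \<le> 1 \<Longrightarrow> \<phi>c i t \<omega> x \<le> \<phi>c i t \<omega> y"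
  using coordinate_less[of \<omega> x y i t] by (cases "x = y") auto

lemma coordinate_range:
  assumes "\<omega> \<in> space M" "0 \<le> x" "x \<le> 1"
  shows "0 \<le> \<phi>c i t \<omega> x" "\<phi>c i t \<omega> x \<le> 1"
  using bij_betwE[OF coordinate_bij[OF assms(1), of i t]] assms(2,3) by auto

lemma coordinate_surj:
  assumes "\<omega> \<in> space M" "0 \<le> y" "y \<le> 1"
  obtains x where "0 \<le> x" "x \<le> 1" "\<phi>c i t \<omega> x = y"
proof -
  have "y \<in> \<phi>c i t \<omega> ` {0..1}"
    using bij_betw_imp_surj_on[OF coordinate_bij[OF assms(1), of i t]] assms by simp
  then show ?thesis using that by auto
qed

lemma coordinate_endpoints:
  assumes w: "\<omega> \<in> space M"
  shows "\<phi>c i t \<omega> 0 = 0" "\<phi>c i t \<omega> 1 = 1"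
proof -
  obtain x where x: "0 \<le> x" "x \<le> 1" "\<phi>c i t \<omega> x = 0" using coordinate_surj[OF w, of 0 i t] by auto
  show "\<phi>c i t \<omega> 0 = 0"
    using coordinate_le[OF w, of 0 x i t] coordinate_range[OF w, of 0 i t] x by simp
  obtain y where y: "0 \<le> y" "y \<le> 1" "\<phi>c i t \<omega> y = 1" using coordinate_surj[OF w, of 1 i t] by auto
  show "\<phi>c i t \<omega> 1 = 1"
    using coordinate_le[OF w, of y 1 i t] coordinate_range[OF w, of 1 i t] y by simp
qed

lemma coordinate_interior:
  assumes "\<omega> \<in> space M" "0 < x" "x < 1"
  shows "0 < \<phi>c i t \<omega> x \<and> \<phi>c i t \<omega> x < 1"
  using coordinate_less[OF assms(1), of 0 x i t] coordinate_less[OF assms(1), of x 1 i t]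
    coordinate_endpoints[OF assms(1)] assms by simp

lemma flow_in_cube: "\<omega> \<in> space M \<Longrightarrow> x \<in> unit_cube \<Longrightarrow> \<phi> t \<omega> x \<in> unit_cube"
  using coordinate_range by (simp add: flow_coordinates unit_cube_def)

lemma flow_vec: "\<omega> \<in> space M \<Longrightarrow> 0 \<le> c \<Longrightarrow> c \<le> 1 \<Longrightarrow> \<phi> t \<omega> (\<chi> j. c) $ i = \<phi>c i t \<omega> c"
  using flow_coordinates[OF _ vec_in_cube] by simp

lemma coordinate_0:
  assumes "\<omega> \<in> space M" "0 \<le> c" "c \<le> 1"
  shows "\<phi>c i 0 \<omega> c = c"
  using flow_0[OF assms(1) vec_in_cube[OF assms(2,3)]] flow_vec[OF assms, of 0 i] by simp

lemma coordinate_add: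
  assumes "\<omega> \<in> space M" "0 \<le> c" "c \<le> 1"
  shows "\<phi>c i (t + s) \<omega> c = \<phi>c i t (\<theta> s \<omega>) (\<phi>c i s \<omega> c)"
  using flow_add[OF assms(1) vec_in_cube[OF assms(2,3)], of t s] flow_vec[OF assms, of "t + s" i]
    flow_coordinates[OF shift_space[OF assms(1)] flow_in_cube[OF assms(1) vec_in_cube[OF assms(2,3)]], of t s s]
    flow_vec[OF assms, of s i] by simp

lemma coordinate_inverse:
  assumes "\<omega> \<in> space M" "0 \<le> c" "c \<le> 1"
  shows "\<phi>c i t \<omega> (\<phi>c i (- t) (\<theta> t \<omega>) c) = c"
  using coordinate_add[OF shift_space[OF assms(1)] assms(2,3), of i t "- t" t] coordinate_0[OF shift_space[OF assms(1)] assms(2,3)]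
    shift_add[OF assms(1)] shift_0[OF assms(1)] by simp

lemma flow_inverse:
  assumes "\<omega> \<in> space M" "x \<in> unit_cube"
  shows "\<phi> (- t) (\<theta> t \<omega>) (\<phi> t \<omega> x) = x" "\<phi> t (\<theta> (- t) \<omega>) (\<phi> (- t) \<omega> x) = x"
  using flow_add[OF assms, of "- t" t] flow_add[OF assms, of t "- t"] flow_0[OF assms] by simp_all

text \<open>By the cocycle property \<open>\<phi> t (\<theta> (- t) \<omega>)\<close> is inverted by \<open>\<phi> (- t) \<omega>\<close>.\<close>

lemma inverse_flow_eq:
  assumes w: "\<omega> \<in> space M" and x: "x \<in> unit_cube"
  shows "inverse_flow \<theta> unit_cube \<phi> t \<omega> x = \<phi> (- t) \<omega> x"
  unfolding inverse_flow_def
proof (rule inv_into_f_eq)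
  show "inj_on (\<phi> t (\<theta> (- t) \<omega>)) unit_cube"
    by (rule inj_on_inverseI[of _ "\<phi> (- t) (\<theta> t (\<theta> (- t) \<omega>))"]) (rule flow_inverse[OF shift_space[OF w]])
qed (use flow_in_cube[OF w x] flow_inverse[OF w x] in auto)

subsection \<open>Measurability and continuity\<close>

lemma coordinate_projection_continuous:
  "continuous_map cube.mtopology euclideanreal (\<lambda>x. x $ i)"
  unfolding continuous_map_def
proof (intro conjI allI impI)
  fix U :: "real set" assume "openin euclideanreal U"
  then have U: "open U" by simp
  show "openin cube.mtopology {x \<in> topspace cube.mtopology. x $ i \<in> U}"
    unfolding cube.openin_mtopology
  proof (intro conjI allI impI)
    fix x :: "real ^ 'd" assume x: "x \<in> {x \<in> topspace cube.mtopology. x $ i \<in> U}"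
    then obtain e where e: "0 < e" "\<And>y. dist y (x $ i) < e \<Longrightarrow> y \<in> U" using U unfolding open_dist by auto
    have "cube.mball x e \<subseteq> {x \<in> topspace cube.mtopology. x $ i \<in> U}"
    proof
      fix y assume y: "y \<in> cube.mball x e"
      have "\<bar>(x - y) $ i\<bar> \<le> infnorm (x - y)" by (rule component_le_infnorm_cart)
      also have "\<dots> < e" using y by (simp add: cube.in_mball uniform_dist_def)
      finally have "dist (y $ i) (x $ i) < e" by (simp add: dist_real_def abs_minus_commute)
      then show "y \<in> {x \<in> topspace cube.mtopology. x $ i \<in> U}"
        using e(2) y by (simp add: cube.in_mball)
    qed
    then show "\<exists>r>0. cube.mball x r \<subseteq> {x \<in> topspace cube.mtopology. x $ i \<in> U}" using e(1) by blast
  qed auto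
qed auto

lemma space_metric_borel: "space (metric_borel unit_cube uniform_dist) = (unit_cube :: (real ^ 'd) set)"
  by (simp add: metric_borel_def space_measure_of_conv)

lemma coordinate_projection_measurable:
  "(\<lambda>x :: real ^ 'd. x $ i) \<in> borel_measurable (metric_borel unit_cube uniform_dist)"
proof (rule borel_measurableI)
  fix U :: "real set" assume "open U"
  then have "openin cube.mtopology {x \<in> topspace cube.mtopology. x $ i \<in> U}"
    using coordinate_projection_continuous[of i] unfolding continuous_map_def by simp
  moreover have "{x \<in> topspace cube.mtopology. x $ i \<in> U} = (\<lambda>x. x $ i) -` U \<inter> space (metric_borel unit_cube uniform_dist)"
    by (auto simp: space_metric_borel)
  moreover have "{U. openin cube.mtopology U} \<subseteq> Pow unit_cube"
    using openin_subset[of cube.mtopology] by auto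
  ultimately show "(\<lambda>x. x $ i) -` U \<inter> space (metric_borel unit_cube uniform_dist) \<in> sets (metric_borel unit_cube uniform_dist)"
    unfolding metric_borel_def by (subst sets_measure_of) (auto intro: sigma_sets.Basic)
qed

lemma flow_jointly_measurable:
  assumes "x \<in> unit_cube"
  shows "(\<lambda>p. \<phi> (snd p) (fst p) x $ i) \<in> borel_measurable (M \<Otimes>\<^sub>M lborel)"
proof -
  have 1: "(\<lambda>p. (snd p, fst p, x)) \<in> measurable (M \<Otimes>\<^sub>M lborel) (borel \<Otimes>\<^sub>M M \<Otimes>\<^sub>M metric_borel unit_cube uniform_dist)"
    using assms by (intro measurable_Pair measurable_const) (auto simp: space_metric_borel)
  have 2: "(\<lambda>(t, \<omega>, x). \<phi> t \<omega> x) \<in> measurable (borel \<Otimes>\<^sub>M M \<Otimes>\<^sub>M metric_borel unit_cube uniform_dist) (metric_borel unit_cube uniform_dist)"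
    using rds by (simp add: random_dynamical_system_def)
  have "(\<lambda>p. \<phi> (snd p) (fst p) x) \<in> measurable (M \<Otimes>\<^sub>M lborel) (metric_borel unit_cube uniform_dist)"
    using measurable_compose[OF 1 2] by simp
  from measurable_compose[OF this coordinate_projection_measurable] show ?thesis .
qed

lemma flow_measurable:
  assumes "x \<in> unit_cube"
  shows "(\<lambda>\<omega>. \<phi> t \<omega> x $ i) \<in> borel_measurable M"
proof -
  have "(\<lambda>\<omega>. (\<omega>, t)) \<in> measurable M (M \<Otimes>\<^sub>M lborel)" by measurable
  from measurable_compose[OF this flow_jointly_measurable[OF assms]] show ?thesis by simp
qed

lemma coordinate_measurable:
  assumes "0 \<le> c" "c \<le> 1"
  shows "(\<lambda>\<omega>. \<phi>c i t \<omega> c) \<in> borel_measurable M"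
proof -
  have "(\<lambda>\<omega>. \<phi>c i t \<omega> c) \<in> borel_measurable M \<longleftrightarrow> (\<lambda>\<omega>. \<phi> t \<omega> (\<chi> j. c) $ i) \<in> borel_measurable M"
    by (rule measurable_cong) (simp add: flow_vec assms)
  then show ?thesis using flow_measurable[OF vec_in_cube[OF assms]] by simp
qed

lemma flow_solution:
  assumes "0 \<le> c" "c \<le> 1"
  shows "logistic_solution i c (\<lambda>t \<omega>. \<phi> t \<omega> (\<chi> j. c) $ i)"
  unfolding logistic_solution_def
proof (intro conjI allI ballI)
  show "solves_ito_sde M \<F> (\<lambda>t \<omega>. \<omega> t $ i) (\<lambda>y. y * (1 - y)) c (\<lambda>t \<omega>. \<phi> t \<omega> (\<chi> j. c) $ i)"
  proof -
    have "\<forall>x\<in>unit_cube. \<forall>i. solves_ito_sde M \<F> (\<lambda>t \<omega>. \<omega> t $ i) (\<lambda>y. y * (1 - y)) (x $ i) (\<lambda>t \<omega>. \<phi> t \<omega> x $ i)"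
      using generated unfolding generated_rds_def by (elim conjE)
    from bspec[OF this vec_in_cube[OF assms]] show ?thesis by simp
  qed
  show "(\<lambda>p. \<phi> (snd p) (fst p) (\<chi> j. c) $ i) \<in> borel_measurable (M \<Otimes>\<^sub>M lborel)"
    by (rule flow_jointly_measurable[OF vec_in_cube[OF assms]])
  fix t \<omega> assume "\<omega> \<in> space M"
  then show "0 \<le> \<phi> t \<omega> (\<chi> j. c) $ i" "\<phi> t \<omega> (\<chi> j. c) $ i \<le> 1"
    using coordinate_range assms by (auto simp: flow_vec)
qed

lemma coordinate_continuous:
  assumes w: "\<omega> \<in> space M"
  shows "continuous_on (UNIV \<times> {0..1}) (\<lambda>(t, c). \<phi>c i t \<omega> c)"
proof -
  have vec: "continuous_map (top_of_set (UNIV \<times> {0..1})) cube.mtopology (\<lambda>(t::real, c). \<chi> j. c)"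
    unfolding cube.continuous_map_to_metric
  proof (intro ballI allI impI)
    fix p :: "real \<times> real" and e :: real assume p: "p \<in> topspace (top_of_set (UNIV \<times> {0..1}))" and e: "0 < e"
    define U where "U = (UNIV \<times> {0..1}) \<inter> {q :: real \<times> real. \<bar>snd p - snd q\<bar> < e}"
    have "open {q :: real \<times> real. \<bar>snd p - snd q\<bar> < e}"
      by (intro open_Collect_less continuous_intros)
    then have "openin (top_of_set (UNIV \<times> {0..1})) U"
      unfolding U_def by (rule openin_open_Int)
    moreover have "p \<in> U" using p e by (auto simp: U_def)
    moreover have "(case q of (t, c) \<Rightarrow> \<chi> j. c) \<in> cube.mball (case p of (t, c) \<Rightarrow> \<chi> j. c) e" if "q \<in> U" for q
    proof -
      have "infnorm ((\<chi> j. snd p) - (\<chi> j. snd q) :: real ^ 'd) = \<bar>snd p - snd q\<bar>"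
      proof -
        have "(\<chi> j. snd p) - (\<chi> j. snd q) = (snd p - snd q) *\<^sub>R (1 :: real ^ 'd)"
          by (simp add: vec_eq_iff)
        moreover have "infnorm (1 :: real ^ 'd) = 1"
          by (simp add: infnorm_cart)
        ultimately show ?thesis by (simp add: infnorm_mul)
      qed
      then show ?thesis
        using that p vec_in_cube by (auto simp: U_def cube.in_mball uniform_dist_def split: prod.splits)
    qed
    ultimately show "\<exists>U. openin (top_of_set (UNIV \<times> {0..1})) U \<and> p \<in> U \<and>
        (\<forall>q\<in>U. (case q of (t, c) \<Rightarrow> \<chi> j. c) \<in> cube.mball (case p of (t, c) \<Rightarrow> \<chi> j. c) e)" by blast
  qed
  have "continuous_map (top_of_set (UNIV \<times> {0..1})) (prod_topology euclideanreal cube.mtopology) (\<lambda>p :: real \<times> real. (fst p, (\<lambda>(t, c). \<chi> j. c) p))"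
    using vec by (intro continuous_map_pairedI) (auto intro: continuous_intros)
  moreover have "continuous_map (prod_topology euclideanreal cube.mtopology) cube.mtopology (\<lambda>(t, x). \<phi> t \<omega> x)"
    using generated w by (simp add: generated_rds_def jointly_continuous_def)
  ultimately have "continuous_map (top_of_set (UNIV \<times> {0..1})) euclideanreal
      ((\<lambda>x. x $ i) \<circ> ((\<lambda>(t, x). \<phi> t \<omega> x) \<circ> (\<lambda>p :: real \<times> real. (fst p, (\<lambda>(t, c). \<chi> j. c) p))))"
    by (intro continuous_map_compose[OF _ coordinate_projection_continuous] continuous_map_compose)
  then have "continuous_on (UNIV \<times> {0..1}) ((\<lambda>x. x $ i) \<circ> ((\<lambda>(t, x). \<phi> t \<omega> x) \<circ> (\<lambda>p :: real \<times> real. (fst p, (\<lambda>(t, c). \<chi> j. c) p))))"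
    by simp
  then show ?thesis
    by (rule continuous_on_eq) (auto simp: flow_vec[OF w])
qed

lemma coordinate_continuous_time:
  assumes "\<omega> \<in> space M" "0 \<le> c" "c \<le> 1"
  shows "continuous_on UNIV (\<lambda>t. \<phi>c i t \<omega> c)"
proof -
  have "continuous_on UNIV (\<lambda>t. (\<lambda>(t, c). \<phi>c i t \<omega> c) (t, c))"
    by (rule continuous_on_compose2[OF coordinate_continuous[OF assms(1)]])
      (use assms in \<open>auto intro!: continuous_intros\<close>)
  then show ?thesis by simp
qed

subsection \<open>The random point\<close>

abbreviation "b \<equiv> basin_point \<phi>c"

definition basin :: "'d \<Rightarrow> (real \<Rightarrow> real ^ 'd) \<Rightarrow> real set" where
  "basin i \<omega> = {c \<in> {0..1}. ((\<lambda>t. \<phi>c i t \<omega> c) \<longlongrightarrow> 0) at_top}"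

lemma b_eq: "b \<omega> $ i = Sup (basin i \<omega>)"
proof -
  have "{x $ i | x :: real ^ 'd. x \<in> unit_cube \<and> ((\<lambda>t. \<phi>c i t \<omega> (x $ i)) \<longlongrightarrow> 0) at_top} = basin i \<omega>"
  proof (intro set_eqI iffI)
    fix c assume "c \<in> basin i \<omega>"
    then have "(\<chi> j. c) \<in> unit_cube" "((\<lambda>t. \<phi>c i t \<omega> ((\<chi> j. c) $ i)) \<longlongrightarrow> 0) at_top" "c = (\<chi> j. c) $ i"
      by (auto simp: basin_def vec_in_cube)
    then show "c \<in> {x $ i | x :: real ^ 'd. x \<in> unit_cube \<and> ((\<lambda>t. \<phi>c i t \<omega> (x $ i)) \<longlongrightarrow> 0) at_top}" by blast
  qed (auto simp: basin_def unit_cube_def)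
  then show ?thesis by (simp add: basin_point_def)
qed

lemma zero_in_basin: "\<omega> \<in> space M \<Longrightarrow> 0 \<in> basin i \<omega>"
  by (simp add: basin_def coordinate_endpoints)

lemma basin_bdd: "bdd_above (basin i \<omega>)"
  by (rule bdd_aboveI[of _ 1]) (auto simp: basin_def)

lemma b_range:
  assumes "\<omega> \<in> space M"
  shows "0 \<le> b \<omega> $ i" "b \<omega> $ i \<le> 1"
proof -
  show "0 \<le> b \<omega> $ i" unfolding b_eq by (rule cSup_upper[OF zero_in_basin[OF assms] basin_bdd])
  show "b \<omega> $ i \<le> 1" unfolding b_eq
  proof (rule cSup_least)
    show "basin i \<omega> \<noteq> {}" using zero_in_basin[OF assms] by blast
  qed (simp add: basin_def)
qed

lemma basin_downward:
  assumes w: "\<omega> \<in> space M" and c: "c \<in> basin i \<omega>" "0 \<le> d" "d \<le> c"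
  shows "d \<in> basin i \<omega>"
proof -
  have r: "c \<le> 1" "d \<le> 1" using c by (auto simp: basin_def)
  have "((\<lambda>t. \<phi>c i t \<omega> d) \<longlongrightarrow> 0) at_top"
  proof (rule tendsto_sandwich[OF _ _ tendsto_const])
    show "((\<lambda>t. \<phi>c i t \<omega> c) \<longlongrightarrow> 0) at_top" using c by (simp add: basin_def)
    show "\<forall>\<^sub>F t in at_top. 0 \<le> \<phi>c i t \<omega> d" "\<forall>\<^sub>F t in at_top. \<phi>c i t \<omega> d \<le> \<phi>c i t \<omega> c"
      using coordinate_range[OF w c(2) r(2)] coordinate_le[OF w c(2,3) r(1)] by auto
  qed
  then show ?thesis using c r by (simp add: basin_def)
qed

lemma below_b_in_basin:
  assumes w: "\<omega> \<in> space M" and "0 \<le> c" "c < b \<omega> $ i"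
  shows "c \<in> basin i \<omega>"
proof -
  obtain d where "d \<in> basin i \<omega>" "c < d"
    using assms(3) less_cSup_iff[OF _ basin_bdd, of i \<omega> c] zero_in_basin[OF w] unfolding b_eq by blast
  then show ?thesis using basin_downward[OF w _ assms(2)] by simp
qed

lemma above_b_not_in_basin: "b \<omega> $ i < c \<Longrightarrow> c \<notin> basin i \<omega>"
  using cSup_upper[OF _ basin_bdd, of c i \<omega>] unfolding b_eq by auto

lemma basin_shift:
  assumes w: "\<omega> \<in> space M" and c: "0 \<le> c" "c \<le> 1"
  shows "\<phi>c i t \<omega> c \<in> basin i (\<theta> t \<omega>) \<longleftrightarrow> c \<in> basin i \<omega>"
proof -
  have "((\<lambda>s. \<phi>c i s (\<theta> t \<omega>) (\<phi>c i t \<omega> c)) \<longlongrightarrow> 0) at_top \<longleftrightarrow> ((\<lambda>s. \<phi>c i (s + t) \<omega> c) \<longlongrightarrow> 0) at_top"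
    by (simp add: coordinate_add[OF w c])
  also have "\<dots> \<longleftrightarrow> ((\<lambda>s. \<phi>c i s \<omega> c) \<longlongrightarrow> 0) at_top"
    by (rule tendsto_at_top_shift)
  finally show ?thesis using coordinate_range[OF w c] c by (simp add: basin_def)
qed

text \<open>The increasing bijection \<open>\<phi>c i t \<omega>\<close> maps the basin of \<open>0\<close> for \<open>\<omega>\<close> onto the basin for \<open>\<theta> t \<omega>\<close>,
  and it commutes with suprema.\<close>

lemma b_equivariant:
  assumes w: "\<omega> \<in> space M"
  shows "b (\<theta> t \<omega>) $ i = \<phi>c i t \<omega> (b \<omega> $ i)"
  unfolding b_eq[of "\<theta> t \<omega>"]
proof (rule cSup_eq_non_empty)
  show "basin i (\<theta> t \<omega>) \<noteq> {}" using zero_in_basin[OF shift_space[OF w]] by blast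
  fix y assume y: "y \<in> basin i (\<theta> t \<omega>)"
  then have yr: "0 \<le> y" "y \<le> 1" by (auto simp: basin_def)
  obtain x where x: "0 \<le> x" "x \<le> 1" "\<phi>c i t \<omega> x = y" by (rule coordinate_surj[OF w yr])
  have "x \<in> basin i \<omega>" using basin_shift[OF w x(1,2), of i t] y x(3) by simp
  then have "x \<le> b \<omega> $ i" unfolding b_eq by (rule cSup_upper[OF _ basin_bdd])
  then show "y \<le> \<phi>c i t \<omega> (b \<omega> $ i)"
    using coordinate_le[OF w x(1) _ b_range(2)[OF w]] x(3) by blast
next
  fix y assume ub: "\<And>x. x \<in> basin i (\<theta> t \<omega>) \<Longrightarrow> x \<le> y"
  show "\<phi>c i t \<omega> (b \<omega> $ i) \<le> y"
  proof (rule ccontr)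
    assume "\<not> \<phi>c i t \<omega> (b \<omega> $ i) \<le> y"
    then have lt: "y < \<phi>c i t \<omega> (b \<omega> $ i)" by simp
    have y: "0 \<le> y" "y \<le> 1"
      using ub[OF zero_in_basin[OF shift_space[OF w]]] lt coordinate_range(2)[OF w b_range[OF w]] by (auto intro: order.trans less_imp_le)
    obtain x where x: "0 \<le> x" "x \<le> 1" "\<phi>c i t \<omega> x = y" by (rule coordinate_surj[OF w y])
    have "x < b \<omega> $ i"
      using coordinate_le[OF w b_range(1)[OF w, of i], of x i t] x lt by force
    then obtain z where z: "x < z" "z < b \<omega> $ i" using dense by blast
    have zb: "z \<in> basin i \<omega>" using z x by (intro below_b_in_basin[OF w]) auto
    have z1: "z \<le> 1" "0 \<le> z" using zb by (auto simp: basin_def)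
    have "\<phi>c i t \<omega> z \<in> basin i (\<theta> t \<omega>)" using basin_shift[OF w z1(2,1), of i t] zb by simp
    then have "\<phi>c i t \<omega> z \<le> y" by (rule ub)
    then show False using coordinate_less[OF w x(1) z(1) z1(1), of i t] x(3) by simp
  qed
qed

lemma basin_measurable:
  assumes "0 \<le> c" "c \<le> 1"
  shows "{\<omega>\<in>space M. c \<in> basin i \<omega>} \<in> sets M"
proof -
  have [measurable]: "(\<lambda>\<omega>. \<phi>c i t \<omega> c) \<in> borel_measurable M" for t
    by (rule coordinate_measurable[OF assms])
  have "{\<omega>\<in>space M. c \<in> basin i \<omega>} =
    {\<omega>\<in>space M. \<forall>m::nat. \<exists>N::nat. \<forall>r::rat. real N \<le> of_rat r \<longrightarrow> \<bar>\<phi>c i (of_rat r) \<omega> c\<bar> \<le> 1 / real (Suc m)}"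
    using tendsto_0_at_top_iff_rational[OF coordinate_continuous_time[OF _ assms]] assms by (auto simp: basin_def)
  also have "\<dots> \<in> sets M" by measurable
  finally show ?thesis .
qed

lemma b_coordinate_measurable: "(\<lambda>\<omega>. b \<omega> $ i) \<in> borel_measurable M"
proof (rule borel_measurableI_greater)
  fix y :: real
  have "{\<omega>\<in>space M. y < b \<omega> $ i} =
    {\<omega>\<in>space M. y < 0} \<union> (\<Union>q\<in>{q::rat. 0 \<le> real_of_rat q \<and> real_of_rat q \<le> 1 \<and> y < real_of_rat q}. {\<omega>\<in>space M. real_of_rat q \<in> basin i \<omega>})"
    (is "?L = ?R")
  proof (intro set_eqI iffI)
    fix \<omega> assume L: "\<omega> \<in> ?L"
    then have w: "\<omega> \<in> space M" by simp
    show "\<omega> \<in> ?R"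
    proof (cases "y < 0")
      case False
      obtain q where q: "y < real_of_rat q" "real_of_rat q < b \<omega> $ i" using of_rat_dense[of y "b \<omega> $ i"] L by auto
      have q0: "0 \<le> real_of_rat q" using q(1) False by linarith
      have "real_of_rat q \<in> basin i \<omega>" by (rule below_b_in_basin[OF w q0 q(2)])
      moreover have "real_of_rat q \<le> 1" using q(2) b_range(2)[OF w, of i] by linarith
      ultimately show ?thesis using q(1) q0 w by blast
    qed (use w in simp)
  next
    fix \<omega> assume "\<omega> \<in> ?R"
    then show "\<omega> \<in> ?L"
    proof
      assume "\<omega> \<in> {\<omega>\<in>space M. y < 0}"
      then show ?thesis using b_range(1)[of \<omega> i] by simp
    next
      assume "\<omega> \<in> (\<Union>q\<in>{q::rat. 0 \<le> real_of_rat q \<and> real_of_rat q \<le> 1 \<and> y < real_of_rat q}. {\<omega>\<in>space M. real_of_rat q \<in> basin i \<omega>})"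
      then obtain q where q: "\<omega> \<in> space M" "y < real_of_rat q" "real_of_rat q \<in> basin i \<omega>" by auto
      then show ?thesis using cSup_upper[OF q(3) basin_bdd] by (simp add: b_eq)
    qed
  qed
  also have "\<dots> \<in> sets M"
    by (intro sets.Un sets.countable_UN'' basin_measurable) auto
  finally show "?L \<in> sets M" .
qed

lemma b_measurable [measurable]: "b \<in> borel_measurable M"
  by (rule borel_measurable_vecI[OF b_coordinate_measurable])

text \<open>Up to null sets, \<open>b\<^sup>i < c\<^sup>i\<close> holds if and only if the solution that starts in \<open>c\<^sup>i\<close> tends to
  \<open>1\<close>, and the joint probability of these events is the product of the \<open>c\<^sup>i\<close>.\<close>

lemma b_joint_bounds:
  fixes c :: "'d \<Rightarrow> real"
  assumes c: "\<And>i. 0 \<le> c i \<and> c i \<le> 1"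
  shows "prob {\<omega>\<in>space M. \<forall>i. b \<omega> $ i < c i \<or> c i = 1} \<le> (\<Prod>i\<in>UNIV. c i)"
    and "(\<Prod>i\<in>UNIV. c i) \<le> prob {\<omega>\<in>space M. \<forall>i. b \<omega> $ i \<le> c i}"
proof -
  note [measurable] = b_coordinate_measurable
  obtain L where L: "\<And>i. L i \<in> borel_measurable M"
    "AE \<omega> in M. \<forall>i::'d. ((\<lambda>t. \<phi> t \<omega> (\<chi> j. c i) $ i) \<longlongrightarrow> L i \<omega>) at_top \<and> (L i \<omega> = 0 \<or> L i \<omega> = 1)"
    "prob {\<omega>\<in>space M. \<forall>i. L i \<omega> = 1} = (\<Prod>i\<in>UNIV. c i)"
    by (rule solutions_limits[of c "\<lambda>i t \<omega>. \<phi> t \<omega> (\<chi> j. c i) $ i"]) (use flow_solution c in auto)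
  note [measurable] = L(1)
  have lim: "AE \<omega> in M. \<forall>i. ((\<lambda>t. \<phi>c i t \<omega> (c i)) \<longlongrightarrow> L i \<omega>) at_top \<and> (L i \<omega> = 0 \<or> L i \<omega> = 1)"
    using L(2) AE_space by eventually_elim (use c in \<open>auto simp: flow_vec\<close>)
  have up: "AE \<omega> in M. (\<forall>i. b \<omega> $ i < c i \<or> c i = 1) \<longrightarrow> (\<forall>i. L i \<omega> = 1)"
    using lim AE_space
  proof eventually_elim
    case (elim \<omega>)
    show ?case
    proof (intro impI allI)
      fix i assume *: "\<forall>i. b \<omega> $ i < c i \<or> c i = 1"
      show "L i \<omega> = 1"
      proof (cases "c i = 1")
        case True
        then have "(\<lambda>t. \<phi>c i t \<omega> (c i)) = (\<lambda>t. 1 :: real)" using coordinate_endpoints(2)[OF elim(2)] by simp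
        moreover have "((\<lambda>t. \<phi>c i t \<omega> (c i)) \<longlongrightarrow> L i \<omega>) at_top" using elim(1) by blast
        ultimately have "((\<lambda>t :: real. 1 :: real) \<longlongrightarrow> L i \<omega>) at_top" by simp
        then show ?thesis by (simp add: tendsto_const_iff)
      next
        case False
        then have "c i \<notin> basin i \<omega>" using * by (intro above_b_not_in_basin) auto
        moreover have "c i \<in> {0..1}" using c[of i] by simp
        moreover have "((\<lambda>t. \<phi>c i t \<omega> (c i)) \<longlongrightarrow> L i \<omega>) at_top" using elim(1) by blast
        ultimately have "L i \<omega> \<noteq> 0" unfolding basin_def by force
        then show ?thesis using elim by blast
      qed
    qed
  qed
  then have "prob {\<omega>\<in>space M. \<forall>i. b \<omega> $ i < c i \<or> c i = 1} \<le> prob {\<omega>\<in>space M. \<forall>i. L i \<omega> = 1}"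
    by (intro finite_measure_mono_AE) auto
  then show "prob {\<omega>\<in>space M. \<forall>i. b \<omega> $ i < c i \<or> c i = 1} \<le> (\<Prod>i\<in>UNIV. c i)"
    by (simp add: L(3))
  have "AE \<omega> in M. (\<forall>i. L i \<omega> = 1) \<longrightarrow> (\<forall>i. b \<omega> $ i \<le> c i)"
    using lim AE_space
  proof eventually_elim
    case (elim \<omega>)
    show ?case
    proof (intro impI allI, rule ccontr)
      fix i assume *: "\<forall>i. L i \<omega> = 1" "\<not> b \<omega> $ i \<le> c i"
      then have "c i \<in> basin i \<omega>" using c by (intro below_b_in_basin[OF elim(2)]) auto
      then have "L i \<omega> = 0"
        using elim(1) unfolding basin_def by (auto intro: tendsto_unique[OF trivial_limit_at_top_linorder])
      then show False using * by simp
    qed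
  qed
  then have "prob {\<omega>\<in>space M. \<forall>i. L i \<omega> = 1} \<le> prob {\<omega>\<in>space M. \<forall>i. b \<omega> $ i \<le> c i}"
    by (intro finite_measure_mono_AE) auto
  then show "(\<Prod>i\<in>UNIV. c i) \<le> prob {\<omega>\<in>space M. \<forall>i. b \<omega> $ i \<le> c i}"
    by (simp add: L(3))
qed

text \<open>The upper bound for strict inequalities is applied to levels \<open>d i\<close> slightly above \<open>c i\<close>. At the
  level \<open>1\<close> there is no room, but there the inequality is no restriction.\<close>

lemma b_joint_distribution:
  fixes c :: "'d \<Rightarrow> real"
  assumes c: "\<And>i. 0 \<le> c i \<and> c i \<le> 1"
  shows "prob {\<omega>\<in>space M. \<forall>i. b \<omega> $ i \<le> c i} = (\<Prod>i\<in>UNIV. c i)"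
proof (rule antisym)
  note [measurable] = b_coordinate_measurable
  show "prob {\<omega>\<in>space M. \<forall>i. b \<omega> $ i \<le> c i} \<le> (\<Prod>i\<in>UNIV. c i)"
  proof (rule LIMSEQ_le_const)
    have "(\<lambda>n. min 1 (c i + inverse (real (Suc n)))) \<longlonglongrightarrow> min 1 (c i + 0)" for i
      by (intro tendsto_intros LIMSEQ_inverse_real_of_nat)
    then show "(\<lambda>n. \<Prod>i\<in>UNIV. min 1 (c i + inverse (real (Suc n)))) \<longlonglongrightarrow> (\<Prod>i\<in>UNIV. c i)"
      using c by (intro tendsto_prod) (simp add: min_absorb2)
    have "prob {\<omega>\<in>space M. \<forall>i. b \<omega> $ i \<le> c i} \<le> (\<Prod>i\<in>UNIV. min 1 (c i + inverse (real (Suc n))))" for n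
    proof -
      define d where "d i = min 1 (c i + inverse (real (Suc n)))" for i
      have d: "0 \<le> d i \<and> d i \<le> 1" "c i < d i \<or> d i = 1" for i
      proof -
        have "0 < inverse (real (Suc n))" by simp
        then have "c i < c i + inverse (real (Suc n))" by linarith
        then show "0 \<le> d i \<and> d i \<le> 1" "c i < d i \<or> d i = 1"
          using c[of i] unfolding d_def by (auto simp: min_def)
      qed
      have "prob {\<omega>\<in>space M. \<forall>i. b \<omega> $ i \<le> c i} \<le> prob {\<omega>\<in>space M. \<forall>i. b \<omega> $ i < d i \<or> d i = 1}"
      proof (rule finite_measure_mono)
        show "{\<omega>\<in>space M. \<forall>i. b \<omega> $ i \<le> c i} \<subseteq> {\<omega>\<in>space M. \<forall>i. b \<omega> $ i < d i \<or> d i = 1}"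
          using d(2) by (auto intro: le_less_trans)
      qed measurable
      also have "\<dots> \<le> (\<Prod>i\<in>UNIV. d i)" by (rule b_joint_bounds(1)[OF d(1)])
      finally show ?thesis by (simp add: d_def)
    qed
    then show "\<exists>N. \<forall>n\<ge>N. prob {\<omega>\<in>space M. \<forall>i. b \<omega> $ i \<le> c i} \<le> (\<Prod>i\<in>UNIV. min 1 (c i + inverse (real (Suc n))))"
      by blast
  qed
qed (rule b_joint_bounds(2)[OF c])

lemma open_cube_eq_box: "{x :: real ^ 'd. \<forall>i. 0 < x $ i \<and> x $ i < 1} = box 0 1"
  by (auto simp: mem_box_cart)

lemma measure_open_cube_below:
  fixes a :: "real ^ 'd"
  assumes "\<And>i. 0 \<le> a $ i"
  shows "measure lborel (box 0 1 \<inter> {..a}) = (\<Prod>i\<in>UNIV. min 1 (a $ i))"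
proof -
  define m :: "real ^ 'd" where "m = (\<chi> i. min 1 (a $ i))"
  have m: "0 \<le> m $ i" for i using assms by (simp add: m_def)
  have ne: "cbox 0 m \<noteq> {}" using m by (auto simp: interval_ne_empty_cart)
  have c: "measure lborel (cbox 0 m) = (\<Prod>i\<in>UNIV. min 1 (a $ i))"
    using content_cbox_cart[OF ne] by (simp add: m_def)
  have b: "measure lborel (box 0 m) = (\<Prod>i\<in>UNIV. min 1 (a $ i))"
    using c by (simp add: measure_lborel_box_eq measure_lborel_cbox_eq)
  have sub: "box 0 m \<subseteq> box 0 1 \<inter> {..a}" "box 0 1 \<inter> {..a} \<subseteq> cbox 0 m"
    by (auto simp: mem_box_cart m_def less_eq_vec_def less_imp_le)
  have "measure lborel (box 0 m) \<le> measure lborel (box 0 1 \<inter> {..a})"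
    by (rule measure_mono_fmeasurable[OF sub(1)]) (auto intro: fmeasurable_Int_fmeasurable)
  moreover have "measure lborel (box 0 1 \<inter> {..a}) \<le> measure lborel (cbox 0 m)"
    by (rule measure_mono_fmeasurable[OF sub(2)]) auto
  ultimately show ?thesis using b c by simp
qed

text \<open>Lower orthants form a \<open>\<pi>\<close>-system that generates the Borel sets.\<close>

theorem b_distribution: "distr M borel b = uniform_measure lborel {x. \<forall>i. 0 < x $ i \<and> x $ i < 1}"
  unfolding open_cube_eq_box
proof (rule measure_eqI_generator_eq[where E = "range (\<lambda>a :: real ^ 'd. {..a})" and \<Omega> = UNIV and A = "\<lambda>n. {..\<chi> i. real n}"])
  have one: "emeasure lborel (box 0 (1 :: real ^ 'd)) = 1"
  proof -
    have "box 0 (1 :: real ^ 'd) \<inter> {..1} = box 0 1"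
      by (auto simp: mem_box_cart less_eq_vec_def less_imp_le)
    then have "measure lborel (box 0 (1 :: real ^ 'd)) = 1"
      using measure_open_cube_below[of "1 :: real ^ 'd"] by simp
    moreover have "emeasure lborel (box 0 (1 :: real ^ 'd)) \<noteq> \<top>"
      using emeasure_lborel_box_finite[of 0 "1 :: real ^ 'd"] by simp
    ultimately show ?thesis by (simp add: emeasure_eq_ennreal_measure)
  qed
  show "Int_stable (range (\<lambda>a :: real ^ 'd. {..a}))"
  proof (rule Int_stableI_image)
    fix a a' :: "real ^ 'd"
    show "\<exists>k\<in>UNIV. {..a} \<inter> {..a'} = {..k}"
      by (intro bexI[of _ "\<chi> i. min (a $ i) (a' $ i)"]) (auto simp: less_eq_vec_def)
  qed
  show "emeasure (distr M borel b) X = emeasure (uniform_measure lborel (box 0 1)) X"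
    if X: "X \<in> range (\<lambda>a :: real ^ 'd. {..a})" for X
  proof -
    obtain a where a: "X = {..a}" using X by auto
    have "emeasure (distr M borel b) X = emeasure M {\<omega>\<in>space M. \<forall>i. b \<omega> $ i \<le> a $ i}"
      unfolding a by (subst emeasure_distr) (auto simp: less_eq_vec_def intro!: arg_cong[where f = "emeasure M"])
    also have "\<dots> = ennreal (measure lborel (box 0 1 \<inter> {..a}))"
    proof (cases "\<forall>i. 0 \<le> a $ i")
      case True
      have "{\<omega>\<in>space M. \<forall>i. b \<omega> $ i \<le> a $ i} = {\<omega>\<in>space M. \<forall>i. b \<omega> $ i \<le> min 1 (a $ i)}"
        using b_range by auto
      then have "prob {\<omega>\<in>space M. \<forall>i. b \<omega> $ i \<le> a $ i} = (\<Prod>i\<in>UNIV. min 1 (a $ i))"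
        using True b_joint_distribution[of "\<lambda>i. min 1 (a $ i)"] by simp
      then show ?thesis using True measure_open_cube_below[of a] by (simp add: emeasure_eq_measure)
    next
      case False
      then obtain i where i: "a $ i < 0" by (auto simp: not_le)
      have "{\<omega>\<in>space M. \<forall>i. b \<omega> $ i \<le> a $ i} = {}"
        using b_range(1)[of _ i] i by (auto simp: not_le intro: exI[of _ i] less_le_trans)
      moreover have "box 0 1 \<inter> {..a} = {}"
        using i by (auto simp: mem_box_cart less_eq_vec_def) (meson less_le_not_le order.trans less_imp_le)
      ultimately show ?thesis by (simp only: emeasure_empty measure_empty ennreal_0)
    qed
    also have "\<dots> = emeasure lborel (box 0 1 \<inter> {..a})"
    proof (rule emeasure_eq_ennreal_measure[symmetric])
      have "emeasure lborel (box 0 1 \<inter> {..a}) \<le> emeasure lborel (box 0 (1 :: real ^ 'd))"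
        by (intro emeasure_mono) auto
      then show "emeasure lborel (box 0 1 \<inter> {..a}) \<noteq> \<top>" unfolding one by (auto simp: top_unique)
    qed
    also have "\<dots> = emeasure (uniform_measure lborel (box 0 1)) X"
      unfolding a by (subst emeasure_uniform_measure) (auto simp: one divide_ennreal_def)
    finally show ?thesis .
  qed
  have borel: "sets (borel :: (real ^ 'd) measure) = sigma_sets UNIV (range (\<lambda>a. {..a}))"
    by (subst borel_eq_atMost) simp
  show "sets (distr M borel b) = sigma_sets UNIV (range (\<lambda>a. {..a}))" by (simp add: borel)
  show "sets (uniform_measure lborel (box 0 1)) = sigma_sets UNIV (range (\<lambda>a :: real ^ 'd. {..a}))" by (simp add: borel)
  show "(\<Union>n. {..(\<chi> i. real n) :: real ^ 'd}) = UNIV"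
  proof (intro set_eqI iffI UNIV_I)
    fix x :: "real ^ 'd"
    obtain n :: nat where n: "(\<Sum>i\<in>UNIV. \<bar>x $ i\<bar>) \<le> real n" using real_arch_simple by blast
    have "x $ i \<le> real n" for i
      using member_le_sum[of i UNIV "\<lambda>i. \<bar>x $ i\<bar>"] n by simp
    then show "x \<in> (\<Union>n. {..(\<chi> i. real n) :: real ^ 'd})" by (auto simp: less_eq_vec_def)
  qed
  show "emeasure (distr M borel b) {..\<chi> i. real n} \<noteq> \<infinity>" for n
    by (subst emeasure_distr) (auto simp: emeasure_eq_measure)
qed auto

lemma b_interior: "AE \<omega> in M. \<forall>i. 0 < b \<omega> $ i \<and> b \<omega> $ i < 1"
proof -
  have "AE x in uniform_measure lborel (box 0 (1 :: real ^ 'd)). x \<in> box 0 1"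
    by (rule AE_uniform_measureI) auto
  then have "AE x in distr M borel b. x \<in> box 0 1"
    by (simp only: b_distribution open_cube_eq_box)
  then have "AE \<omega> in M. b \<omega> \<in> box 0 1" by (rule AE_distrD[OF b_measurable])
  then show ?thesis by eventually_elim (auto simp: mem_box_cart)
qed

end

section \<open>Distances to random sets\<close>

lemma set_dist_singleton: "set_dist d {x} B = (INF y\<in>B. d x y)"
  by (simp add: set_dist_def)

lemma infnorm_le_sum: "infnorm (v :: real ^ 'n) \<le> (\<Sum>i\<in>UNIV. \<bar>v $ i\<bar>)"
  unfolding infnorm_cart by (rule cSup_least) (auto intro!: member_le_sum)

lemma uniform_dist_nonneg: "0 \<le> uniform_dist x y"
  by (simp add: uniform_dist_def infnorm_pos_le)

lemma uniform_dist_triangle: "uniform_dist x z \<le> uniform_dist x y + uniform_dist y z"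
  using infnorm_triangle[of "x - y" "y - z"] by (simp add: uniform_dist_def)

lemma uniform_dist_sym: "uniform_dist x y = uniform_dist y x"
  by (simp add: uniform_dist_def infnorm_sub)

lemma set_dist_less_iff:
  "B \<noteq> {} \<Longrightarrow> set_dist uniform_dist {x} B < r \<longleftrightarrow> (\<exists>y\<in>B. uniform_dist x y < r)"
  unfolding set_dist_singleton
  by (rule cINF_less_iff) (auto intro!: bdd_belowI[of _ 0] simp: uniform_dist_nonneg)

lemma set_dist_nonneg: "B \<noteq> {} \<Longrightarrow> 0 \<le> set_dist uniform_dist {x} B"
  unfolding set_dist_singleton by (rule cINF_greatest) (auto simp: uniform_dist_nonneg)

lemma set_dist_le: "y \<in> B \<Longrightarrow> set_dist uniform_dist {x} B \<le> uniform_dist x y"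
  unfolding set_dist_singleton
  by (rule cINF_lower) (auto intro!: bdd_belowI[of _ 0] simp: uniform_dist_nonneg)

lemma set_dist_triangle:
  assumes "B \<noteq> {}"
  shows "set_dist uniform_dist {x} B \<le> uniform_dist x y + set_dist uniform_dist {y} B"
proof (rule field_le_epsilon)
  fix e :: real assume "0 < e"
  then have "set_dist uniform_dist {y} B < set_dist uniform_dist {y} B + e" by simp
  then obtain z where z: "z \<in> B" "uniform_dist y z < set_dist uniform_dist {y} B + e"
    using set_dist_less_iff[OF assms] by blast
  have "set_dist uniform_dist {x} B \<le> uniform_dist x z" by (rule set_dist_le[OF z(1)])
  also have "\<dots> \<le> uniform_dist x y + uniform_dist y z" by (rule uniform_dist_triangle)
  finally show "set_dist uniform_dist {x} B \<le> uniform_dist x y + set_dist uniform_dist {y} B + e"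
    using z(2) by simp
qed

lemma uniform_dist_measurable [measurable (raw)]:
  fixes f g :: "'a \<Rightarrow> real ^ 'n"
  assumes [measurable]: "f \<in> borel_measurable N" "g \<in> borel_measurable N"
  shows "(\<lambda>x. uniform_dist (f x) (g x)) \<in> borel_measurable N"
proof -
  have "continuous_on UNIV (infnorm :: real ^ 'n \<Rightarrow> real)"
    unfolding continuous_on_def by (auto intro: tendsto_infnorm)
  then have "(infnorm :: real ^ 'n \<Rightarrow> real) \<in> borel_measurable borel"
    by (rule borel_measurable_continuous_onI)
  moreover have "(\<lambda>x. f x - g x) \<in> borel_measurable N" by measurable
  ultimately show ?thesis unfolding uniform_dist_def by (rule measurable_compose[rotated])
qed

text \<open>The distance to a set is \<open>1\<close>-Lipschitz, so its values at a random point are determined by those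
  on a countable dense set.\<close>

lemma set_dist_random_point_measurable:
  fixes Y :: "'a \<Rightarrow> real ^ 'n"
  assumes Y: "Y \<in> borel_measurable N" "\<And>\<omega>. \<omega> \<in> space N \<Longrightarrow> Y \<omega> \<in> unit_cube"
    and B: "\<And>\<omega>. \<omega> \<in> space N \<Longrightarrow> B \<omega> \<noteq> {}"
      "\<And>x. x \<in> unit_cube \<Longrightarrow> (\<lambda>\<omega>. set_dist uniform_dist {x} (B \<omega>)) \<in> borel_measurable N"
  shows "(\<lambda>\<omega>. set_dist uniform_dist {Y \<omega>} (B \<omega>)) \<in> borel_measurable N"
proof (rule borel_measurableI_less)
  fix r :: real
  obtain D :: "(real ^ 'n) set" where D: "countable D" "D \<subseteq> unit_cube" "unit_cube \<subseteq> closure D"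
    by (rule separable)
  have "{\<omega>\<in>space N. set_dist uniform_dist {Y \<omega>} (B \<omega>) < r} =
    (\<Union>q\<in>D. {\<omega>\<in>space N. uniform_dist (Y \<omega>) q + set_dist uniform_dist {q} (B \<omega>) < r})"
  proof (intro set_eqI iffI)
    fix \<omega> assume w: "\<omega> \<in> {\<omega>\<in>space N. set_dist uniform_dist {Y \<omega>} (B \<omega>) < r}"
    define e where "e = (r - set_dist uniform_dist {Y \<omega>} (B \<omega>)) / 2"
    have e: "0 < e" using w by (simp add: e_def)
    have "Y \<omega> \<in> closure D" using Y(2) D(3) w by auto
    then obtain q where q: "q \<in> D" "dist q (Y \<omega>) < e" using e by (auto simp: closure_approachable)
    have 1: "uniform_dist (Y \<omega>) q < e"
      using infnorm_le_norm[of "Y \<omega> - q"] q(2) by (simp add: uniform_dist_def dist_norm norm_minus_commute)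
    have "set_dist uniform_dist {q} (B \<omega>) \<le> uniform_dist q (Y \<omega>) + set_dist uniform_dist {Y \<omega>} (B \<omega>)"
      using B(1) w by (intro set_dist_triangle) auto
    then have "uniform_dist (Y \<omega>) q + set_dist uniform_dist {q} (B \<omega>) < r"
      using 1 uniform_dist_sym[of q "Y \<omega>"] unfolding e_def by argo
    then show "\<omega> \<in> (\<Union>q\<in>D. {\<omega>\<in>space N. uniform_dist (Y \<omega>) q + set_dist uniform_dist {q} (B \<omega>) < r})"
      using q(1) w by auto
  next
    fix \<omega> assume "\<omega> \<in> (\<Union>q\<in>D. {\<omega>\<in>space N. uniform_dist (Y \<omega>) q + set_dist uniform_dist {q} (B \<omega>) < r})"
    then obtain q where w: "\<omega> \<in> space N" and q: "uniform_dist (Y \<omega>) q + set_dist uniform_dist {q} (B \<omega>) < r" by auto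
    then show "\<omega> \<in> {\<omega>\<in>space N. set_dist uniform_dist {Y \<omega>} (B \<omega>) < r}"
      using set_dist_triangle[OF B(1)[OF w], of "Y \<omega>" q] by simp
  qed
  also have "\<dots> \<in> sets N"
  proof (rule sets.countable_UN''[OF D(1)])
    fix q assume "q \<in> D"
    then have [measurable]: "(\<lambda>\<omega>. set_dist uniform_dist {q} (B \<omega>)) \<in> borel_measurable N" using B(2) D(2) by auto
    note [measurable] = Y(1)
    show "{\<omega>\<in>space N. uniform_dist (Y \<omega>) q + set_dist uniform_dist {q} (B \<omega>) < r} \<in> sets N" by measurable
  qed
  finally show "{\<omega>\<in>space N. set_dist uniform_dist {Y \<omega>} (B \<omega>) < r} \<in> sets N" .
qed

lemma (in prob_space) AE_tendsto_0_imp_prob: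
  fixes X :: "nat \<Rightarrow> 'a \<Rightarrow> real"
  assumes [measurable]: "\<And>n. X n \<in> borel_measurable M" and lim: "AE \<omega> in M. (\<lambda>n. X n \<omega>) \<longlonglongrightarrow> 0" and e: "0 < e"
  shows "(\<lambda>n. prob {\<omega>\<in>space M. \<bar>X n \<omega>\<bar> > e}) \<longlonglongrightarrow> 0"
proof -
  have "(\<lambda>n. \<integral>\<omega>. indicator {\<omega>\<in>space M. \<bar>X n \<omega>\<bar> > e} \<omega> \<partial>M) \<longlonglongrightarrow> (\<integral>\<omega>. (0::real) \<partial>M)"
  proof (rule integral_dominated_convergence[where w = "\<lambda>_. 1"])
    show "AE \<omega> in M. (\<lambda>n. indicator {\<omega>\<in>space M. \<bar>X n \<omega>\<bar> > e} \<omega> :: real) \<longlonglongrightarrow> 0"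
      using lim
    proof eventually_elim
      case (elim \<omega>)
      have "\<forall>\<^sub>F n in sequentially. dist (X n \<omega>) 0 < e" by (rule tendstoD[OF elim e])
      then have "\<forall>\<^sub>F n in sequentially. indicator {\<omega>\<in>space M. \<bar>X n \<omega>\<bar> > e} \<omega> = (0 :: real)"
        by eventually_elim auto
      then show ?case by (rule tendsto_eventually)
    qed
  qed auto
  then show ?thesis by (simp add: less_top[symmetric])
qed

section \<open>Separation along the flow\<close>

lemma square_le_separation:
  assumes "0 < x" "x < 1" "0 < y" "y < 1"
  shows "(x - y)\<^sup>2 \<le> separation x y"
proof -
  have p: "0 < x * (1 - x) * (y * (1 - y))" using assms by simp
  have "x * (1 - x) * (y * (1 - y)) \<le> 1 * 1"
    using assms logistic_bounds[of x] logistic_bounds[of y] by (intro mult_mono) auto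
  then have "(x - y)\<^sup>2 * (x * (1 - x) * (y * (1 - y))) \<le> (x - y)\<^sup>2 * 1" by (intro mult_left_mono) auto
  then show ?thesis unfolding separation_def using p by (simp add: pos_le_divide_eq)
qed

lemma separation_nonneg:
  assumes "0 < x" "x < 1" "0 < y" "y < 1"
  shows "0 \<le> separation x y"
  using square_le_separation[OF assms] zero_le_power2[of "x - y"] by linarith

context logistic_flow
begin

lemma separation_mono_rational:
  "AE \<omega> in M. \<forall>i. \<forall>x y s t :: rat. 0 < real_of_rat x \<and> real_of_rat x < 1 \<and> 0 < real_of_rat y \<and> real_of_rat y < 1 \<and>
     0 \<le> real_of_rat s \<and> real_of_rat s \<le> real_of_rat t \<longrightarrow>
     separation (\<phi>c i (real_of_rat s) \<omega> (real_of_rat x)) (\<phi>c i (real_of_rat s) \<omega> (real_of_rat y)) \<le>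
     separation (\<phi>c i (real_of_rat t) \<omega> (real_of_rat x)) (\<phi>c i (real_of_rat t) \<omega> (real_of_rat y))"
proof (rule eventually_all_finite, unfold AE_all_countable, intro allI)
  fix i and x y s t :: rat
  define X where "X c t \<omega> = \<phi> t \<omega> (\<chi> j. c) $ i" for c t \<omega>
  show "AE \<omega> in M. 0 < real_of_rat x \<and> real_of_rat x < 1 \<and> 0 < real_of_rat y \<and> real_of_rat y < 1 \<and>
     0 \<le> real_of_rat s \<and> real_of_rat s \<le> real_of_rat t \<longrightarrow>
     separation (\<phi>c i (real_of_rat s) \<omega> (real_of_rat x)) (\<phi>c i (real_of_rat s) \<omega> (real_of_rat y)) \<le>
     separation (\<phi>c i (real_of_rat t) \<omega> (real_of_rat x)) (\<phi>c i (real_of_rat t) \<omega> (real_of_rat y))"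
  proof (cases "0 < real_of_rat x \<and> real_of_rat x < 1 \<and> 0 < real_of_rat y \<and> real_of_rat y < 1 \<and>
     0 \<le> real_of_rat s \<and> real_of_rat s \<le> real_of_rat t")
    case True
    define x' y' s' t' where "x' = real_of_rat x" "y' = real_of_rat y" "s' = real_of_rat s" "t' = real_of_rat t"
    have r: "0 < x'" "x' < 1" "0 < y'" "y' < 1" "0 \<le> s'" "s' \<le> t'"
      using True by (auto simp: x'_y'_s'_t'_def)
    have v: "X x' u \<omega> = \<phi>c i u \<omega> x'" "X y' u \<omega> = \<phi>c i u \<omega> y'" if "\<omega> \<in> space M" for u \<omega>
      unfolding X_def using flow_vec[OF that] r by auto
    have "AE \<omega> in M. separation (X x' s' \<omega>) (X y' s' \<omega>) \<le> separation (X x' t' \<omega>) (X y' t' \<omega>)"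
    proof (rule separation_solutions_mono)
      show "logistic_solution i x' (X x')" "logistic_solution i y' (X y')"
        unfolding X_def using r by (auto intro!: flow_solution)
      show "0 < X x' u \<omega> \<and> X x' u \<omega> < 1" "0 < X y' u \<omega> \<and> X y' u \<omega> < 1" if "\<omega> \<in> space M" for u \<omega>
        using coordinate_interior[OF that] r v[OF that] by auto
    qed (use r in auto)
    then show ?thesis
      using AE_space by eventually_elim (use v in \<open>auto simp: x'_y'_s'_t'_def\<close>)
  next
    case False
    then show ?thesis by (intro AE_I2) blast
  qed
qed

text \<open>By continuity in time and space one null set serves for all times and all starting points, which
  is needed because the random point \<open>b\<close> will be one of them.\<close>

lemma separation_mono_forward:
  "AE \<omega> in M. \<forall>i x y s t. 0 < x \<and> x < 1 \<and> 0 < y \<and> y < 1 \<and> 0 \<le> s \<and> s \<le> t \<longrightarrow>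
     separation (\<phi>c i s \<omega> x) (\<phi>c i s \<omega> y) \<le> separation (\<phi>c i t \<omega> x) (\<phi>c i t \<omega> y)"
  using separation_mono_rational AE_space
proof eventually_elim
  case (elim \<omega>)
  show ?case
  proof (intro allI impI)
    fix i and x y s t :: real assume *: "0 < x \<and> x < 1 \<and> 0 < y \<and> y < 1 \<and> 0 \<le> s \<and> s \<le> t"
    have lim: "(\<lambda>n. \<phi>c i (dyadic n u) \<omega> (dyadic n c)) \<longlonglongrightarrow> \<phi>c i u \<omega> c" if c: "0 < c" "c < 1" for u c
    proof -
      have ev: "\<forall>\<^sub>F n in sequentially. dyadic n c \<in> {0..1}"
      proof -
        have "\<forall>\<^sub>F n in sequentially. 0 < dyadic n c" by (rule order_tendstoD(1)[OF dyadic_tendsto c(1)])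
        moreover have "\<forall>\<^sub>F n in sequentially. dyadic n c < 1" by (rule order_tendstoD(2)[OF dyadic_tendsto c(2)])
        ultimately show ?thesis by eventually_elim auto
      qed
      have "(\<lambda>n. (\<lambda>(t, c). \<phi>c i t \<omega> c) (dyadic n u, dyadic n c)) \<longlonglongrightarrow> (\<lambda>(t, c). \<phi>c i t \<omega> c) (u, c)"
      proof (rule continuous_on_tendsto_compose[OF coordinate_continuous[OF elim(2)]])
        show "(\<lambda>n. (dyadic n u, dyadic n c)) \<longlonglongrightarrow> (u, c)" by (intro tendsto_Pair dyadic_tendsto)
        show "\<forall>\<^sub>F n in sequentially. (dyadic n u, dyadic n c) \<in> UNIV \<times> {0..1}"
          using ev by eventually_elim auto
      qed (use c in auto)
      then show ?thesis by simp
    qed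
    have sep: "(\<lambda>n. separation (\<phi>c i (dyadic n u) \<omega> (dyadic n x)) (\<phi>c i (dyadic n u) \<omega> (dyadic n y))) \<longlonglongrightarrow>
       separation (\<phi>c i u \<omega> x) (\<phi>c i u \<omega> y)" for u
    proof -
      have "\<phi>c i u \<omega> x * (1 - \<phi>c i u \<omega> x) * (\<phi>c i u \<omega> y * (1 - \<phi>c i u \<omega> y)) \<noteq> 0"
        using coordinate_interior[OF elim(2), of x i u] coordinate_interior[OF elim(2), of y i u] * by auto
      then show ?thesis unfolding separation_def using * by (intro tendsto_intros lim) auto
    qed
    show "separation (\<phi>c i s \<omega> x) (\<phi>c i s \<omega> y) \<le> separation (\<phi>c i t \<omega> x) (\<phi>c i t \<omega> y)"
    proof (rule tendsto_le[OF _ sep sep])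
      have "\<forall>\<^sub>F n in sequentially. 0 < dyadic n x" "\<forall>\<^sub>F n in sequentially. dyadic n x < 1"
        "\<forall>\<^sub>F n in sequentially. 0 < dyadic n y" "\<forall>\<^sub>F n in sequentially. dyadic n y < 1"
        using * by (auto intro!: order_tendstoD[OF dyadic_tendsto])
      then show "\<forall>\<^sub>F n in sequentially. separation (\<phi>c i (dyadic n s) \<omega> (dyadic n x)) (\<phi>c i (dyadic n s) \<omega> (dyadic n y)) \<le>
        separation (\<phi>c i (dyadic n t) \<omega> (dyadic n x)) (\<phi>c i (dyadic n t) \<omega> (dyadic n y))"
      proof eventually_elim
        case e: (elim n)
        obtain p q u v where pq: "dyadic n x = of_rat p" "dyadic n y = of_rat q" "dyadic n s = of_rat u" "dyadic n t = of_rat v"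
          using dyadic_rat by metis
        have "0 < real_of_rat p \<and> real_of_rat p < 1 \<and> 0 < real_of_rat q \<and> real_of_rat q < 1 \<and> 0 \<le> real_of_rat u \<and> real_of_rat u \<le> real_of_rat v"
          using e * dyadic_nonneg[of s n] dyadic_mono[of s t n] unfolding pq by auto
        then show ?case using elim(1) unfolding pq by blast
      qed
    qed simp
  qed
qed

text \<open>A time interval that begins before \<open>0\<close> is seen from a time \<open>- n\<close> further back, where the previous
  lemma applies; countably many \<open>n\<close> suffice.\<close>

lemma separation_mono:
  "AE \<omega> in M. \<forall>i x y s t. 0 < x \<and> x < 1 \<and> 0 < y \<and> y < 1 \<and> s \<le> t \<longrightarrow>
     separation (\<phi>c i s \<omega> x) (\<phi>c i s \<omega> y) \<le> separation (\<phi>c i t \<omega> x) (\<phi>c i t \<omega> y)"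
proof -
  have "AE \<omega> in M. \<forall>n::nat. \<forall>i x y s t. 0 < x \<and> x < 1 \<and> 0 < y \<and> y < 1 \<and> 0 \<le> s \<and> s \<le> t \<longrightarrow>
     separation (\<phi>c i s (\<theta> (- real n) \<omega>) x) (\<phi>c i s (\<theta> (- real n) \<omega>) y) \<le>
     separation (\<phi>c i t (\<theta> (- real n) \<omega>) x) (\<phi>c i t (\<theta> (- real n) \<omega>) y)"
    by (subst AE_all_countable) (intro allI AE_shift[OF separation_mono_forward])
  then show ?thesis
    using AE_space
  proof eventually_elim
    case (elim \<omega>)
    show ?case
    proof (intro allI impI)
      fix i and x y s t :: real assume *: "0 < x \<and> x < 1 \<and> 0 < y \<and> y < 1 \<and> s \<le> t"
      obtain n :: nat where n: "- s \<le> real n" using real_arch_simple by blast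
      have split: "\<phi>c i u \<omega> c = \<phi>c i (u + real n) (\<theta> (- real n) \<omega>) (\<phi>c i (- real n) \<omega> c)" if "0 < c" "c < 1" for u c
        using coordinate_add[OF elim(2), of c i "u + real n" "- real n"] that by simp
      have "0 < \<phi>c i (- real n) \<omega> x \<and> \<phi>c i (- real n) \<omega> x < 1" "0 < \<phi>c i (- real n) \<omega> y \<and> \<phi>c i (- real n) \<omega> y < 1"
        using coordinate_interior[OF elim(2)] * by auto
      moreover have "0 \<le> s + real n" "s + real n \<le> t + real n" using n * by auto
      ultimately have "separation (\<phi>c i (s + real n) (\<theta> (- real n) \<omega>) (\<phi>c i (- real n) \<omega> x)) (\<phi>c i (s + real n) (\<theta> (- real n) \<omega>) (\<phi>c i (- real n) \<omega> y)) \<le>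
        separation (\<phi>c i (t + real n) (\<theta> (- real n) \<omega>) (\<phi>c i (- real n) \<omega> x)) (\<phi>c i (t + real n) (\<theta> (- real n) \<omega>) (\<phi>c i (- real n) \<omega> y))"
        using elim(1) by blast
      moreover have "0 < x" "x < 1" "0 < y" "y < 1" using * by auto
      ultimately show "separation (\<phi>c i s \<omega> x) (\<phi>c i s \<omega> y) \<le> separation (\<phi>c i t \<omega> x) (\<phi>c i t \<omega> y)"
        by (simp only: split[of x s] split[of y s] split[of x t] split[of y t])
    qed
  qed
qed

section \<open>Pullback and forward convergence of the inverse flow\<close>

lemma rational_dichotomy:
  "AE \<omega> in M. \<forall>i. \<forall>q::rat. 0 \<le> real_of_rat q \<and> real_of_rat q \<le> 1 \<longrightarrow>
     of_rat q \<in> basin i \<omega> \<or> ((\<lambda>t. \<phi>c i t \<omega> (of_rat q)) \<longlongrightarrow> 1) at_top"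
proof (rule eventually_all_finite, unfold AE_all_countable, intro allI)
  fix i and q :: rat
  show "AE \<omega> in M. 0 \<le> real_of_rat q \<and> real_of_rat q \<le> 1 \<longrightarrow>
     of_rat q \<in> basin i \<omega> \<or> ((\<lambda>t. \<phi>c i t \<omega> (of_rat q)) \<longlongrightarrow> 1) at_top"
  proof (cases "0 \<le> real_of_rat q \<and> real_of_rat q \<le> 1")
    case True
    define c where "c = real_of_rat q"
    have c: "0 \<le> c" "c \<le> 1" using True by (auto simp: c_def)
    obtain L where "AE \<omega> in M. ((\<lambda>t. \<phi> t \<omega> (\<chi> j. c) $ i) \<longlongrightarrow> L \<omega>) at_top \<and> (L \<omega> = 0 \<or> L \<omega> = 1)"
      by (rule solution_limit[OF flow_solution[OF c, of i]])
    then have "AE \<omega> in M. c \<in> basin i \<omega> \<or> ((\<lambda>t. \<phi>c i t \<omega> c) \<longlongrightarrow> 1) at_top"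
      using AE_space by eventually_elim (use c in \<open>auto simp: flow_vec basin_def\<close>)
    then show ?thesis unfolding c_def by eventually_elim auto
  qed auto
qed

lemma above_b_tendsto_1:
  "AE \<omega> in M. \<forall>i c. b \<omega> $ i < c \<and> c \<le> 1 \<longrightarrow> ((\<lambda>t. \<phi>c i t \<omega> c) \<longlongrightarrow> 1) at_top"
  using rational_dichotomy AE_space
proof eventually_elim
  case (elim \<omega>)
  show ?case
  proof (intro allI impI)
    fix i c assume c: "b \<omega> $ i < c \<and> c \<le> 1"
    obtain q where q: "b \<omega> $ i < real_of_rat q" "real_of_rat q < c" using of_rat_dense[of "b \<omega> $ i" c] c by auto
    have q0: "0 \<le> real_of_rat q" "real_of_rat q \<le> 1" using q c b_range(1)[OF elim(2), of i] by linarith+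
    have "real_of_rat q \<notin> basin i \<omega>" by (rule above_b_not_in_basin[OF q(1)])
    then have lim: "((\<lambda>t. \<phi>c i t \<omega> (of_rat q)) \<longlongrightarrow> 1) at_top" using elim(1) q0 by blast
    show "((\<lambda>t. \<phi>c i t \<omega> c) \<longlongrightarrow> 1) at_top"
    proof (rule tendsto_sandwich[OF _ _ lim tendsto_const])
      show "\<forall>\<^sub>F t in at_top. \<phi>c i t \<omega> (of_rat q) \<le> \<phi>c i t \<omega> c" "\<forall>\<^sub>F t in at_top. \<phi>c i t \<omega> c \<le> 1"
        using coordinate_le[OF elim(2) q0(1), of c i] coordinate_range(2)[OF elim(2), of c i] q q0 c by auto
    qed
  qed
qed

text \<open>The inverse of \<open>\<phi> t\<close> maps an interior point close to \<open>b\<close>, because \<open>\<phi> t\<close> moves everything below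
  \<open>b\<close> to \<open>0\<close> and everything above to \<open>1\<close>.\<close>

lemma pullback_to_b:
  "AE \<omega> in M. \<forall>i x. 0 < x \<and> x < 1 \<longrightarrow> ((\<lambda>t. \<phi>c i (- t) (\<theta> t \<omega>) x) \<longlongrightarrow> b \<omega> $ i) at_top"
  using above_b_tendsto_1 AE_space
proof eventually_elim
  case (elim \<omega>)
  show ?case
  proof (intro allI impI)
    fix i and x :: real assume x: "0 < x \<and> x < 1"
    define z where "z t = \<phi>c i (- t) (\<theta> t \<omega>) x" for t
    have z: "0 \<le> z t" "z t \<le> 1" "\<phi>c i t \<omega> (z t) = x" for t
      unfolding z_def using coordinate_range[OF shift_space[OF elim(2)]] coordinate_inverse[OF elim(2)] x by auto
    have "(z \<longlongrightarrow> b \<omega> $ i) at_top"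
    proof (rule order_tendstoI)
      fix a assume a: "a < b \<omega> $ i"
      show "\<forall>\<^sub>F t in at_top. a < z t"
      proof (cases "a < 0")
        case True
        then show ?thesis using z(1) by (auto intro!: always_eventually intro: less_le_trans)
      next
        case False
        then have "a \<in> basin i \<omega>" using a by (intro below_b_in_basin[OF elim(2)]) auto
        then have a1: "a \<le> 1" "((\<lambda>t. \<phi>c i t \<omega> a) \<longlongrightarrow> 0) at_top" by (auto simp: basin_def)
        have "\<forall>\<^sub>F t in at_top. \<phi>c i t \<omega> a < x" using order_tendstoD(2)[OF a1(2)] x by auto
        then show ?thesis
        proof eventually_elim
          case (elim t)
          show ?case
          proof (rule ccontr)
            assume "\<not> a < z t"
            then have "\<phi>c i t \<omega> (z t) \<le> \<phi>c i t \<omega> a"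
              using coordinate_le[OF \<open>\<omega> \<in> space M\<close> z(1), of t a i t] a1(1) by simp
            then show False using elim z(3)[of t] by simp
          qed
        qed
      qed
    next
      fix a assume a: "b \<omega> $ i < a"
      show "\<forall>\<^sub>F t in at_top. z t < a"
      proof (cases "1 < a")
        case True
        then show ?thesis using z(2) by (auto intro!: always_eventually intro: le_less_trans)
      next
        case False
        then have "((\<lambda>t. \<phi>c i t \<omega> a) \<longlongrightarrow> 1) at_top" using elim(1) a by simp
        then have "\<forall>\<^sub>F t in at_top. x < \<phi>c i t \<omega> a" using order_tendstoD(1) x by blast
        then show ?thesis
        proof eventually_elim
          case (elim t)
          show ?case
          proof (rule ccontr)
            assume "\<not> z t < a"
            then have "\<phi>c i t \<omega> a \<le> \<phi>c i t \<omega> (z t)"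
              using coordinate_le[OF \<open>\<omega> \<in> space M\<close>, of a "z t" i t] z(2)[of t] a b_range(1)[OF \<open>\<omega> \<in> space M\<close>, of i] by simp
            then show False using elim z(3)[of t] by simp
          qed
        qed
      qed
    qed
    then show "((\<lambda>t. \<phi>c i (- t) (\<theta> t \<omega>) x) \<longlongrightarrow> b \<omega> $ i) at_top" by (simp add: z_def[abs_def])
  qed
qed

text \<open>Along the inverse flow the separation from \<open>b\<close> decreases. In distribution it equals its
  pullback version, which tends to \<open>0\<close>; a monotone function that tends to \<open>0\<close> in probability tends to
  \<open>0\<close> almost surely.\<close>

lemma forward_to_b:
  assumes x: "0 < x" "x < 1"
  shows "AE \<omega> in M. ((\<lambda>t. \<phi>c i (- t) \<omega> x - b (\<theta> (- t) \<omega>) $ i) \<longlongrightarrow> 0) at_top"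
proof -
  define D where "D t \<omega> = separation (\<phi>c i (- t) \<omega> x) (b (\<theta> (- t) \<omega>) $ i)" for t \<omega>
  have Dm [measurable]: "D t \<in> borel_measurable M" for t
  proof -
    have [measurable]: "(\<lambda>\<omega>. \<phi>c i (- t) \<omega> x) \<in> borel_measurable M" using x by (intro coordinate_measurable) auto
    have [measurable]: "(\<lambda>\<omega>. b (\<theta> (- t) \<omega>) $ i) \<in> borel_measurable M"
      by (rule measurable_compose[OF shift_measurable b_coordinate_measurable])
    show ?thesis unfolding D_def separation_def by measurable
  qed
  have pull: "AE \<omega> in M. (\<lambda>n::nat. D (real n) (\<theta> (real n) \<omega>)) \<longlonglongrightarrow> 0"
    using pullback_to_b b_interior AE_space
  proof eventually_elim
    case (elim \<omega>)
    have lim: "((\<lambda>t. \<phi>c i (- t) (\<theta> t \<omega>) x) \<longlongrightarrow> b \<omega> $ i) at_top" using elim(1) x by blast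
    have "((\<lambda>t. separation (\<phi>c i (- t) (\<theta> t \<omega>) x) (b \<omega> $ i)) \<longlongrightarrow> separation (b \<omega> $ i) (b \<omega> $ i)) at_top"
    proof -
      have "0 < b \<omega> $ i" "b \<omega> $ i < 1" using elim(2) by auto
      then have "b \<omega> $ i * (1 - b \<omega> $ i) * (b \<omega> $ i * (1 - b \<omega> $ i)) \<noteq> 0" by simp
      then show ?thesis unfolding separation_def by (intro tendsto_intros lim)
    qed
    moreover have "D t (\<theta> t \<omega>) = separation (\<phi>c i (- t) (\<theta> t \<omega>) x) (b \<omega> $ i)" for t
      unfolding D_def by (simp add: shift_add[OF elim(3)] shift_0[OF elim(3)])
    ultimately have "((\<lambda>t. D t (\<theta> t \<omega>)) \<longlongrightarrow> 0) at_top" by (simp add: separation_def)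
    then show ?case by (rule filterlim_compose[OF _ filterlim_real_sequentially])
  qed
  have small: "AE \<omega> in M. \<exists>n::nat. D (real n) \<omega> \<le> e" if e: "0 < e" for e
  proof -
    have "(\<lambda>n. prob {\<omega>\<in>space M. \<bar>D (real n) (\<theta> (real n) \<omega>)\<bar> > e}) \<longlonglongrightarrow> 0"
      by (rule AE_tendsto_0_imp_prob[OF _ pull e]) measurable
    moreover have "prob {\<omega>\<in>space M. \<bar>D (real n) (\<theta> (real n) \<omega>)\<bar> > e} = prob {\<omega>\<in>space M. \<bar>D (real n) \<omega>\<bar> > e}" for n
      by (rule prob_shift[where P = "\<lambda>\<omega>. \<bar>D (real n) \<omega>\<bar> > e"]) measurable
    ultimately have lim: "(\<lambda>n. prob {\<omega>\<in>space M. \<bar>D (real n) \<omega>\<bar> > e}) \<longlonglongrightarrow> 0" by simp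
    \<comment> \<open>The event that \<open>D\<close> does not fall below \<open>e\<close> is contained in events of arbitrarily small probability.\<close>
    define E where "E = {\<omega>\<in>space M. \<forall>n::nat. D (real n) \<omega> > e}"
    have [measurable]: "E \<in> sets M" unfolding E_def by measurable
    have "prob E \<le> prob {\<omega>\<in>space M. \<bar>D (real n) \<omega>\<bar> > e}" for n
      by (intro finite_measure_mono) (auto simp: E_def intro: less_le_trans[OF _ abs_ge_self])
    then have "prob E \<le> 0" by (intro LIMSEQ_le_const[OF lim]) auto
    then have "prob E = 0" using measure_nonneg[of M E] by linarith
    then have "E \<in> null_sets M" by (intro null_setsI) (auto simp: emeasure_eq_measure)
    then have "AE \<omega> in M. \<omega> \<notin> E" by (rule AE_not_in)
    then show ?thesis using AE_space by eventually_elim (auto simp: E_def not_less)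
  qed
  have "AE \<omega> in M. \<forall>m::nat. \<exists>n::nat. D (real n) \<omega> \<le> 1 / real (Suc m)"
    unfolding AE_all_countable by (intro allI small) simp
  then show ?thesis
    using separation_mono b_interior AE_space
  proof eventually_elim
    case (elim \<omega>)
    have w: "\<omega> \<in> space M" by (rule elim(4))
    have bi: "0 < b \<omega> $ i" "b \<omega> $ i < 1" using elim(3) by auto
    have Deq: "D t \<omega> = separation (\<phi>c i (- t) \<omega> x) (\<phi>c i (- t) \<omega> (b \<omega> $ i))" for t
      unfolding D_def by (simp add: b_equivariant[OF w])
    have mono: "D t \<omega> \<le> D s \<omega>" if "s \<le> t" for s t
      unfolding Deq using elim(2) x bi that by simp
    have int: "0 < \<phi>c i (- t) \<omega> x" "\<phi>c i (- t) \<omega> x < 1" "0 < \<phi>c i (- t) \<omega> (b \<omega> $ i)" "\<phi>c i (- t) \<omega> (b \<omega> $ i) < 1" for t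
      using coordinate_interior[OF w] x bi by auto
    have D0: "0 \<le> D t \<omega>" for t unfolding Deq by (rule separation_nonneg[OF int])
    have lim: "((\<lambda>t. D t \<omega>) \<longlongrightarrow> 0) at_top"
    proof (rule tendstoI)
      fix e :: real assume "0 < e"
      then obtain m :: nat where m: "1 / real (Suc m) < e" by (metis nat_approx_posE)
      obtain n :: nat where n: "D (real n) \<omega> \<le> 1 / real (Suc m)" using elim(1) by blast
      have "dist (D t \<omega>) 0 < e" if "real n \<le> t" for t
        using mono[OF that] n m D0[of t] by simp
      then show "\<forall>\<^sub>F t in at_top. dist (D t \<omega>) 0 < e" by (auto simp: eventually_at_top_linorder)
    qed
    have "((\<lambda>t. sqrt (D t \<omega>)) \<longlongrightarrow> sqrt 0) at_top" by (intro tendsto_intros lim)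
    then have s: "((\<lambda>t. sqrt (D t \<omega>)) \<longlongrightarrow> 0) at_top" by simp
    have "\<bar>\<phi>c i (- t) \<omega> x - b (\<theta> (- t) \<omega>) $ i\<bar> \<le> sqrt (D t \<omega>)" for t
      using square_le_separation[OF int, of t] unfolding Deq b_equivariant[OF w]
      by (intro real_le_rsqrt) simp
    then show ?case by (intro Lim_null_comparison[OF _ s]) (auto intro!: always_eventually)
  qed
qed

section \<open>The attractor\<close>

definition att :: "(real \<Rightarrow> real ^ 'd) \<Rightarrow> (real ^ 'd) set" where
  "att \<omega> = {face_proj \<alpha> (b \<omega>) | \<alpha>. \<forall>i. \<alpha> $ i \<in> {-1, 0, 1}}"

lemma att_eq: "att \<omega> = {y. \<forall>i. y $ i \<in> {0, b \<omega> $ i, 1}}"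
proof (intro set_eqI iffI)
  fix y assume y: "y \<in> {y. \<forall>i. y $ i \<in> {0, b \<omega> $ i, 1}}"
  define \<alpha> :: "int ^ 'd" where "\<alpha> = (\<chi> i. if y $ i = b \<omega> $ i then 0 else if y $ i = 0 then -1 else 1)"
  have "face_proj \<alpha> (b \<omega>) = y" using y by (auto simp: face_proj_def \<alpha>_def vec_eq_iff)
  moreover have "\<forall>i. \<alpha> $ i \<in> {-1, 0, 1}" by (simp add: \<alpha>_def)
  ultimately show "y \<in> att \<omega>" unfolding att_def by blast
next
  fix y assume "y \<in> att \<omega>"
  then obtain \<alpha> where \<alpha>: "y = face_proj \<alpha> (b \<omega>)" "\<forall>i. \<alpha> $ i \<in> {-1, 0, 1}" by (auto simp: att_def)
  have "y $ i \<in> {0, b \<omega> $ i, 1}" for i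
    using spec[OF \<alpha>(2), of i] unfolding \<alpha>(1) by (auto simp: face_proj_def)
  then show "y \<in> {y. \<forall>i. y $ i \<in> {0, b \<omega> $ i, 1}}" by simp
qed

lemma finite_vec_product:
  assumes "\<And>i. finite (F i)"
  shows "finite {y :: 'c ^ 'd. \<forall>i. y $ i \<in> F i}"
proof (rule finite_subset)
  show "{y :: 'c ^ 'd. \<forall>i. y $ i \<in> F i} \<subseteq> vec_lambda ` (PiE UNIV F)"
  proof
    fix y :: "'c ^ 'd" assume "y \<in> {y. \<forall>i. y $ i \<in> F i}"
    then have "vec_nth y \<in> PiE UNIV F" by auto
    then show "y \<in> vec_lambda ` (PiE UNIV F)" by (intro image_eqI[of _ _ "vec_nth y"]) (simp_all add: vec_nth_inverse)
  qed
  show "finite (vec_lambda ` (PiE UNIV F) :: ('c ^ 'd) set)" using assms by (intro finite_imageI finite_PiE) auto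
qed

lemma face_proj_b_measurable [measurable]: "(\<lambda>\<omega>. face_proj \<alpha> (b \<omega>)) \<in> borel_measurable M"
proof (rule borel_measurable_vecI)
  fix i
  show "(\<lambda>\<omega>. face_proj \<alpha> (b \<omega>) $ i) \<in> borel_measurable M"
    using b_coordinate_measurable[of i] by (cases "\<alpha> $ i = 0") (auto simp: face_proj_def)
qed

lemma att_nonempty: "att \<omega> \<noteq> {}"
  unfolding att_eq by (auto intro!: exI[of _ "\<chi> i. 0"])

lemma att_subset_cube: "\<omega> \<in> space M \<Longrightarrow> att \<omega> \<subseteq> unit_cube"
proof
  fix y assume w: "\<omega> \<in> space M" and "y \<in> att \<omega>"
  then have "y $ i = 0 \<or> y $ i = b \<omega> $ i \<or> y $ i = 1" for i by (auto simp: att_eq)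
  then have "0 \<le> y $ i \<and> y $ i \<le> 1" for i using b_range[OF w, of i] by (metis order_refl zero_le_one)
  then show "y \<in> unit_cube" by (simp add: unit_cube_def)
qed

lemma compact_random_set_att: "compact_random_set M unit_cube uniform_dist att"
  unfolding compact_random_set_def
proof (intro conjI ballI)
  fix \<omega> assume w: "\<omega> \<in> space M"
  show "att \<omega> \<noteq> {}" by (rule att_nonempty)
  have "finite (att \<omega>)" unfolding att_eq by (rule finite_vec_product) simp
  then show "compactin cube.mtopology (att \<omega>)"
    using att_subset_cube[OF w] by (intro finite_imp_compactin) auto
next
  fix x :: "real ^ 'd"
  show "(\<lambda>\<omega>. set_dist uniform_dist {x} (att \<omega>)) \<in> borel_measurable M"
  proof (rule borel_measurableI_less)
    fix r
    have "finite {\<alpha> :: int ^ 'd. \<forall>i. \<alpha> $ i \<in> {-1, 0, 1}}" by (rule finite_vec_product) simp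
    then have "(\<Union>\<alpha>\<in>{\<alpha>. \<forall>i. \<alpha> $ i \<in> {-1, 0, 1}}. {\<omega>\<in>space M. uniform_dist x (face_proj \<alpha> (b \<omega>)) < r}) \<in> sets M"
      by (intro sets.finite_UN) auto
    also have "(\<Union>\<alpha>\<in>{\<alpha>. \<forall>i. \<alpha> $ i \<in> {-1, 0, 1}}. {\<omega>\<in>space M. uniform_dist x (face_proj \<alpha> (b \<omega>)) < r}) =
      {\<omega>\<in>space M. set_dist uniform_dist {x} (att \<omega>) < r}"
      unfolding set_dist_less_iff[OF att_nonempty] by (auto simp: att_def)
    finally show "{\<omega>\<in>space M. set_dist uniform_dist {x} (att \<omega>) < r} \<in> sets M" .
  qed
qed

abbreviation "\<phi>bar \<equiv> inverse_flow \<theta> unit_cube \<phi>"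

abbreviation "\<theta>bar \<equiv> (\<lambda>t. \<theta> (- t))"

abbreviation "point_attractor Q \<equiv> Q M \<theta>bar unit_cube uniform_dist \<phi>bar (singletons unit_cube)"

text \<open>Invariance holds because the coordinate flows fix \<open>0\<close> and \<open>1\<close> and carry \<open>b\<close> along.\<close>

lemma flow_att:
  assumes w: "\<omega> \<in> space M"
  shows "\<phi> t \<omega> ` att \<omega> = att (\<theta> t \<omega>)"
proof (intro set_eqI iffI)
  fix y assume "y \<in> \<phi> t \<omega> ` att \<omega>"
  then obtain x where x: "x \<in> att \<omega>" "y = \<phi> t \<omega> x" by auto
  have y: "y = (\<chi> i. \<phi>c i t \<omega> (x $ i))"
    using x att_subset_cube[OF w] by (simp add: flow_coordinates[OF w] subset_iff)
  have "y $ i \<in> {0, b (\<theta> t \<omega>) $ i, 1}" for i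
  proof -
    have "x $ i = 0 \<or> x $ i = b \<omega> $ i \<or> x $ i = 1" using x(1) by (auto simp: att_eq)
    then show ?thesis
      by (elim disjE) (simp_all add: y b_equivariant[OF w] coordinate_endpoints[OF w])
  qed
  then show "y \<in> att (\<theta> t \<omega>)" unfolding att_eq by blast
next
  fix y assume y: "y \<in> att (\<theta> t \<omega>)"
  define x where "x = (\<chi> i. if y $ i = 0 then 0 else if y $ i = 1 then 1 else b \<omega> $ i)"
  have x: "x \<in> att \<omega>" unfolding att_eq by (simp add: x_def)
  have "y $ i = \<phi>c i t \<omega> (x $ i)" for i
    using y unfolding att_eq x_def by (auto simp: b_equivariant[OF w] coordinate_endpoints[OF w])
  then have "y = \<phi> t \<omega> x"
    using x att_subset_cube[OF w] by (subst flow_coordinates[OF w]) (auto simp: vec_eq_iff)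
  then show "y \<in> \<phi> t \<omega> ` att \<omega>" using x by blast
qed

lemma strictly_invariant_att: "strictly_invariant M \<theta>bar \<phi>bar att"
  unfolding strictly_invariant_def
proof (intro allI AE_I2)
  fix t \<omega> assume w: "\<omega> \<in> space M"
  have "\<phi>bar t \<omega> ` att \<omega> = \<phi> (- t) \<omega> ` att \<omega>"
    using inverse_flow_eq[OF w] att_subset_cube[OF w] by (intro image_cong) auto
  then show "\<phi>bar t \<omega> ` att \<omega> = att (\<theta> (- t) \<omega>)" by (simp add: flow_att[OF w])
qed

text \<open>The point to which the inverse flow pulls \<open>x\<close>: coordinates on the boundary stay there, interior
  ones move to the coordinate of \<open>b\<close>.\<close>

definition face_limit :: "real ^ 'd \<Rightarrow> (real \<Rightarrow> real ^ 'd) \<Rightarrow> real ^ 'd" where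
  "face_limit x \<omega> = (\<chi> i. if x $ i = 0 \<or> x $ i = 1 then x $ i else b \<omega> $ i)"

lemma face_limit_in_att: "face_limit x \<omega> \<in> att \<omega>"
  by (auto simp: att_eq face_limit_def)

lemma uniform_dist_tendsto_0:
  fixes f g :: "real \<Rightarrow> real ^ 'd"
  assumes "\<And>i. ((\<lambda>t. f t $ i - g t $ i) \<longlongrightarrow> 0) F"
  shows "((\<lambda>t. uniform_dist (f t) (g t)) \<longlongrightarrow> 0) F"
proof -
  have "((\<lambda>t. \<Sum>i\<in>UNIV. \<bar>f t $ i - g t $ i\<bar>) \<longlongrightarrow> (\<Sum>i\<in>(UNIV :: 'd set). \<bar>0\<bar>)) F"
    by (intro tendsto_sum tendsto_rabs assms)
  then have s: "((\<lambda>t. \<Sum>i\<in>UNIV. \<bar>f t $ i - g t $ i\<bar>) \<longlongrightarrow> 0) F" by simp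
  show ?thesis
    using infnorm_le_sum[of "f t - g t" for t] uniform_dist_nonneg
    by (intro Lim_null_comparison[OF _ s]) (auto intro!: always_eventually simp: uniform_dist_def infnorm_pos_le)
qed

lemma pullback_face_limit:
  assumes x: "x \<in> unit_cube"
  shows "AE \<omega> in M. ((\<lambda>t. uniform_dist (\<phi> (- t) (\<theta> t \<omega>) x) (face_limit x \<omega>)) \<longlongrightarrow> 0) at_top"
  using pullback_to_b AE_space
proof eventually_elim
  case (elim \<omega>)
  show ?case
  proof (rule uniform_dist_tendsto_0)
    fix i
    have e: "\<phi> (- t) (\<theta> t \<omega>) x $ i = \<phi>c i (- t) (\<theta> t \<omega>) (x $ i)" for t
      by (simp add: flow_coordinates[OF shift_space[OF elim(2)] x])
    have xi: "0 \<le> x $ i" "x $ i \<le> 1" using x by (auto simp: unit_cube_def)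
    show "((\<lambda>t. \<phi> (- t) (\<theta> t \<omega>) x $ i - face_limit x \<omega> $ i) \<longlongrightarrow> 0) at_top"
    proof (cases "x $ i = 0 \<or> x $ i = 1")
      case True
      then show ?thesis
        unfolding e face_limit_def using coordinate_endpoints[OF shift_space[OF elim(2)]] by auto
    next
      case False
      then have "((\<lambda>t. \<phi>c i (- t) (\<theta> t \<omega>) (x $ i)) \<longlongrightarrow> b \<omega> $ i) at_top" using elim(1) xi by simp
      then show ?thesis unfolding e face_limit_def using False by (simp add: LIM_zero)
    qed
  qed
qed

lemma forward_face_limit:
  assumes x: "x \<in> unit_cube"
  shows "AE \<omega> in M. ((\<lambda>t. uniform_dist (\<phi> (- t) \<omega> x) (face_limit x (\<theta> (- t) \<omega>))) \<longlongrightarrow> 0) at_top"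
proof -
  have xi: "0 \<le> x $ i" "x $ i \<le> 1" for i using x by (auto simp: unit_cube_def)
  have "AE \<omega> in M. \<forall>i. 0 < x $ i \<and> x $ i < 1 \<longrightarrow> ((\<lambda>t. \<phi>c i (- t) \<omega> (x $ i) - b (\<theta> (- t) \<omega>) $ i) \<longlongrightarrow> 0) at_top"
  proof (rule eventually_all_finite)
    fix i
    show "AE \<omega> in M. 0 < x $ i \<and> x $ i < 1 \<longrightarrow> ((\<lambda>t. \<phi>c i (- t) \<omega> (x $ i) - b (\<theta> (- t) \<omega>) $ i) \<longlongrightarrow> 0) at_top"
      using forward_to_b[of "x $ i" i] by (cases "0 < x $ i \<and> x $ i < 1") auto
  qed
  then show ?thesis
    using AE_space
  proof eventually_elim
    case (elim \<omega>)
    show ?case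
    proof (rule uniform_dist_tendsto_0)
      fix i
      have e: "\<phi> (- t) \<omega> x $ i = \<phi>c i (- t) \<omega> (x $ i)" for t
        by (simp add: flow_coordinates[OF elim(2) x])
      show "((\<lambda>t. \<phi> (- t) \<omega> x $ i - face_limit x (\<theta> (- t) \<omega>) $ i) \<longlongrightarrow> 0) at_top"
      proof (cases "x $ i = 0 \<or> x $ i = 1")
        case True
        then show ?thesis unfolding e face_limit_def using coordinate_endpoints[OF elim(2)] by auto
      next
        case False
        then show ?thesis unfolding e face_limit_def using elim(1) xi[of i] by simp
      qed
    qed
  qed
qed

lemma inverse_flow_image:
  assumes "\<omega> \<in> space M" "x \<in> unit_cube"
  shows "\<phi>bar t \<omega> ` {x} = {\<phi> (- t) \<omega> x}"
  using inverse_flow_eq[OF assms] by simp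

lemma singletonsE:
  assumes "C \<in> singletons E"
  obtains x where "x \<in> E" "C = {x}"
  using assms by (auto simp: singletons_def)

lemma set_dist_face_limit: "set_dist uniform_dist {y} (att \<omega>) \<le> uniform_dist y (face_limit x \<omega>)"
  by (rule set_dist_le[OF face_limit_in_att])

lemma forward_attractor_att: "point_attractor forward_attractor att"
  unfolding forward_attractor_def
proof (intro conjI ballI compact_random_set_att strictly_invariant_att)
  fix C :: "(real ^ 'd) set" assume "C \<in> singletons unit_cube"
  then obtain x where x: "x \<in> unit_cube" "C = {x}" by (rule singletonsE)
  show "AE \<omega> in M. ((\<lambda>t. set_dist uniform_dist (\<phi>bar t \<omega> ` C) (att (\<theta> (- t) \<omega>))) \<longlongrightarrow> 0) at_top"
    using forward_face_limit[OF x(1)] AE_space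
  proof eventually_elim
    case (elim \<omega>)
    show ?case
      unfolding x(2) inverse_flow_image[OF elim(2) x(1)]
      by (rule tendsto_sandwich[OF _ _ tendsto_const elim(1)])
        (auto intro!: always_eventually set_dist_nonneg att_nonempty set_dist_face_limit)
  qed
qed

lemma pullback_attractor_att: "point_attractor pullback_attractor att"
  unfolding pullback_attractor_def
proof (intro conjI ballI compact_random_set_att strictly_invariant_att)
  fix C :: "(real ^ 'd) set" assume "C \<in> singletons unit_cube"
  then obtain x where x: "x \<in> unit_cube" "C = {x}" by (rule singletonsE)
  show "AE \<omega> in M. ((\<lambda>t. set_dist uniform_dist (\<phi>bar t (\<theta> (- (- t)) \<omega>) ` C) (att \<omega>)) \<longlongrightarrow> 0) at_top"
    using pullback_face_limit[OF x(1)] AE_space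
  proof eventually_elim
    case (elim \<omega>)
    show ?case
      unfolding x(2) minus_minus inverse_flow_image[OF shift_space[OF elim(2)] x(1)]
      by (rule tendsto_sandwich[OF _ _ tendsto_const elim(1)])
        (auto intro!: always_eventually set_dist_nonneg att_nonempty set_dist_face_limit)
  qed
qed

text \<open>All three kinds of attraction are statements about this function: it tends to \<open>0\<close> along \<open>\<omega>\<close>, along
  the shifted points \<open>\<theta> t \<omega>\<close>, or in probability.\<close>

definition gap :: "((real \<Rightarrow> real ^ 'd) \<Rightarrow> (real ^ 'd) set) \<Rightarrow> real ^ 'd \<Rightarrow> real \<Rightarrow> (real \<Rightarrow> real ^ 'd) \<Rightarrow> real" where
  "gap B x t \<omega> = set_dist uniform_dist {\<phi> (- t) \<omega> x} (B (\<theta> (- t) \<omega>))"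

lemma flow_vec_measurable: "x \<in> unit_cube \<Longrightarrow> (\<lambda>\<omega>. \<phi> t \<omega> x) \<in> borel_measurable M"
  using flow_measurable by (intro borel_measurable_vecI)

lemma gap_measurable:
  assumes B: "compact_random_set M unit_cube uniform_dist B" and x: "x \<in> unit_cube"
  shows "gap B x t \<in> borel_measurable M"
  unfolding gap_def
proof (rule set_dist_random_point_measurable)
  show "(\<lambda>\<omega>. set_dist uniform_dist {y} (B (\<theta> (- t) \<omega>))) \<in> borel_measurable M" if "y \<in> unit_cube" for y
    using B that by (intro measurable_compose[OF shift_measurable]) (auto simp: compact_random_set_def)
  show "B (\<theta> (- t) \<omega>) \<noteq> {}" if "\<omega> \<in> space M" for \<omega>
    using B shift_space[OF that] by (auto simp: compact_random_set_def)
qed (use x flow_in_cube flow_vec_measurable in auto)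

lemma gap_eq: "\<omega> \<in> space M \<Longrightarrow> x \<in> unit_cube \<Longrightarrow> set_dist uniform_dist (\<phi>bar t \<omega> ` {x}) (B (\<theta> (- t) \<omega>)) = gap B x t \<omega>"
  unfolding gap_def by (simp only: inverse_flow_image)

lemma gap_shift:
  "\<omega> \<in> space M \<Longrightarrow> gap B x t (\<theta> t \<omega>) = set_dist uniform_dist {\<phi> (- t) (\<theta> t \<omega>) x} (B \<omega>)"
  unfolding gap_def by (simp add: shift_add shift_0)

lemma AE_tendsto_0_imp_prob_real:
  fixes X :: "real \<Rightarrow> (real \<Rightarrow> real ^ 'd) \<Rightarrow> real"
  assumes "\<And>t. X t \<in> borel_measurable M" and lim: "AE \<omega> in M. ((\<lambda>t. X t \<omega>) \<longlongrightarrow> 0) at_top" and e: "0 < e"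
  shows "((\<lambda>t. prob {\<omega>\<in>space M. \<bar>X t \<omega>\<bar> > e}) \<longlongrightarrow> 0) at_top"
proof (rule tendsto_at_topI_sequentially)
  fix T :: "nat \<Rightarrow> real" assume T: "filterlim T at_top sequentially"
  have "AE \<omega> in M. (\<lambda>n. X (T n) \<omega>) \<longlonglongrightarrow> 0"
    using lim by eventually_elim (rule filterlim_compose[OF _ T])
  then show "(\<lambda>n. prob {\<omega>\<in>space M. \<bar>X (T n) \<omega>\<bar> > e}) \<longlonglongrightarrow> 0"
    by (intro AE_tendsto_0_imp_prob assms) auto
qed

text \<open>Attractors of all three types attract points in probability: for pullback attractors this is
  the invariance of the measure under the shift.\<close>

lemma forward_attractor_gap:
  assumes B: "point_attractor forward_attractor B"
    and x: "x \<in> unit_cube" and e: "0 < e"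
  shows "((\<lambda>t. prob {\<omega>\<in>space M. \<bar>gap B x t \<omega>\<bar> > e}) \<longlongrightarrow> 0) at_top"
proof (rule AE_tendsto_0_imp_prob_real[OF _ _ e])
  show "gap B x t \<in> borel_measurable M" for t
    using B x by (intro gap_measurable) (auto simp: forward_attractor_def)
  have "AE \<omega> in M. ((\<lambda>t. set_dist uniform_dist (\<phi>bar t \<omega> ` {x}) (B (\<theta> (- t) \<omega>))) \<longlongrightarrow> 0) at_top"
    using B x unfolding forward_attractor_def singletons_def by blast
  then show "AE \<omega> in M. ((\<lambda>t. gap B x t \<omega>) \<longlongrightarrow> 0) at_top"
    using AE_space by eventually_elim (simp only: gap_eq[OF _ x])
qed

lemma pullback_attractor_gap:
  assumes B: "point_attractor pullback_attractor B"
    and x: "x \<in> unit_cube" and e: "0 < e"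
  shows "((\<lambda>t. prob {\<omega>\<in>space M. \<bar>gap B x t \<omega>\<bar> > e}) \<longlongrightarrow> 0) at_top"
proof -
  have gm [measurable]: "gap B x t \<in> borel_measurable M" for t
    using B x by (intro gap_measurable) (auto simp: pullback_attractor_def)
  have "AE \<omega> in M. ((\<lambda>t. set_dist uniform_dist (\<phi>bar t (\<theta> (- (- t)) \<omega>) ` {x}) (B \<omega>)) \<longlongrightarrow> 0) at_top"
    using B x unfolding pullback_attractor_def singletons_def by blast
  then have "AE \<omega> in M. ((\<lambda>t. gap B x t (\<theta> t \<omega>)) \<longlongrightarrow> 0) at_top"
    using AE_space by eventually_elim (simp only: minus_minus inverse_flow_image[OF shift_space x] gap_shift)
  then have "((\<lambda>t. prob {\<omega>\<in>space M. \<bar>gap B x t (\<theta> t \<omega>)\<bar> > e}) \<longlongrightarrow> 0) at_top"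
    by (intro AE_tendsto_0_imp_prob_real[OF _ _ e]) (auto intro: measurable_compose[OF shift_measurable gm])
  moreover have "prob {\<omega>\<in>space M. \<bar>gap B x t (\<theta> t \<omega>)\<bar> > e} = prob {\<omega>\<in>space M. \<bar>gap B x t \<omega>\<bar> > e}" for t
    by (rule prob_shift[where P = "\<lambda>\<omega>. \<bar>gap B x t \<omega>\<bar> > e"]) measurable
  ultimately show ?thesis by simp
qed

lemma weak_attractor_gap:
  assumes B: "point_attractor weak_attractor B"
    and x: "x \<in> unit_cube" and e: "0 < e"
  shows "((\<lambda>t. prob {\<omega>\<in>space M. \<bar>gap B x t \<omega>\<bar> > e}) \<longlongrightarrow> 0) at_top"
proof -
  have "tendsto_in_probability M (\<lambda>t \<omega>. set_dist uniform_dist (\<phi>bar t \<omega> ` {x}) (B (\<theta> (- t) \<omega>))) 0"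
    using B x unfolding weak_attractor_def singletons_def by blast
  then have "((\<lambda>t. prob {\<omega>\<in>space M. \<bar>set_dist uniform_dist (\<phi>bar t \<omega> ` {x}) (B (\<theta> (- t) \<omega>)) - 0\<bar> > e}) \<longlongrightarrow> 0) at_top"
    using e unfolding tendsto_in_probability_def by blast
  moreover have "{\<omega>\<in>space M. \<bar>set_dist uniform_dist (\<phi>bar t \<omega> ` {x}) (B (\<theta> (- t) \<omega>)) - 0\<bar> > e} =
      {\<omega>\<in>space M. \<bar>gap B x t \<omega>\<bar> > e}" for t
    using gap_eq[OF _ x, of _ t B] by (intro Collect_cong conj_cong) (simp_all only: diff_zero)
  ultimately show ?thesis by simp
qed

lemma weak_attractor_att: "point_attractor weak_attractor att"
  unfolding weak_attractor_def
proof (intro conjI ballI compact_random_set_att strictly_invariant_att)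
  fix C :: "(real ^ 'd) set" assume "C \<in> singletons unit_cube"
  then obtain x where x: "x \<in> unit_cube" "C = {x}" by (rule singletonsE)
  show "tendsto_in_probability M (\<lambda>t \<omega>. set_dist uniform_dist (\<phi>bar t \<omega> ` C) (att (\<theta> (- t) \<omega>))) 0"
    unfolding tendsto_in_probability_def x(2)
  proof (intro conjI allI impI)
    fix t :: real
    have "(\<lambda>\<omega>. set_dist uniform_dist (\<phi>bar t \<omega> ` {x}) (att (\<theta> (- t) \<omega>))) \<in> borel_measurable M \<longleftrightarrow> gap att x t \<in> borel_measurable M"
      by (rule measurable_cong) (rule gap_eq[OF _ x(1)])
    then show "(\<lambda>\<omega>. set_dist uniform_dist (\<phi>bar t \<omega> ` {x}) (att (\<theta> (- t) \<omega>))) \<in> borel_measurable M"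
      using gap_measurable[OF compact_random_set_att x(1)] by blast
  next
    fix e :: real assume e: "0 < e"
    have "{\<omega>\<in>space M. \<bar>set_dist uniform_dist (\<phi>bar t \<omega> ` {x}) (att (\<theta> (- t) \<omega>)) - 0\<bar> > e} =
      {\<omega>\<in>space M. \<bar>gap att x t \<omega>\<bar> > e}" for t
      using gap_eq[OF _ x(1), of _ t att] by (intro Collect_cong conj_cong) (simp_all only: diff_zero)
    then show "((\<lambda>t. prob {\<omega>\<in>space M. \<bar>set_dist uniform_dist (\<phi>bar t \<omega> ` {x}) (att (\<theta> (- t) \<omega>)) - 0\<bar> > e}) \<longlongrightarrow> 0) at_top"
      using forward_attractor_gap[OF forward_attractor_att x(1) e] by simp
  qed
qed

text \<open>Every face \<open>\<Gamma>\<^sub>\<alpha>\<close> contains a point that the inverse flow pulls to \<open>P\<^sub>\<alpha> b\<close>. By shift invariance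
  the pulled point is close to \<open>B \<omega>\<close> with high probability, so \<open>P\<^sub>\<alpha> b\<close> has distance \<open>0\<close> from the closed
  set \<open>B \<omega>\<close>.\<close>

lemma att_minimal:
  assumes B: "compact_random_set M unit_cube uniform_dist B"
    and gap: "\<And>x e. x \<in> unit_cube \<Longrightarrow> 0 < e \<Longrightarrow> ((\<lambda>t. prob {\<omega>\<in>space M. \<bar>gap B x t \<omega>\<bar> > e}) \<longlongrightarrow> 0) at_top"
  shows "AE \<omega> in M. att \<omega> \<subseteq> B \<omega>"
proof -
  have Bne: "B \<omega> \<noteq> {}" if "\<omega> \<in> space M" for \<omega> using B that by (simp add: compact_random_set_def)
  have main: "AE \<omega> in M. face_limit x \<omega> \<in> B \<omega>" if x: "x \<in> unit_cube" for x
  proof -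
    define p where "p \<omega> = set_dist uniform_dist {face_limit x \<omega>} (B \<omega>)" for \<omega>
    define Y where "Y t \<omega> = uniform_dist (\<phi> (- t) (\<theta> t \<omega>) x) (face_limit x \<omega>)" for t \<omega>
    have cube: "face_limit x \<omega> \<in> unit_cube" if "\<omega> \<in> space M" for \<omega>
      using face_limit_in_att att_subset_cube[OF that] by blast
    have fm [measurable]: "face_limit x \<in> borel_measurable M"
    proof (rule borel_measurable_vecI)
      show "(\<lambda>\<omega>. face_limit x \<omega> $ i) \<in> borel_measurable M" for i
        using b_coordinate_measurable[of i] by (cases "x $ i = 0 \<or> x $ i = 1") (auto simp: face_limit_def)
    qed
    have [measurable]: "p \<in> borel_measurable M"
      unfolding p_def
    proof (rule set_dist_random_point_measurable[OF fm cube Bne])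
      show "(\<lambda>\<omega>. set_dist uniform_dist {y} (B \<omega>)) \<in> borel_measurable M" if "y \<in> unit_cube" for y
        using B that by (simp add: compact_random_set_def)
    qed
    have [measurable]: "(\<lambda>\<omega>. \<phi> (- t) (\<theta> t \<omega>) x) \<in> borel_measurable M" for t
      by (rule measurable_compose[OF shift_measurable flow_vec_measurable[OF x]])
    have Ym [measurable]: "Y t \<in> borel_measurable M" for t unfolding Y_def by measurable
    have gm [measurable]: "gap B x t \<in> borel_measurable M" for t by (rule gap_measurable[OF B x])
    have gsm [measurable]: "(\<lambda>\<omega>. gap B x t (\<theta> t \<omega>)) \<in> borel_measurable M" for t
      by (rule measurable_compose[OF shift_measurable gm])
    have null: "prob {\<omega>\<in>space M. 2 * e < p \<omega>} = 0" if e: "0 < e" for e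
    proof -
      have "AE \<omega> in M. ((\<lambda>t. Y t \<omega>) \<longlongrightarrow> 0) at_top" unfolding Y_def by (rule pullback_face_limit[OF x])
      then have "((\<lambda>t. prob {\<omega>\<in>space M. \<bar>Y t \<omega>\<bar> > e}) \<longlongrightarrow> 0) at_top"
        by (rule AE_tendsto_0_imp_prob_real[OF Ym _ e])
      moreover have "((\<lambda>t. prob {\<omega>\<in>space M. \<bar>gap B x t (\<theta> t \<omega>)\<bar> > e}) \<longlongrightarrow> 0) at_top"
      proof -
        have "prob {\<omega>\<in>space M. \<bar>gap B x t (\<theta> t \<omega>)\<bar> > e} = prob {\<omega>\<in>space M. \<bar>gap B x t \<omega>\<bar> > e}" for t
          by (rule prob_shift[where P = "\<lambda>\<omega>. \<bar>gap B x t \<omega>\<bar> > e"]) measurable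
        then show ?thesis using gap[OF x e] by simp
      qed
      ultimately have lim: "((\<lambda>t. prob {\<omega>\<in>space M. \<bar>Y t \<omega>\<bar> > e} + prob {\<omega>\<in>space M. \<bar>gap B x t (\<theta> t \<omega>)\<bar> > e}) \<longlongrightarrow> 0 + 0) at_top"
        by (rule tendsto_add)
      have "prob {\<omega>\<in>space M. 2 * e < p \<omega>} \<le> prob {\<omega>\<in>space M. \<bar>Y t \<omega>\<bar> > e} + prob {\<omega>\<in>space M. \<bar>gap B x t (\<theta> t \<omega>)\<bar> > e}" for t
      proof -
        have "prob {\<omega>\<in>space M. 2 * e < p \<omega>} \<le> prob ({\<omega>\<in>space M. \<bar>Y t \<omega>\<bar> > e} \<union> {\<omega>\<in>space M. \<bar>gap B x t (\<theta> t \<omega>)\<bar> > e})"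
        proof (rule finite_measure_mono)
          show "{\<omega>\<in>space M. 2 * e < p \<omega>} \<subseteq> {\<omega>\<in>space M. \<bar>Y t \<omega>\<bar> > e} \<union> {\<omega>\<in>space M. \<bar>gap B x t (\<theta> t \<omega>)\<bar> > e}"
          proof
            fix \<omega> assume w: "\<omega> \<in> {\<omega>\<in>space M. 2 * e < p \<omega>}"
            then have ws: "\<omega> \<in> space M" by simp
            have "p \<omega> \<le> Y t \<omega> + gap B x t (\<theta> t \<omega>)"
              unfolding p_def Y_def gap_shift[OF ws]
              using set_dist_triangle[OF Bne[OF ws]] by (subst uniform_dist_sym)
            then have "e < Y t \<omega> \<or> e < gap B x t (\<theta> t \<omega>)" using w by force
            then show "\<omega> \<in> {\<omega>\<in>space M. \<bar>Y t \<omega>\<bar> > e} \<union> {\<omega>\<in>space M. \<bar>gap B x t (\<theta> t \<omega>)\<bar> > e}"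
              using ws by (auto intro: less_le_trans[OF _ abs_ge_self])
          qed
        qed measurable
        also have "\<dots> \<le> prob {\<omega>\<in>space M. \<bar>Y t \<omega>\<bar> > e} + prob {\<omega>\<in>space M. \<bar>gap B x t (\<theta> t \<omega>)\<bar> > e}"
          by (rule measure_Un_le) measurable
        finally show ?thesis .
      qed
      then have "prob {\<omega>\<in>space M. 2 * e < p \<omega>} \<le> 0 + 0"
        by (intro tendsto_lowerbound[OF lim] always_eventually allI) auto
      then show ?thesis using measure_nonneg[of M "{\<omega>\<in>space M. 2 * e < p \<omega>}"] by linarith
    qed
    have "AE \<omega> in M. \<forall>m::nat. \<not> 2 * (1 / real (Suc m)) < p \<omega>"
      unfolding AE_all_countable
    proof
      fix m :: nat
      show "AE \<omega> in M. \<not> 2 * (1 / real (Suc m)) < p \<omega>"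
        using null[of "1 / real (Suc m)"] by (subst AE_iff_measurable[OF _ refl]) (auto simp: emeasure_eq_measure)
    qed
    then show ?thesis
      using AE_space
    proof eventually_elim
      case (elim \<omega>)
      have p0: "p \<omega> < r" if r: "0 < r" for r
      proof -
        have "0 < r / 2" using r by simp
        then obtain m :: nat where "1 / real (Suc m) < r / 2" by (metis nat_approx_posE)
        moreover have "p \<omega> \<le> 2 * (1 / real (Suc m))" using elim(1) by (simp only: not_less)
        ultimately show ?thesis by linarith
      qed
      have "compactin cube.mtopology (B \<omega>)" using B elim(2) by (simp add: compact_random_set_def)
      then have cl: "closedin cube.mtopology (B \<omega>)"
        by (rule compactin_imp_closedin[OF cube.Hausdorff_space_mtopology])
      show ?case
      proof (rule ccontr)
        assume n: "face_limit x \<omega> \<notin> B \<omega>"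
        have "openin cube.mtopology (unit_cube - B \<omega>)" using cl by (simp add: closedin_def)
        then obtain r where r: "0 < r" "cube.mball (face_limit x \<omega>) r \<subseteq> unit_cube - B \<omega>"
          using n cube[OF elim(2)] unfolding cube.openin_mtopology by blast
        obtain z where z: "z \<in> B \<omega>" "uniform_dist (face_limit x \<omega>) z < r"
          using p0[OF r(1)] set_dist_less_iff[OF Bne[OF elim(2)]] unfolding p_def by blast
        have "z \<in> unit_cube" using closedin_subset[OF cl] z(1) by auto
        then have "z \<in> cube.mball (face_limit x \<omega>) r" using z(2) cube[OF elim(2)] by (simp add: cube.in_mball)
        then show False using r(2) z(1) by blast
      qed
    qed
  qed
  have fin: "finite {\<alpha> :: int ^ 'd. \<forall>i. \<alpha> $ i \<in> {-1, 0, 1}}" by (rule finite_vec_product) simp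
  have "AE \<omega> in M. \<forall>\<alpha>\<in>{\<alpha> :: int ^ 'd. \<forall>i. \<alpha> $ i \<in> {-1, 0, 1}}. face_proj \<alpha> (b \<omega>) \<in> B \<omega>"
  proof (rule AE_finite_allI[OF fin])
    fix \<alpha> :: "int ^ 'd" assume \<alpha>: "\<alpha> \<in> {\<alpha>. \<forall>i. \<alpha> $ i \<in> {-1, 0, 1}}"
    \<comment> \<open>A point of the relative interior of the face; any value in \<open>(0, 1)\<close> would serve for the free
        coordinates.\<close>
    define x :: "real ^ 'd" where "x = face_proj \<alpha> (\<chi> i. 1 / 2)"
    have \<alpha>i: "\<alpha> $ i = -1 \<or> \<alpha> $ i = 0 \<or> \<alpha> $ i = 1" for i using \<alpha> by auto
    have "0 \<le> x $ i \<and> x $ i \<le> 1" for i using \<alpha>i[of i] by (auto simp: x_def face_proj_def)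
    then have "x \<in> unit_cube" by (simp add: unit_cube_def)
    moreover have "face_limit x \<omega> = face_proj \<alpha> (b \<omega>)" for \<omega>
    proof -
      have "face_limit x \<omega> $ i = face_proj \<alpha> (b \<omega>) $ i" for i
        using \<alpha>i[of i] by (auto simp: x_def face_proj_def face_limit_def)
      then show ?thesis by (simp add: vec_eq_iff)
    qed
    ultimately show "AE \<omega> in M. face_proj \<alpha> (b \<omega>) \<in> B \<omega>" using main[of x] by simp
  qed
  then show ?thesis by eventually_elim (auto simp: att_def)
qed

theorem minimal_attractors:
  "minimal_among M (point_attractor forward_attractor) att"
  "minimal_among M (point_attractor pullback_attractor) att"
  "minimal_among M (point_attractor weak_attractor) att"
proof -
  show "minimal_among M (point_attractor forward_attractor) att"
    unfolding minimal_among_def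
  proof (intro conjI allI impI forward_attractor_att)
    fix B assume B: "point_attractor forward_attractor B"
    show "AE \<omega> in M. att \<omega> \<subseteq> B \<omega>"
      by (rule att_minimal[OF _ forward_attractor_gap[OF B]]) (use B in \<open>simp_all add: forward_attractor_def\<close>)
  qed
  show "minimal_among M (point_attractor pullback_attractor) att"
    unfolding minimal_among_def
  proof (intro conjI allI impI pullback_attractor_att)
    fix B assume B: "point_attractor pullback_attractor B"
    show "AE \<omega> in M. att \<omega> \<subseteq> B \<omega>"
      by (rule att_minimal[OF _ pullback_attractor_gap[OF B]]) (use B in \<open>simp_all add: pullback_attractor_def\<close>)
  qed
  show "minimal_among M (point_attractor weak_attractor) att"
    unfolding minimal_among_def
  proof (intro conjI allI impI weak_attractor_att)
    fix B assume B: "point_attractor weak_attractor B"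
    show "AE \<omega> in M. att \<omega> \<subseteq> B \<omega>"
      by (rule att_minimal[OF _ weak_attractor_gap[OF B]]) (use B in \<open>simp_all add: weak_attractor_def\<close>)
  qed
qed

end

theorem theorem3p3:
  fixes M :: "(real \<Rightarrow> real ^ 'd) measure"
    and \<phi> :: "real \<Rightarrow> (real \<Rightarrow> real ^ 'd) \<Rightarrow> real ^ 'd \<Rightarrow> real ^ 'd"
    and \<phi>c :: "'d \<Rightarrow> real \<Rightarrow> (real \<Rightarrow> real ^ 'd) \<Rightarrow> real \<Rightarrow> real"
    and \<theta>bar :: "real \<Rightarrow> (real \<Rightarrow> real ^ 'd) \<Rightarrow> (real \<Rightarrow> real ^ 'd)"
    and \<phi>bar :: "real \<Rightarrow> (real \<Rightarrow> real ^ 'd) \<Rightarrow> real ^ 'd \<Rightarrow> real ^ 'd"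
    and b :: "(real \<Rightarrow> real ^ 'd) \<Rightarrow> real ^ 'd"
    and A :: "(real \<Rightarrow> real ^ 'd) \<Rightarrow> (real ^ 'd) set"
  assumes "wiener_space M"
    and "generated_rds M \<phi> \<phi>c"
  defines "\<theta>bar \<equiv> \<lambda>t. wiener_shift (- t)"
    and "\<phi>bar \<equiv> inverse_flow wiener_shift unit_cube \<phi>"
    and "b \<equiv> basin_point \<phi>c"
    and "A \<equiv> \<lambda>\<omega>. {face_proj \<alpha> (b \<omega>) | \<alpha>. \<forall>i. \<alpha> $ i \<in> {-1, 0, 1}}"
  shows "minimal_among M
           (forward_attractor M \<theta>bar unit_cube uniform_dist \<phi>bar (singletons unit_cube)) A \<and>
         minimal_among M
           (pullback_attractor M \<theta>bar unit_cube uniform_dist \<phi>bar (singletons unit_cube)) A \<and>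
         minimal_among M
           (weak_attractor M \<theta>bar unit_cube uniform_dist \<phi>bar (singletons unit_cube)) A \<and>
         b \<in> borel_measurable M \<and>
         distr M borel b = uniform_measure lborel {x. \<forall>i. 0 < x $ i \<and> x $ i < 1}"
proof -
  interpret logistic_flow M \<phi> \<phi>c
    by unfold_locales (rule assms)+
  have A: "A = att" unfolding A_def att_def b_def by (rule refl)
  show ?thesis
    unfolding A \<theta>bar_def \<phi>bar_def b_def
    by (intro conjI minimal_attractors b_measurable b_distribution)
qed

end
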